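(* Fix $s>2$ and assume that $\theta_0\in H^s(\mathbb{T}^2)$ has zero mean on $\mathbb{T}^2$. Let $T>0$ and let $\theta^0\in L^\infty(0,T;H^s(\mathbb{T}^2))$ be the unique smooth solution to (IPMB$_0$) on $[0,T]$ given by local wellposedness in $H^s$, and for $\nu>0$ let $\theta^\nu$ be the $H^s$ solution to (IPMB$_\nu$) with the same initial datum $\theta_0$ on $[0,T]$. Then for $t\in[0,T]$, $$\lim_{\nu\to0}\|(\theta^\nu-\theta^0)(\cdot,t)\|_{H^{s-1}}=0.$$
   Context: Setting. $\mathbb{T}^2=[0,2\pi]^2$ with periodic boundary conditions. For $\nu\ge0$, (IPMB$_\nu$) denotes the incompressible porous media Brinkman problem $$\partial_t\theta^\nu+(u^\nu\cdot\nabla)\theta^\nu=0,\qquad u^\nu=M^\nu[\theta^\nu],\qquad\theta^\nu(x,0)=\theta_0(x),$$ where $M^\nu=(M^\nu_1,M^\nu_2)$ is the Fourier multiplier operator with symbols, for $k=(k_1,k_2)\in\mathbb{Z}^2\setminus\{0\}$, $$\widehat M^\nu_1(k)=\frac{1}{1+\nu(k_1^2+k_2^2)}\cdot\frac{k_1k_2}{k_1^2+k_2^2},\qquad \widehat M^\nu_2(k)=\frac{1}{1+\nu(k_1^2+k_2^2)}\cdot\frac{-k_1^2}{k_1^2+k_2^2}.$$ Solutions $\theta^\nu(\cdot,t)$ have zero mean on $\mathbb{T}^2$ for all $t$. $H^s=W^{s,2}$. *)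

theory Defs
  imports "HOL-Analysis.Analysis"
begin

text \<open>
  A function on the torus is a function on \<open>real^2\<close> that is \<open>2 * pi\<close>-periodic in each variable;
  integrals over the torus are Lebesgue integrals over one periodicity cell.
\<close>

definition torus_cell :: "(real^2) set" where
  "torus_cell = {x. \<forall>i. 0 \<le> x $ i \<and> x $ i \<le> 2 * pi}"

definition torus_periodic :: "(real^2 \<Rightarrow> 'a) \<Rightarrow> bool" where
  "torus_periodic f \<longleftrightarrow> (\<forall>x i. f (x + axis i (2 * pi)) = f x)"

definition zero_mean :: "(real^2 \<Rightarrow> real) \<Rightarrow> bool" where
  "zero_mean f \<longleftrightarrow> (LINT x|lebesgue_on torus_cell. f x) = 0"

definition torus_char :: "int \<times> int \<Rightarrow> real^2 \<Rightarrow> complex" where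
  "torus_char k x = cis (real_of_int (fst k) * x $ 1 + real_of_int (snd k) * x $ 2)"

definition fourier_coeff :: "(real^2 \<Rightarrow> real) \<Rightarrow> int \<times> int \<Rightarrow> complex" where
  "fourier_coeff f k =
     (LINT x|lebesgue_on torus_cell. of_real (f x) * cnj (torus_char k x)) / of_real ((2 * pi)\<^sup>2)"

definition freq_sq :: "int \<times> int \<Rightarrow> real" where
  "freq_sq k = (real_of_int (fst k))\<^sup>2 + (real_of_int (snd k))\<^sup>2"

definition torus_L2 :: "(real^2 \<Rightarrow> real) \<Rightarrow> bool" where
  "torus_L2 f \<longleftrightarrow> torus_periodic f \<and> f \<in> borel_measurable (lebesgue_on torus_cell) \<and>
     integrable (lebesgue_on torus_cell) (\<lambda>x. (f x)\<^sup>2)"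

text \<open>
  The Sobolev space \<open>H\<^sup>s = W\<^sup>s\<^sup>,\<^sup>2\<close> of order \<open>s \<ge> 0\<close>. The norm \<open>sobolev_norm s f\<close> is meaningful
  only when \<open>in_sobolev s f\<close> holds, because \<open>infsum\<close> is \<open>0\<close> on families that are not summable.
\<close>

definition in_sobolev :: "real \<Rightarrow> (real^2 \<Rightarrow> real) \<Rightarrow> bool" where
  "in_sobolev s f \<longleftrightarrow> torus_L2 f \<and>
     (\<lambda>k. (1 + freq_sq k) powr s * (cmod (fourier_coeff f k))\<^sup>2) summable_on UNIV"

definition sobolev_norm :: "real \<Rightarrow> (real^2 \<Rightarrow> real) \<Rightarrow> real" where
  "sobolev_norm s f =
     sqrt (\<Sum>\<^sub>\<infinity>k\<in>UNIV. (1 + freq_sq k) powr s * (cmod (fourier_coeff f k))\<^sup>2)"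

text \<open>
  The class \<open>L\<^sup>\<infinity>(0,T;H\<^sup>s)\<close>, for a representative all of whose time slices lie in \<open>H\<^sup>s\<close>. As \<open>H\<^sup>s\<close> is a
  separable Hilbert space, strong measurability in time amounts to measurability of every
  Fourier coefficient.
\<close>

definition Linfty_sobolev :: "real \<Rightarrow> real \<Rightarrow> (real \<Rightarrow> real^2 \<Rightarrow> real) \<Rightarrow> bool" where
  "Linfty_sobolev s T \<theta> \<longleftrightarrow>
     (\<forall>t\<in>{0..T}. in_sobolev s (\<theta> t)) \<and>
     (\<forall>k. (\<lambda>t. fourier_coeff (\<theta> t) k) \<in> borel_measurable (lebesgue_on {0..T})) \<and>
     (\<exists>C. AE t in lebesgue_on {0..T}. sobolev_norm s (\<theta> t) \<le> C)"

text \<open>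
  The symbols are given only for \<open>k \<noteq> 0\<close>; the value \<open>0\<close> at \<open>k = 0\<close> is immaterial, as the
  operators act on functions of zero mean.
\<close>

definition M1_symbol :: "real \<Rightarrow> int \<times> int \<Rightarrow> real" where
  "M1_symbol \<nu> k = (if k = 0 then 0 else
     1 / (1 + \<nu> * freq_sq k) * (real_of_int (fst k) * real_of_int (snd k) / freq_sq k))"

definition M2_symbol :: "real \<Rightarrow> int \<times> int \<Rightarrow> real" where
  "M2_symbol \<nu> k = (if k = 0 then 0 else
     1 / (1 + \<nu> * freq_sq k) * (- (real_of_int (fst k))\<^sup>2 / freq_sq k))"

text \<open>
  The operator is evaluated pointwise through its Fourier series, which converges absolutely for
  a bounded symbol and \<open>f\<close> in \<open>H\<^sup>s\<close> with \<open>s > 1\<close>. For a real even symbol and a real \<open>f\<close> the sum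
  is real, so that \<open>Re\<close> only changes the type.
\<close>

definition fourier_multiplier ::
    "(int \<times> int \<Rightarrow> real) \<Rightarrow> (real^2 \<Rightarrow> real) \<Rightarrow> real^2 \<Rightarrow> real" where
  "fourier_multiplier m f x =
     Re (\<Sum>\<^sub>\<infinity>k\<in>UNIV. of_real (m k) * fourier_coeff f k * torus_char k x)"

definition brinkman_velocity :: "real \<Rightarrow> (real^2 \<Rightarrow> real) \<Rightarrow> real^2 \<Rightarrow> real^2" where
  "brinkman_velocity \<nu> f x =
     vector [fourier_multiplier (M1_symbol \<nu>) f x, fourier_multiplier (M2_symbol \<nu>) f x]"

text \<open>
  A solution of class \<open>H\<^sup>s\<close> on \<open>[0,T]\<close>, intended for \<open>s > 2\<close>. Then \<open>H\<^sup>s\<close> embeds into \<open>C\<^sup>1\<close> and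
  \<open>(u \<cdot> \<nabla>)\<theta>\<close> is continuous, so the equation is imposed classically (one-sided in time at the end
  points) on the differentiable representative. The Frechet derivative of \<open>\<theta> t\<close> at \<open>x\<close> applied to
  \<open>u\<close> is \<open>(u \<cdot> \<nabla>)\<theta>\<close>. The initial datum is an \<open>H\<^sup>s\<close> class, hence attained almost everywhere.
\<close>

definition IPMB_solution ::
    "real \<Rightarrow> real \<Rightarrow> real \<Rightarrow> (real^2 \<Rightarrow> real) \<Rightarrow> (real \<Rightarrow> real^2 \<Rightarrow> real) \<Rightarrow> bool" where
  "IPMB_solution \<nu> s T \<theta>0 \<theta> \<longleftrightarrow>
     Linfty_sobolev s T \<theta> \<and>
     (\<forall>t\<in>{0..T}. zero_mean (\<theta> t)) \<and>
     (AE x in lebesgue. \<theta> 0 x = \<theta>0 x) \<and>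
     (\<forall>t\<in>{0..T}. \<forall>x.
        \<theta> t differentiable (at x) \<and>
        ((\<lambda>\<tau>. \<theta> \<tau> x) has_real_derivative
           - frechet_derivative (\<theta> t) (at x) (brinkman_velocity \<nu> (\<theta> t) x))
          (at t within {0..T}))"

end

theory Submission
  imports Defs
begin

text \<open>
  Let \<open>a(t)\<close> be the sequence of Fourier coefficients of a solution \<open>\<theta>(t)\<close>. The equation becomes
  \<open>a\<^sub>k' = - \<Sum>\<^sub>l i (M(k - l) \<bullet> l) a\<^sub>k\<^sub>-\<^sub>l a\<^sub>l\<close>, and the theorem becomes a statement about sequences.
  The symbol \<open>M\<close> of the velocity is even, satisfies \<open>M(j) \<bullet> j = 0\<close> (the velocity is divergence free) and
  is bounded by \<open>1\<close> for every \<open>\<nu>\<close>. The first two properties make transport antisymmetric, so an energy with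
  weights \<open>\<phi>(k)\<^sup>2\<close> only feels the differences \<open>\<phi>(k) - \<phi>(l)\<close> (\<open>transport_cancellation\<close>). This is used
  twice. Write \<open>W(a) = \<Sum>\<^sub>k (1 + k\<^sup>2)\<^sup>1\<^sup>/\<^sup>2 |a\<^sub>k|\<close>, a norm which controls the gradients of \<open>\<theta>\<close> and of
  the velocity.

  \<^item> For the weight of \<open>H\<^sup>s\<close> one gets the tame estimate that the time derivative of
    \<open>\<parallel>\<theta>\<parallel>\<^sup>2\<close> in \<open>H\<^sup>s\<close> is at most \<open>C W(\<theta>) \<parallel>\<theta>\<parallel>\<^sup>2\<close>, with \<open>C\<close> independent of \<open>\<nu>\<close>
    (\<open>sobolev_energy_estimate\<close>, \<open>sobolev_growth\<close>).
  \<^item> For the weight \<open>1\<close>, applied to \<open>w = \<theta>\<^sup>\<nu> - \<theta>\<^sup>0\<close>, one gets \<open>\<parallel>w\<parallel> = O(\<nu>)\<close> in \<open>L\<^sup>2\<close> with a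
    constant that depends on \<open>\<theta>\<^sup>0\<close> and \<open>T\<close> only (\<open>difference_energy_estimate\<close>, \<open>difference_growth\<close>).

  The \<open>H\<^sup>s\<close> bounds contained in the notion of solution may blow up as \<open>\<nu> \<rightarrow> 0\<close>; a bootstrap
  (\<open>coefficient_convergence\<close>) makes them uniform. As long as \<open>W(w) \<le> 1\<close>, the tame estimate bounds
  \<open>\<theta>\<^sup>\<nu>\<close> in \<open>H\<^sup>s\<close> independently of \<open>\<nu>\<close>. Since \<open>s > 2\<close>, the norm \<open>W\<close> is small on sequences that are
  bounded in \<open>H\<^sup>s\<close> and have small low frequencies (\<open>wiener_small\<close>), so the \<open>L\<^sup>2\<close> estimate improves the
  bound to \<open>W(w) \<le> 1/2\<close> once \<open>\<nu>\<close> is small. As \<open>W(w)\<close> is continuous in time and starts from \<open>0\<close>, it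
  never reaches \<open>1\<close>. On all of \<open>[0,T]\<close> the difference \<open>w\<close> is then bounded in \<open>H\<^sup>s\<close> and tends to \<open>0\<close> in
  \<open>L\<^sup>2\<close>, hence tends to \<open>0\<close> in \<open>H\<^sup>s\<^sup>-\<^sup>1\<close> (\<open>sobolev_lower_small\<close>).

  Because \<open>u \<bullet> \<nabla>\<theta>\<close> is one derivative rougher than \<open>\<theta>\<close>, the \<open>H\<^sup>s\<close> energy of an \<open>H\<^sup>s\<close> solution need
  not be differentiable in time. All energies are therefore computed with weights cut off to finitely many
  frequencies, by a Lipschitz cutoff for which the commutator estimates do not depend on the
  truncation, and \<open>gronwall_truncated\<close> passes to the limit. Only finite sums are ever differentiated.

  That the coefficients of a solution do satisfy the system of ordinary differential equations at
  every time, with a bound in \<open>H\<^sup>s\<close> valid at every time, is \<open>solution_coefficients\<close>.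
\<close>

type_synonym freq = "int \<times> int"
type_synonym coeffs = "freq \<Rightarrow> complex"

section \<open>Characters and Fourier series\<close>

abbreviation torus :: "(real^2) measure" where
  "torus \<equiv> lebesgue_on torus_cell"

lemma torus_cell_eq_cbox: "torus_cell = cbox 0 (\<chi> i. 2 * pi)"
  by (auto simp: torus_cell_def mem_box_cart)

lemma torus_cell_lebesgue [simp, measurable]: "torus_cell \<in> sets lebesgue"
  by (simp add: torus_cell_eq_cbox)

lemma torus_char_add: "torus_char (j + l) x = torus_char j x * torus_char l x"
  by (simp add: torus_char_def cis_mult algebra_simps)

lemma torus_char_uminus: "torus_char (- k) x = cnj (torus_char k x)"
  by (simp add: torus_char_def cis_cnj algebra_simps)

lemma torus_char_mult_cnj: "torus_char k x * cnj (torus_char m x) = torus_char (k - m) x"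
  using torus_char_add[of k "- m" x] by (simp add: torus_char_uminus)

lemma torus_char_0 [simp]: "torus_char 0 x = 1"
  by (simp add: torus_char_def)

lemma norm_torus_char [simp]: "cmod (torus_char k x) = 1"
  by (simp add: torus_char_def)

lemma continuous_torus_char [continuous_intros]: "continuous_on S (torus_char k)"
  unfolding torus_char_def by (intro continuous_intros)

lemma torus_periodic_char: "torus_periodic (torus_char k)"
proof -
  have "torus_char k (x + axis i (2 * pi)) = torus_char k x" for x i
  proof -
    have "\<exists>n::int. real_of_int (fst k) * (x + axis i (2 * pi)) $ 1 + real_of_int (snd k) * (x + axis i (2 * pi)) $ 2
        = (real_of_int (fst k) * x $ 1 + real_of_int (snd k) * x $ 2) + 2 * pi * n"
      using exhaust_2[of i] 
      by (elim disjE) (auto simp: axis_def algebra_simps intro: exI[of _ "fst k"] exI[of _ "snd k"])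
    then obtain n :: int where n: "real_of_int (fst k) * (x + axis i (2 * pi)) $ 1 + real_of_int (snd k) * (x + axis i (2 * pi)) $ 2
        = (real_of_int (fst k) * x $ 1 + real_of_int (snd k) * x $ 2) + 2 * pi * n" by blast
    have "cis (2 * pi * n) = 1" by (rule cis_multiple_2pi) auto
    then show ?thesis unfolding torus_char_def n by (simp flip: cis_mult)
  qed
  then show ?thesis by (simp add: torus_periodic_def)
qed

lemma integral_cis_period:
  "(LINT y|lborel. indicator {0..2*pi} y *\<^sub>R cis (real_of_int n * y)) = (if n = 0 then 2 * pi else 0)"
proof (cases "n = 0")
  case True
  then show ?thesis by (simp add: scaleR_conv_of_real)
next
  case False
  have "(LINT y|lborel. indicator {0..2*pi} y *\<^sub>R cis (real_of_int n * y))
    = cis (real_of_int n * (2 * pi)) / (\<i> * n) - cis (real_of_int n * 0) / (\<i> * n)"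
  proof (rule integral_FTC_Icc)
    fix x assume "0 \<le> x" "x \<le> 2 * pi"
    show "((\<lambda>x. cis (real_of_int n * x) / (\<i> * n)) has_vector_derivative cis (n * x)) (at x within {0..2*pi})"
    proof -
      have "((\<lambda>x. cis (real_of_int n * x)) has_derivative (\<lambda>t. (n * t) *\<^sub>R (\<i> * cis (n * x)))) (at x within {0..2*pi})"
        by (rule has_derivative_cis) (intro derivative_intros)
      then have "((\<lambda>x. cis (real_of_int n * x)) has_vector_derivative (\<i> * n * cis (n * x))) (at x within {0..2*pi})"
        by (simp add: has_vector_derivative_def scaleR_conv_of_real mult_ac)
      from has_vector_derivative_divide[OF this, of "\<i> * n"] show ?thesis
        using False by simp
    qed
  qed (auto intro!: continuous_intros)
  also have "cis (n * (2 * pi)) = 1" using cis_multiple_2pi[of n] by (simp add: mult.commute)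
  finally show ?thesis using False by simp
qed

text \<open>
  Lebesgue measure on the plane is a product measure and the character is a product of functions of one
  coordinate, so the integral is the product of the two integrals of \<open>integral_cis_period\<close>.
\<close>
lemma integral_torus_char:
  "(LINT x|torus. torus_char k x) = (if k = 0 then of_real ((2 * pi)\<^sup>2) else 0)"
proof -
  define c :: "real^2 \<Rightarrow> int" where "c b = (if b = axis 1 1 then fst k else snd k)" for b
  define g where "g b y = indicator {0..2*pi} y *\<^sub>R cis (real_of_int (c b) * y)" for b :: "real^2" and y :: real
  have B: "(Basis :: (real^2) set) = {axis 1 1, axis 2 1}"
    by (auto simp: Basis_vec_def) (metis exhaust_2)
  have ne: "axis 1 1 \<noteq> (axis 2 1 :: real^2)" by (simp add: axis_eq_axis)
  have prod: "indicator torus_cell x *\<^sub>R torus_char k x = (\<Prod>b\<in>Basis. g b (x \<bullet> b))" for x :: "real^2"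
    unfolding B using ne
    by (auto simp: g_def c_def torus_char_def inner_axis cis_mult indicator_def torus_cell_def forall_2)
  have [measurable]: "g b \<in> borel_measurable borel" for b
  proof -
    have [measurable]: "(\<lambda>y. cis (real_of_int (c b) * y)) \<in> borel_measurable borel"
      by (intro borel_measurable_continuous_onI continuous_intros)
    show ?thesis unfolding g_def by measurable
  qed
  have int: "integrable lborel (g b)" for b
  proof -
    have "set_integrable lborel {0..2*pi} (\<lambda>y. cis (real_of_int (c b) * y))"
      by (rule borel_integrable_atLeastAtMost') (auto intro!: continuous_intros)
    then show ?thesis by (simp add: set_integrable_def g_def[abs_def])
  qed
  interpret product_sigma_finite "\<lambda>_::real^2. lborel :: real measure" ..
  have "(LINT x|torus. torus_char k x) = (LINT x|lebesgue. indicator torus_cell x *\<^sub>R torus_char k x)"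
    by (subst integral_restrict_space) auto
  also have "\<dots> = (LINT x|lborel. (\<Prod>b\<in>Basis. g b (x \<bullet> b)))"
    unfolding prod by (rule integral_completion) simp
  also have "\<dots> = (LINT f|Pi\<^sub>M Basis (\<lambda>_. lborel). (\<Prod>b\<in>Basis. g b ((\<Sum>b\<in>Basis. f b *\<^sub>R b) \<bullet> b)))"
    by (subst lborel_eq, subst integral_distr) auto
  also have "\<dots> = (LINT f|Pi\<^sub>M Basis (\<lambda>_. lborel). (\<Prod>b\<in>Basis. g b (f b)))"
    by (intro Bochner_Integration.integral_cong prod.cong refl) (simp add: inner_sum_left inner_Basis if_distrib cong: if_cong)
  also have "\<dots> = (\<Prod>b\<in>Basis. integral\<^sup>L lborel (g b))"
    by (rule product_integral_prod) (auto intro: int)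
  also have "\<dots> = (if k = 0 then of_real ((2 * pi)\<^sup>2) else 0)"
    unfolding B g_def integral_cis_period using ne
    by (auto simp: c_def prod_eq_iff power2_eq_square zero_prod_def)
  finally show ?thesis .
qed

lemma integrable_continuous_torus_cell:
  fixes f :: "real^2 \<Rightarrow> 'a::euclidean_space"
  assumes "continuous_on torus_cell f"
  shows "integrable (torus) f"
  using assms unfolding torus_cell_eq_cbox by (rule continuous_imp_integrable)

lemma lebesgue_integral_torus_cell:
  fixes f :: "real^2 \<Rightarrow> 'a::euclidean_space"
  assumes "continuous_on torus_cell f" "(f has_integral I) torus_cell"
  shows "(LINT x|torus. f x) = I"
  using lebesgue_integral_eq_integral[OF integrable_continuous_torus_cell[OF assms(1)] torus_cell_lebesgue]
    integral_unique[OF assms(2)] by simp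

definition trig_series :: "coeffs \<Rightarrow> real^2 \<Rightarrow> complex" where
  "trig_series c x = (\<Sum>\<^sub>\<infinity>k. c k * torus_char k x)"

lemma trig_series_summable:
  assumes "(\<lambda>k. cmod (c k)) summable_on UNIV"
  shows "(\<lambda>k. c k * torus_char k x) summable_on UNIV"
  by (rule abs_summable_summable) (use assms in \<open>simp add: norm_mult\<close>)

lemma uniform_limit_trig_series:
  assumes "(\<lambda>k. cmod (c k)) summable_on UNIV"
  shows "uniform_limit S (\<lambda>F x. \<Sum>k\<in>F. c k * torus_char k x) (trig_series c) (finite_subsets_at_top UNIV)"
  unfolding trig_series_def[abs_def]
  by (rule Weierstrass_m_test_general[OF _ assms]) (simp add: norm_mult)

lemma continuous_trig_series:
  assumes "(\<lambda>k. cmod (c k)) summable_on UNIV"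
  shows "continuous_on S (trig_series c)"
  by (rule uniform_limit_theorem[OF _ uniform_limit_trig_series[OF assms]])
     (auto intro!: always_eventually continuous_intros)

lemma norm_trig_series_le:
  assumes "(\<lambda>k. cmod (c k)) summable_on UNIV"
  shows "cmod (trig_series c x) \<le> (\<Sum>\<^sub>\<infinity>k. cmod (c k))"
  unfolding trig_series_def
  by (rule order_trans[OF norm_infsum_bound]) (use assms in \<open>simp_all add: norm_mult\<close>)

text \<open>
  The series converges uniformly, so it may be integrated term by term against a character; by
  orthogonality only the term \<open>m\<close> survives.
\<close>
lemma trig_series_coefficient:
  assumes "(\<lambda>k. cmod (c k)) summable_on UNIV"
  shows "(LINT x|torus. trig_series c x * cnj (torus_char m x)) = of_real ((2 * pi)\<^sup>2) * c m"
proof -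
  let ?Z = "finite_subsets_at_top (UNIV :: freq set)"
  have ul: "uniform_limit torus_cell (\<lambda>F x. (\<Sum>k\<in>F. c k * torus_char k x) * cnj (torus_char m x))
      (\<lambda>x. trig_series c x * cnj (torus_char m x)) ?Z"
  proof (rule uniform_limitI)
    fix e :: real assume "e > 0"
    from uniform_limitD[OF uniform_limit_trig_series[OF assms, of torus_cell] this]
    show "\<forall>\<^sub>F F in ?Z. \<forall>x\<in>torus_cell. dist ((\<Sum>k\<in>F. c k * torus_char k x) * cnj (torus_char m x)) (trig_series c x * cnj (torus_char m x)) < e"
      by eventually_elim (simp add: dist_norm norm_mult flip: left_diff_distrib)
  qed
  have cont: "continuous_on S (\<lambda>x. (\<Sum>k\<in>F. c k * torus_char k x) * cnj (torus_char m x))" for F S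
    by (intro continuous_intros)
  have conts: "continuous_on S (\<lambda>x. trig_series c x * cnj (torus_char m x))" for S
    by (intro continuous_intros continuous_trig_series assms)
  obtain I J where IJ: "\<And>F. ((\<lambda>x. (\<Sum>k\<in>F. c k * torus_char k x) * cnj (torus_char m x)) has_integral I F) torus_cell"
     "((\<lambda>x. trig_series c x * cnj (torus_char m x)) has_integral J) torus_cell" "(I \<longlongrightarrow> J) ?Z"
    using uniform_limit_integral_cbox[OF ul[unfolded torus_cell_eq_cbox] cont finite_subsets_at_top_neq_bot]
    unfolding torus_cell_eq_cbox by blast
  have I: "I F = (if m \<in> F then of_real ((2*pi)\<^sup>2) * c m else 0)" if "finite F" for F
  proof -
    have "I F = (LINT x|torus. (\<Sum>k\<in>F. c k * torus_char k x) * cnj (torus_char m x))"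
      by (rule lebesgue_integral_torus_cell[OF cont IJ(1), symmetric])
    also have "\<dots> = (LINT x|torus. (\<Sum>k\<in>F. c k * torus_char (k - m) x))"
      by (intro Bochner_Integration.integral_cong refl)
         (simp add: sum_distrib_right mult.assoc torus_char_mult_cnj)
    also have "\<dots> = (\<Sum>k\<in>F. c k * (LINT x|torus. torus_char (k - m) x))"
    proof -
      have "integrable (torus) (torus_char k)" for k
        by (intro integrable_continuous_torus_cell continuous_intros)
      then show ?thesis by (simp add: Bochner_Integration.integral_sum)
    qed
    also have "\<dots> = (\<Sum>k\<in>F. if k = m then of_real ((2*pi)\<^sup>2) * c m else 0)"
      by (intro sum.cong refl) (auto simp: integral_torus_char)
    also have "\<dots> = (if m \<in> F then of_real ((2*pi)\<^sup>2) * c m else 0)"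
      using that by simp
    finally show ?thesis .
  qed
  have "\<forall>\<^sub>F F in ?Z. I F = of_real ((2*pi)\<^sup>2) * c m"
    using eventually_finite_subsets_at_top_weakI[of UNIV "\<lambda>F. finite F"]
      eventually_finite_subsets_at_top[of "\<lambda>F. m \<in> F" UNIV]
    by (auto simp: eventually_finite_subsets_at_top intro!: exI[of _ "{m}"] simp: I)
  then have "(I \<longlongrightarrow> of_real ((2*pi)\<^sup>2) * c m) ?Z"
    by (rule tendsto_eventually)
  then have "J = of_real ((2*pi)\<^sup>2) * c m"
    using IJ(3) tendsto_unique finite_subsets_at_top_neq_bot by blast
  then show ?thesis
    using lebesgue_integral_torus_cell[OF conts IJ(2)] by simp
qed

text \<open>
  A function orthogonal to all characters is orthogonal to all trigonometric polynomials, in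
  particular to the powers of one; these powers serve as the concentrating kernels below.
\<close>
section \<open>Uniqueness of Fourier coefficients\<close>

lemma integral_mult_trig_poly_power:
  fixes h t :: "real^2 \<Rightarrow> real"
  assumes h: "continuous_on UNIV h" and t: "continuous_on UNIV t"
    and zero: "\<And>k. (LINT x|torus. of_real (h x) * torus_char k x) = 0"
    and F: "finite F" and poly: "\<And>x. of_real (t x) = (\<Sum>j\<in>F. \<alpha> j * torus_char j x)"
  shows "(LINT x|torus. of_real (h x * t x ^ n) * torus_char k x) = 0"
proof (induction n arbitrary: k)
  case 0
  then show ?case using zero by simp
next
  case (Suc n)
  have c: "continuous_on S h" "continuous_on S t" for S
    using h t continuous_on_subset by blast+
  have int: "integrable (torus) (\<lambda>x. of_real (h x * t x ^ n) * torus_char k x)" for k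
    by (intro integrable_continuous_torus_cell continuous_intros c)
  have "of_real (h x * t x ^ Suc n) * torus_char k x
      = (\<Sum>j\<in>F. \<alpha> j * (of_real (h x * t x ^ n) * torus_char (j + k) x))" for x
    by (simp add: poly sum_distrib_left sum_distrib_right torus_char_add mult_ac)
  then have "(LINT x|torus. of_real (h x * t x ^ Suc n) * torus_char k x)
      = (LINT x|torus. (\<Sum>j\<in>F. \<alpha> j * (of_real (h x * t x ^ n) * torus_char (j + k) x)))"
    by presburger
  also have "\<dots> = (\<Sum>j\<in>F. \<alpha> j * (LINT x|torus. of_real (h x * t x ^ n) * torus_char (j + k) x))"
    using int by (subst Bochner_Integration.integral_sum) (auto intro!: integrable_mult_right)
  also have "\<dots> = 0" using Suc by (intro sum.neutral) simp
  finally show ?case .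
qed

lemma cos_le_cos_period:
  assumes "0 \<le> \<delta>" "\<delta> \<le> u" "u \<le> 2 * pi - \<delta>" shows "cos u \<le> cos \<delta>"
proof (cases "u \<le> pi")
  case True
  then show ?thesis using assms cos_monotone_0_pi_le[of \<delta> u] by simp
next
  case False
  have "cos (2 * pi - u) \<le> cos \<delta>"
    by (rule cos_monotone_0_pi_le) (use False assms in auto)
  then show ?thesis by (simp add: cos_diff)
qed

text \<open>
  Suppose \<open>h\<close> is positive at \<open>x0\<close>, hence at least \<open>\<epsilon>\<close> on a small square around \<open>x0\<close>. The trigonometric
  polynomial \<open>t\<close> is nonnegative, at most \<open>1\<close> on the rest of the cell and at least some \<open>q > 1\<close> on a smaller
  square. The integral of \<open>h t\<^sup>n\<close> then grows like \<open>q\<^sup>n\<close>, whereas orthogonality makes it \<open>0\<close> for every \<open>n\<close>.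
  Taking \<open>x0\<close> in the interior keeps the square inside the cell.
\<close>
lemma zero_fourier_imp_nonpos:
  fixes h :: "real^2 \<Rightarrow> real"
  assumes h: "continuous_on UNIV h"
    and zero: "\<And>k. (LINT x|torus. of_real (h x) * torus_char k x) = 0"
    and x0: "x0 \<in> box 0 (\<chi> i. 2 * pi)"
  shows "h x0 \<le> 0"
proof (rule ccontr)
  assume "\<not> h x0 \<le> 0"
  define \<epsilon> where "\<epsilon> = h x0 / 2"
  have \<epsilon>: "\<epsilon> > 0" using \<open>\<not> h x0 \<le> 0\<close> by (simp add: \<epsilon>_def)
  define a b where "a = x0 $ 1" and "b = x0 $ 2"
  have ab: "0 < a" "a < 2 * pi" "0 < b" "b < 2 * pi"
    using x0 by (auto simp: mem_box_cart a_def b_def)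
  obtain \<delta>0 where \<delta>0: "\<delta>0 > 0" "\<And>x. dist x x0 < \<delta>0 \<Longrightarrow> dist (h x) (h x0) < \<epsilon>"
    using h \<epsilon> unfolding continuous_on_iff by (metis UNIV_I)
  define \<delta> where "\<delta> = Min {\<delta>0 / 2, a, b, 2 * pi - a, 2 * pi - b, 1}"
  have \<delta>: "0 < \<delta>" "2 * \<delta> \<le> \<delta>0" "\<delta> \<le> a" "\<delta> \<le> b" "\<delta> \<le> 2 * pi - a" "\<delta> \<le> 2 * pi - b" "\<delta> \<le> 1"
  proof -
    have "\<delta> \<in> {\<delta>0 / 2, a, b, 2 * pi - a, 2 * pi - b, 1}" unfolding \<delta>_def by (rule Min_in) auto
    then show "0 < \<delta>" using ab \<delta>0(1) by auto
    have *: "\<delta> \<le> z" if "z \<in> {\<delta>0 / 2, a, b, 2 * pi - a, 2 * pi - b, 1}" for z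
      unfolding \<delta>_def by (rule Min_le) (use that in auto)
    show "2 * \<delta> \<le> \<delta>0" "\<delta> \<le> a" "\<delta> \<le> b" "\<delta> \<le> 2 * pi - a" "\<delta> \<le> 2 * pi - b" "\<delta> \<le> 1"
      using *[of "\<delta>0 / 2"] *[of a] *[of b] *[of "2 * pi - a"] *[of "2 * pi - b"] *[of 1] by simp_all
  qed
  have pi1: "1 < pi" using pi_gt3 by simp
  have near: "\<epsilon> \<le> h x" if "\<bar>x $ 1 - a\<bar> < \<delta>" "\<bar>x $ 2 - b\<bar> < \<delta>" for x
  proof -
    have "dist x x0 \<le> \<bar>x $ 1 - a\<bar> + \<bar>x $ 2 - b\<bar>"
      unfolding dist_norm using norm_le_l1_cart[of "x - x0"] by (simp add: sum_2 a_def b_def)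
    then have "dist x x0 < \<delta>0" using that \<delta> by linarith
    from \<delta>0(2)[OF this] have "\<bar>h x - h x0\<bar> < \<epsilon>" by (simp add: dist_real_def)
    then show ?thesis unfolding \<epsilon>_def by linarith
  qed
  \<comment> \<open>the normalisation puts the level \<open>t x = 1\<close> at \<open>cos + cos = 1 + cos \<delta>\<close>, which is out of reach as soon as one coordinate is \<open>\<delta>\<close>-far from \<open>x0\<close>\<close>
  define D where "D = 3 + cos \<delta>"
  have D: "D > 0" unfolding D_def using cos_ge_minus_one[of \<delta>] by linarith
  define t where "t x = (2 + cos (x $ 1 - a) + cos (x $ 2 - b)) / D" for x :: "real^2"
  have t0: "0 \<le> t x" for x
    unfolding t_def using D cos_ge_minus_one[of "x $ 1 - a"] cos_ge_minus_one[of "x $ 2 - b"]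
    by (intro divide_nonneg_pos) linarith+
  have large: "\<bar>x $ 1 - a\<bar> < \<delta> \<and> \<bar>x $ 2 - b\<bar> < \<delta>" if "t x > 1" "x \<in> torus_cell" for x
  proof -
    have s: "1 + cos \<delta> < cos (x $ 1 - a) + cos (x $ 2 - b)"
      using that(1) D by (simp add: t_def D_def field_simps)
    then have "cos \<delta> < cos \<bar>x $ 1 - a\<bar>" "cos \<delta> < cos \<bar>x $ 2 - b\<bar>"
      unfolding cos_abs_real using cos_le_one[of "x $ 1 - a"] cos_le_one[of "x $ 2 - b"] by linarith+
    \<comment> \<open>within the cell, the cosine cannot become large again because of the next period\<close>
    moreover have "\<bar>x $ 1 - a\<bar> \<le> 2 * pi - \<delta>" "\<bar>x $ 2 - b\<bar> \<le> 2 * pi - \<delta>"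
      using that(2) \<delta> by (auto simp: torus_cell_def abs_le_iff forall_2)
    ultimately show ?thesis
      using cos_le_cos_period[of \<delta> "\<bar>x $ 1 - a\<bar>"] cos_le_cos_period[of \<delta> "\<bar>x $ 2 - b\<bar>"] \<delta>(1) by force
  qed
  define q where "q = (2 + 2 * cos (\<delta> / 2)) / D"
  have c2: "0 < cos (\<delta> / 2)" using \<delta> pi1 by (intro cos_gt_zero_pi) auto
  have c1: "cos (\<delta> / 2) < 1" using \<delta> pi1 cos_monotone_0_pi[of 0 "\<delta>/2"] by simp
  have q: "q > 1"
  proof -
    \<comment> \<open>\<open>q > 1\<close> means \<open>2 cos (\<delta>/2) > 1 + cos \<delta> = 2 (cos (\<delta>/2))\<^sup>2\<close>\<close>
    have "cos \<delta> = 2 * (cos (\<delta> / 2))\<^sup>2 - 1" using cos_double_cos[of "\<delta>/2"] by simp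
    moreover have "(cos (\<delta> / 2))\<^sup>2 < cos (\<delta> / 2)" using c1 c2 by (simp add: power2_eq_square)
    ultimately show ?thesis using D by (simp add: q_def D_def field_simps)
  qed
  define S where "S = cbox (x0 - (\<chi> i. \<delta> / 2)) (x0 + (\<chi> i. \<delta> / 2))"
  have Sx: "\<bar>x $ 1 - a\<bar> \<le> \<delta> / 2" "\<bar>x $ 2 - b\<bar> \<le> \<delta> / 2" if "x \<in> S" for x
  proof -
    have "x0 $ i - \<delta> / 2 \<le> x $ i" "x $ i \<le> x0 $ i + \<delta> / 2" for i
      using that by (auto simp: S_def mem_box_cart)
    from this[of 1] this[of 2] show "\<bar>x $ 1 - a\<bar> \<le> \<delta> / 2" "\<bar>x $ 2 - b\<bar> \<le> \<delta> / 2"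
      unfolding a_def b_def by linarith+
  qed
  have Scell: "S \<subseteq> torus_cell"
    using \<delta> by (auto simp: S_def mem_box_cart torus_cell_def forall_2 a_def b_def)
  have Sq: "q \<le> t x" if "x \<in> S" for x
  proof -
    have "cos (\<delta> / 2) \<le> cos \<bar>x $ 1 - a\<bar>" "cos (\<delta> / 2) \<le> cos \<bar>x $ 2 - b\<bar>"
      using Sx[OF that] \<delta> pi1 by (intro cos_monotone_0_pi_le; linarith)+
    then show ?thesis using D by (simp add: q_def t_def cos_abs_real divide_right_mono)
  qed
  have tc: "continuous_on A t" for A
    unfolding t_def using D by (intro continuous_intros) auto
  have hc: "continuous_on A h" for A using h continuous_on_subset by blast
  have "compact (h ` torus_cell)"
    by (intro compact_continuous_image hc) (simp add: torus_cell_eq_cbox)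
  then obtain H where H: "\<And>x. x \<in> torus_cell \<Longrightarrow> \<bar>h x\<bar> \<le> H"
    using compact_imp_bounded[of "h ` torus_cell"] by (auto simp: bounded_iff)
  have "x0 \<in> torus_cell" using x0 by (auto simp: torus_cell_def mem_box_cart less_imp_le)
  then have H0: "H \<ge> 0" using H by force
  have I0: "(LINT x|torus. h x * t x ^ n) = 0" for n
  proof -
    define F :: "freq set" where "F = {0, (1,0), (-1,0), (0,1), (0,-1)}"
    define \<alpha> :: coeffs where "\<alpha> j = (if j = 0 then 2 / D else if j = (1,0) then cis (-a) / (2 * D)
        else if j = (-1,0) then cis a / (2 * D) else if j = (0,1) then cis (-b) / (2 * D) else cis b / (2 * D))" for j
    have cc: "complex_of_real (cos u) = (cis u + cis (-u)) / 2" for u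
      by (simp add: complex_eq_iff)
    have "complex_of_real (t x) = (\<Sum>j\<in>F. \<alpha> j * torus_char j x)" for x
    proof -
      have "complex_of_real (t x) = 2 / D + (cis (x $ 1) * cis (-a) + cis (-(x $ 1)) * cis a) / (2 * D)
          + (cis (x $ 2) * cis (-b) + cis (-(x $ 2)) * cis b) / (2 * D)"
        unfolding t_def of_real_divide of_real_add cc cis_mult using D by (simp add: field_simps)
      also have "\<dots> = (\<Sum>j\<in>F. \<alpha> j * torus_char j x)"
        unfolding F_def \<alpha>_def using D by (simp add: zero_prod_def torus_char_def field_simps)
      finally show ?thesis .
    qed
    then have "(LINT x|torus. of_real (h x * t x ^ n) * torus_char 0 x) = 0"
      by (intro integral_mult_trig_poly_power[OF h tc zero]) (auto simp: F_def)
    then show ?thesis by (simp flip: of_real_mult of_real_power)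
  qed
  define \<mu> where "\<mu> = measure (torus)"
  have mS: "\<mu> S > 0"
  proof -
    have "\<mu> S = measure lebesgue S"
      unfolding \<mu>_def using Scell by (intro measure_restrict_space) (auto simp: S_def)
    also have "\<dots> > 0"
      using \<delta>(1) by (simp add: S_def content_pos_lt_eq inner_simps Basis_vec_def) (auto simp: inner_axis)
    finally show ?thesis .
  qed
  have bound: "\<epsilon> * q ^ n * \<mu> S \<le> H * \<mu> torus_cell" for n
  proof -
    have fin: "emeasure (torus) A < \<infinity>" for A
    proof -
      have "emeasure (torus) A \<le> emeasure (torus) (space (torus))"
        by (rule emeasure_space)
      also have "\<dots> = emeasure lebesgue torus_cell" by (simp add: emeasure_restrict_space)
      also have "\<dots> < \<infinity>" using emeasure_lborel_cbox_finite[of 0 "(\<chi> i. 2 * pi) :: real^2"]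
        by (simp add: torus_cell_eq_cbox less_top)
      finally show ?thesis .
    qed
    have Sm: "S \<in> sets (torus)"
      using Scell by (simp add: sets_restrict_space_iff S_def)
    have Tm: "torus_cell \<in> sets (torus)" by simp
    have iS: "integrable (torus) (\<lambda>x. \<epsilon> * q ^ n * indicator S x :: real)"
      by (intro integrable_mult_right integrable_real_indicator Sm fin)
    have iT: "integrable (torus) (\<lambda>x. H * indicator torus_cell x :: real)"
      by (intro integrable_mult_right integrable_real_indicator Tm fin)
    have "(LINT x|torus. \<epsilon> * q ^ n * indicator S x - H * indicator torus_cell x)
        \<le> (LINT x|torus. h x * t x ^ n)"
    proof (rule integral_mono)
      show "integrable (torus) (\<lambda>x. \<epsilon> * q ^ n * indicator S x - H * indicator torus_cell x :: real)"
        by (intro Bochner_Integration.integrable_diff iS iT)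
      show "integrable (torus) (\<lambda>x. h x * t x ^ n)"
        by (intro integrable_continuous_torus_cell continuous_intros hc tc)
      fix x assume "x \<in> space (torus)"
      then have x: "x \<in> torus_cell" by simp
      show "\<epsilon> * q ^ n * indicator S x - H * indicator torus_cell x \<le> h x * t x ^ n"
      proof (cases "t x > 1")
        case True
        then have hx: "\<epsilon> \<le> h x" using large[OF True x] near by blast
        have tn: "0 \<le> t x ^ n" using t0 by simp
        have "\<epsilon> * (q ^ n * indicator S x) \<le> h x * t x ^ n"
        proof (rule mult_mono)
          show "q ^ n * indicator S x \<le> t x ^ n"
            using Sq[of x] q tn by (auto simp: indicator_def intro!: power_mono)
        qed (use hx \<epsilon> q in \<open>auto simp: indicator_def\<close>)
        then show ?thesis using H0 x by (simp add: mult.assoc)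
      next
        case False
        then have "x \<notin> S" using Sq q by force
        moreover have "- H \<le> h x * t x ^ n"
        proof -
          have "\<bar>h x * t x ^ n\<bar> \<le> H * 1"
            unfolding abs_mult using H[OF x] False t0[of x] H0
            by (intro mult_mono) (auto simp: power_le_one)
          then show ?thesis by linarith
        qed
        ultimately show ?thesis using x by simp
      qed
    qed
    then have "\<epsilon> * q ^ n * \<mu> S - H * \<mu> torus_cell \<le> 0"
      unfolding I0 by (subst (asm) Bochner_Integration.integral_diff[OF iS iT]) (use Sm Tm Scell in \<open>simp add: \<mu>_def Int_absorb2\<close>)
    then show ?thesis by simp
  qed
  obtain n where "H * \<mu> torus_cell / (\<epsilon> * \<mu> S) < q ^ n"
    using real_arch_pow[OF q] by blast
  then have "H * \<mu> torus_cell < \<epsilon> * q ^ n * \<mu> S"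
    using \<epsilon> mS by (simp add: field_simps)
  with bound[of n] show False by simp
qed

lemma torus_periodic_shift:
  assumes "torus_periodic f"
  shows "f (x + axis i (2 * pi * of_int n)) = f x"
proof (induction n arbitrary: x rule: int_induct[of _ 0])
  case base
  then show ?case by (simp add: axis_def vec_eq_iff flip: zero_vec_def)
next
  case (step1 m)
  have "x + axis i (2 * pi * real_of_int (m + 1)) = (x + axis i (2 * pi * of_int m)) + axis i (2 * pi)"
    by (simp add: vec_eq_iff axis_def algebra_simps)
  then show ?case using step1 assms unfolding torus_periodic_def by metis
next
  case (step2 m)
  have "x + axis i (2 * pi * of_int m) = (x + axis i (2 * pi * real_of_int (m - 1))) + axis i (2 * pi)"
    by (simp add: vec_eq_iff axis_def algebra_simps)
  then show ?case using step2 assms unfolding torus_periodic_def by metis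
qed

lemma torus_periodic_representative:
  assumes "torus_periodic f"
  obtains y where "y \<in> torus_cell" "f y = f x"
proof -
  define n where "n i = - \<lfloor>x $ i / (2 * pi)\<rfloor>" for i
  define y where "y = (x + axis 1 (2 * pi * of_int (n 1))) + axis 2 (2 * pi * of_int (n 2))"
  have "f y = f x" unfolding y_def by (simp add: torus_periodic_shift[OF assms])
  moreover have "y \<in> torus_cell"
  proof -
    have "y $ i = 2 * pi * frac (x $ i / (2 * pi))" for i
      using exhaust_2[of i] by (auto simp: y_def axis_def n_def frac_def algebra_simps)
    moreover have "0 \<le> frac u" "frac u \<le> 1" for u :: real using frac_lt_1[of u] by auto
    ultimately show ?thesis by (auto simp: torus_cell_def mult_left_le)
  qed
  ultimately show ?thesis using that by blast
qed

text \<open>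
  Both \<open>h\<close> and \<open>- h\<close> are nonpositive inside the cell; continuity covers its boundary and periodicity the
  rest of the plane.
\<close>
proposition zero_fourier_imp_zero:
  fixes h :: "real^2 \<Rightarrow> real"
  assumes h: "continuous_on UNIV h" and per: "torus_periodic h"
    and zero: "\<And>k. (LINT x|torus. of_real (h x) * torus_char k x) = 0"
  shows "h x = 0"
proof -
  have box: "h x = 0" if "x \<in> box 0 (\<chi> i. 2 * pi)" for x
    using zero_fourier_imp_nonpos[OF h zero that] zero_fourier_imp_nonpos[of "\<lambda>x. - h x", OF _ _ that] h zero
    by (force intro: continuous_intros)
  have "h x = 0" if "x \<in> closure (box 0 (\<chi> i. 2 * pi))" for x
    by (rule continuous_constant_on_closure[OF _ box that]) (use h continuous_on_subset in auto)
  moreover have "closure (box 0 (\<chi> i. 2 * pi)) = torus_cell"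
    unfolding torus_cell_eq_cbox by (rule closure_box) (auto simp: box_ne_empty inner_simps Basis_vec_def inner_axis)
  ultimately show ?thesis using torus_periodic_representative[OF per, of x] by metis
qed

section \<open>Frequency weights and derivatives of Fourier series\<close>

text \<open>
  The Japanese bracket: \<open>bracket k powr s\<close> is the weight of \<open>H\<^sup>s\<close>.
\<close>
definition bracket :: "freq \<Rightarrow> real" where
  "bracket k = sqrt (1 + freq_sq k)"

text \<open>
  Reading the bracket as a Euclidean norm gives its triangle inequality.
\<close>
lemma bracket_eq_norm: "bracket k = norm (1::real, real_of_int (fst k), real_of_int (snd k))"
  by (simp add: bracket_def freq_sq_def norm_Pair)

lemma freq_sq_nonneg [simp]: "0 \<le> freq_sq k"
  by (simp add: freq_sq_def)

lemma bracket_ge_1 [simp]: "1 \<le> bracket k"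
  by (simp add: bracket_def)

lemma bracket_pos [simp]: "0 < bracket k" and bracket_nonneg [simp]: "0 \<le> bracket k"
  using bracket_ge_1[of k] by linarith+

lemma bracket_neq_0 [simp]: "bracket k \<noteq> 0"
  by (rule less_imp_neq[OF bracket_pos, symmetric])

lemma bracket_powr: "(1 + freq_sq k) powr s = (bracket k powr s)\<^sup>2"
  by (simp add: bracket_def powr_half_sqrt[symmetric] powr_powr add_nonneg_nonneg flip: powr_add power2_eq_square)
     (simp add: power2_eq_square flip: powr_add)

lemma bracket_triangle: "bracket k \<le> bracket (k - l) + bracket l"
  and abs_bracket_diff_le: "\<bar>bracket k - bracket l\<bar> \<le> bracket (k - l)"
proof -
  let ?v = "\<lambda>k :: freq. (1::real, real_of_int (fst k), real_of_int (snd k))"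
  have "\<bar>bracket k - bracket l\<bar> \<le> norm (?v k - ?v l)"
    unfolding bracket_eq_norm by (rule norm_triangle_ineq3)
  also have "\<dots> \<le> bracket (k - l)"
    unfolding bracket_def freq_sq_def by (simp add: norm_Pair)
  finally show "\<bar>bracket k - bracket l\<bar> \<le> bracket (k - l)" .
  then show "bracket k \<le> bracket (k - l) + bracket l" by linarith
qed

lemma freq_le_bracket: "\<bar>real_of_int (fst k)\<bar> \<le> bracket k" "\<bar>real_of_int (snd k)\<bar> \<le> bracket k"
  unfolding bracket_def freq_sq_def by (auto intro!: real_le_rsqrt)

lemma finite_bracket_le: "finite {k. bracket k \<le> N}"
proof (rule finite_subset)
  show "{k. bracket k \<le> N} \<subseteq> {- \<lceil>N\<rceil>..\<lceil>N\<rceil>} \<times> {- \<lceil>N\<rceil>..\<lceil>N\<rceil>}"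
  proof clarify
    fix p q :: int assume *: "bracket (p, q) \<le> N"
    have "\<bar>real_of_int p\<bar> \<le> N" "\<bar>real_of_int q\<bar> \<le> N"
      using * freq_le_bracket[of "(p,q)"] by auto
    then show "p \<in> {- \<lceil>N\<rceil>..\<lceil>N\<rceil>} \<and> q \<in> {- \<lceil>N\<rceil>..\<lceil>N\<rceil>}"
      by (auto simp: abs_le_iff) linarith+
  qed
qed auto

lemma infsum_diff:
  fixes f g :: "'a \<Rightarrow> 'b::real_normed_vector"
  assumes "f summable_on A" "g summable_on A"
  shows "infsum (\<lambda>k. f k - g k) A = infsum f A - infsum g A" "(\<lambda>k. f k - g k) summable_on A"
  using infsum_add[OF assms(1) summable_on_uminus[THEN iffD2, OF assms(2)]]
    summable_on_add[OF assms(1) summable_on_uminus[THEN iffD2, OF assms(2)]]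
  by (simp_all add: infsum_uminus)

lemma infsum_split_finite:
  fixes f :: "'a \<Rightarrow> 'b::banach"
  assumes "finite F" "f summable_on UNIV"
  shows "infsum f UNIV = sum f F + infsum f (- F)"
proof -
  have "infsum f (F \<union> - F) = sum f F + infsum f (- F)"
    using assms by (subst infsum_Un_disjoint) (auto intro: summable_on_subset_banach)
  then show ?thesis by (simp add: Un_commute)
qed

lemma summable_tail_small:
  fixes f :: "'a \<Rightarrow> real"
  assumes f: "f summable_on UNIV" and e: "e > 0"
  obtains F where "finite F" "\<bar>infsum f (- F)\<bar> \<le> e"
proof -
  obtain F where F: "finite F" "dist (sum f F) (infsum f UNIV) \<le> e"
    using infsum_finite_approximation[OF f e] by blast
  then show ?thesis using that infsum_split_finite[OF F(1) f] by (auto simp: dist_real_def)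
qed

lemma norm_cis_diff_le: "cmod (cis a - cis b) \<le> \<bar>a - b\<bar>"
proof -
  have "norm (cis a - cis b) \<le> 1 * norm (a - b)"
  proof (rule differentiable_bound)
    show "convex (UNIV::real set)" by simp
    fix x :: real
    show "(cis has_derivative (\<lambda>t. t *\<^sub>R (\<i> * cis x))) (at x within UNIV)"
      using has_derivative_cis[of "\<lambda>x. x" "\<lambda>x. x" x UNIV] by simp
    show "onorm (\<lambda>t. t *\<^sub>R (\<i> * cis x)) \<le> 1"
      by (rule onorm_le) (simp add: norm_mult)
  qed auto
  then show ?thesis by simp
qed

definition freq_inner :: "freq \<Rightarrow> real^2 \<Rightarrow> real" where
  "freq_inner k v = real_of_int (fst k) * v $ 1 + real_of_int (snd k) * v $ 2"

lemma torus_char_eq: "torus_char k x = cis (freq_inner k x)"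
  by (simp add: torus_char_def freq_inner_def)

lemma freq_inner_le: "\<bar>freq_inner k v\<bar> \<le> 2 * bracket k * norm v"
proof -
  have "\<bar>freq_inner k v\<bar> \<le> \<bar>real_of_int (fst k)\<bar> * \<bar>v $ 1\<bar> + \<bar>real_of_int (snd k)\<bar> * \<bar>v $ 2\<bar>"
    unfolding freq_inner_def by (metis abs_mult abs_triangle_ineq)
  also have "\<dots> \<le> bracket k * norm v + bracket k * norm v"
    by (intro add_mono mult_mono freq_le_bracket component_le_norm_cart) auto
  finally show ?thesis by (simp add: mult_ac)
qed

lemma freq_inner_linear: "bounded_linear (freq_inner k)"
  unfolding freq_inner_def[abs_def]
  by (intro bounded_linear_add bounded_linear_mult_right[THEN bounded_linear_compose] bounded_linear_vec_nth)

lemma has_derivative_torus_char: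
  "(torus_char k has_derivative (\<lambda>v. of_real (freq_inner k v) * (\<i> * torus_char k x))) (at x)"
proof -
  have "((\<lambda>x. cis (freq_inner k x)) has_derivative (\<lambda>v. freq_inner k v *\<^sub>R (\<i> * cis (freq_inner k x)))) (at x)"
    by (rule has_derivative_cis) (rule bounded_linear_imp_has_derivative[OF freq_inner_linear])
  then show ?thesis by (simp add: torus_char_eq[abs_def] scaleR_conv_of_real)
qed

lemma summable_of_bracket_summable:
  assumes "(\<lambda>k. bracket k * cmod (c k)) summable_on UNIV"
  shows "(\<lambda>k. cmod (c k)) summable_on UNIV"
  by (rule summable_on_comparison_test[OF assms]) (auto simp: mult_le_cancel_right1)

lemma summable_freq:
  assumes "(\<lambda>k. bracket k * cmod (c k)) summable_on UNIV"
  shows "(\<lambda>k. cmod (\<i> * of_int (fst k) * c k)) summable_on UNIV"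
    and "(\<lambda>k. cmod (\<i> * of_int (snd k) * c k)) summable_on UNIV"
  by (rule summable_on_comparison_test[OF assms]; auto simp: norm_mult intro!: mult_right_mono freq_le_bracket)+

text \<open>
  The remainders of first order Taylor expansions of the characters are at most
  \<open>4 |y - x| bracket k\<close>, which is summable against \<open>c\<close>. So the tail of the series contributes at most
  \<open>e / 2\<close> times \<open>|y - x|\<close>, uniformly in \<open>y\<close>, and the remaining finite sum is differentiable.
\<close>
proposition has_derivative_trig_series:
  assumes sm: "(\<lambda>k. bracket k * cmod (c k)) summable_on UNIV"
  shows "(trig_series c has_derivative (\<lambda>v. of_real (v $ 1) * trig_series (\<lambda>k. \<i> * of_int (fst k) * c k) x
      + of_real (v $ 2) * trig_series (\<lambda>k. \<i> * of_int (snd k) * c k) x)) (at x)"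
    (is "(_ has_derivative ?D) _")
  unfolding has_derivative_at_alt
proof (intro conjI allI impI)
  have "bounded_linear (\<lambda>v::real^2. complex_of_real (v $ i) * z)" for i z
    by (intro bounded_linear_mult_const bounded_linear_compose[OF bounded_linear_of_real bounded_linear_vec_nth])
  then show "bounded_linear ?D" by (intro bounded_linear_add)
next
  fix e :: real assume e: "e > 0"
  note sm0 = summable_of_bracket_summable[OF sm]
  define r where "r k y = c k * (torus_char k y - torus_char k x - of_real (freq_inner k (y - x)) * (\<i> * torus_char k x))" for k y
  have r_le: "cmod (r k y) \<le> norm (y - x) * (4 * (bracket k * cmod (c k)))" for k y
  proof -
    have "cmod (torus_char k y - torus_char k x) \<le> \<bar>freq_inner k (y - x)\<bar>"
      using norm_cis_diff_le[of "freq_inner k y" "freq_inner k x"]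
      by (simp add: torus_char_eq linear_diff[OF bounded_linear.linear[OF freq_inner_linear]])
    then have "cmod (torus_char k y - torus_char k x - of_real (freq_inner k (y - x)) * (\<i> * torus_char k x))
        \<le> \<bar>freq_inner k (y - x)\<bar> + \<bar>freq_inner k (y - x)\<bar>"
      by (intro order_trans[OF norm_triangle_ineq4 add_mono]) (auto simp: norm_mult)
    also have "\<dots> \<le> 4 * bracket k * norm (y - x)" using freq_inner_le[of k "y - x"] by simp
    finally have "cmod (torus_char k y - torus_char k x - of_real (freq_inner k (y - x)) * (\<i> * torus_char k x))
        \<le> 4 * bracket k * norm (y - x)" .
    from mult_left_mono[OF this norm_ge_zero[of "c k"]] show ?thesis unfolding r_def norm_mult
      by (simp only: mult_ac)
  qed
  have sm4: "(\<lambda>k. 4 * (bracket k * cmod (c k))) summable_on UNIV"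
    by (intro summable_on_cmult_right sm)
  have rs: "(\<lambda>k. r k y) summable_on A" for y A
  proof -
    have "(\<lambda>k. cmod (r k y)) summable_on UNIV"
      by (rule Infinite_Sum.abs_summable_on_comparison_test'[OF summable_on_cmult_right[OF sm4]]) (rule r_le)
    then have "(\<lambda>k. r k y) summable_on UNIV" by (rule abs_summable_summable)
    then show ?thesis by (rule summable_on_subset_banach) simp
  qed
  have diff: "trig_series c y - trig_series c x - ?D (y - x) = (\<Sum>\<^sub>\<infinity>k. r k y)" for y
  proof -
    have D: "?D v = (\<Sum>\<^sub>\<infinity>k. c k * (of_real (freq_inner k v) * (\<i> * torus_char k x)))" for v
    proof -
      have "?D v = (\<Sum>\<^sub>\<infinity>k. of_real (v $ 1) * (\<i> * of_int (fst k) * c k * torus_char k x)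
         + of_real (v $ 2) * (\<i> * of_int (snd k) * c k * torus_char k x))"
        unfolding trig_series_def
        by (subst infsum_add) (auto intro!: summable_on_cmult_right trig_series_summable summable_freq sm simp: infsum_cmult_right')
      also have "\<dots> = (\<Sum>\<^sub>\<infinity>k. c k * (of_real (freq_inner k v) * (\<i> * torus_char k x)))"
        by (intro infsum_cong) (simp add: freq_inner_def algebra_simps)
      finally show ?thesis .
    qed
    have sD: "(\<lambda>k. c k * (of_real (freq_inner k v) * (\<i> * torus_char k x))) summable_on UNIV" for v
    proof (rule abs_summable_summable, rule Infinite_Sum.abs_summable_on_comparison_test')
      show "(\<lambda>k. (2 * norm v) * (bracket k * cmod (c k))) summable_on UNIV" by (intro summable_on_cmult_right sm)
      show "cmod (c k * (of_real (freq_inner k v) * (\<i> * torus_char k x))) \<le> (2 * norm v) * (bracket k * cmod (c k))" for k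
        using mult_left_mono[OF freq_inner_le[of k v], of "cmod (c k)"] by (simp add: norm_mult mult_ac)
    qed
    have "(\<Sum>\<^sub>\<infinity>k. r k y) = (\<Sum>\<^sub>\<infinity>k. (c k * torus_char k y - c k * torus_char k x) - c k * (of_real (freq_inner k (y-x)) * (\<i> * torus_char k x)))"
      by (simp add: r_def algebra_simps)
    also have "\<dots> = trig_series c y - trig_series c x - ?D (y - x)"
      unfolding D unfolding trig_series_def
      by (simp only: infsum_diff trig_series_summable[OF sm0] sD)
    finally show ?thesis by simp
  qed
  obtain F where F: "finite F" "\<bar>infsum (\<lambda>k. 4 * (bracket k * cmod (c k))) (- F)\<bar> \<le> e / 2"
    using summable_tail_small[OF sm4, of "e / 2"] e by auto
  have "((\<lambda>y. \<Sum>k\<in>F. c k * torus_char k y) has_derivative (\<lambda>v. \<Sum>k\<in>F. c k * (of_real (freq_inner k v) * (\<i> * torus_char k x)))) (at x)"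
    by (intro has_derivative_sum has_derivative_mult_right has_derivative_torus_char)
  then obtain d where d: "d > 0" "\<And>y. norm (y - x) < d \<Longrightarrow> norm ((\<Sum>k\<in>F. c k * torus_char k y) - (\<Sum>k\<in>F. c k * torus_char k x)
       - (\<Sum>k\<in>F. c k * (of_real (freq_inner k (y-x)) * (\<i> * torus_char k x)))) \<le> e / 2 * norm (y - x)"
    unfolding has_derivative_at_alt using e half_gt_zero by meson
  have "norm (trig_series c y - trig_series c x - ?D (y - x)) \<le> e * norm (y - x)" if y: "norm (y - x) < d" for y
  proof -
    have 1: "trig_series c y - trig_series c x - ?D (y - x) = (\<Sum>k\<in>F. r k y) + (\<Sum>\<^sub>\<infinity>k\<in>-F. r k y)"
      unfolding diff by (rule infsum_split_finite[OF F(1) rs])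
    have 2: "cmod (\<Sum>k\<in>F. r k y) \<le> e / 2 * norm (y - x)"
      using d(2)[OF y] by (simp add: r_def sum_subtractf right_diff_distrib)
    have "cmod (\<Sum>\<^sub>\<infinity>k\<in>-F. r k y) \<le> (\<Sum>\<^sub>\<infinity>k\<in>-F. norm (y - x) * (4 * (bracket k * cmod (c k))))"
    proof (rule norm_infsum_le[OF has_sum_infsum has_sum_infsum])
      show "(\<lambda>k. norm (y - x) * (4 * (bracket k * cmod (c k)))) summable_on - F"
        by (rule summable_on_subset_banach[OF summable_on_cmult_right[OF sm4]]) simp
    qed (rule rs, rule r_le)
    also have "\<dots> = norm (y - x) * (\<Sum>\<^sub>\<infinity>k\<in>-F. 4 * (bracket k * cmod (c k)))"
      by (rule infsum_cmult_right')
    also have "\<dots> \<le> norm (y - x) * (e / 2)"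
      using F(2) by (intro mult_left_mono) auto
    finally have 3: "cmod (\<Sum>\<^sub>\<infinity>k\<in>-F. r k y) \<le> e / 2 * norm (y - x)" by (simp add: mult.commute)
    show ?thesis unfolding 1 using norm_triangle_mono[OF 2 3] by simp
  qed
  then show "\<exists>d>0. \<forall>y. norm (y - x) < d \<longrightarrow> norm (trig_series c y - trig_series c x - ?D (y - x)) \<le> e * norm (y - x)"
    using d(1) by blast
qed

section \<open>Products of Fourier series\<close>

definition convolution :: "coeffs \<Rightarrow> coeffs \<Rightarrow> coeffs" where
  "convolution b c k = (\<Sum>\<^sub>\<infinity>l. b (k - l) * c l)"

lemma bij_betw_shear: "bij_betw (\<lambda>(k, l). (k - l, l)) (UNIV :: (freq \<times> freq) set) UNIV"
  by (rule bij_betwI[where g = "\<lambda>(j, l). (j + l, l)"]) auto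

lemma summable_shear:
  assumes "(\<lambda>k. cmod (b k)) summable_on UNIV" "(\<lambda>k. cmod (c k)) summable_on UNIV"
  shows "(\<lambda>(k, l). cmod (b (k - l) * c l)) summable_on (UNIV :: (freq \<times> freq) set)"
proof -
  have "(\<lambda>p. cmod (case p of (j, l) \<Rightarrow> b j * c l)) summable_on UNIV \<times> UNIV"
    unfolding Infinite_Sum.abs_summable_on_Sigma_iff
    using assms summable_on_cmult_left[OF assms(1), of "\<Sum>\<^sub>\<infinity>y. cmod (c y)"]
    by (auto simp: norm_mult infsum_cmult_right' infsum_nonneg abs_mult intro!: summable_on_cmult_right)
  then have "(\<lambda>p. cmod (case p of (j, l) \<Rightarrow> b j * c l)) summable_on UNIV" by simp
  then have "(\<lambda>p. cmod (case (case p of (k, l) \<Rightarrow> (k - l, l)) of (j, l) \<Rightarrow> b j * c l)) summable_on UNIV"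
    by (subst summable_on_reindex_bij_betw[OF bij_betw_shear])
  then show ?thesis by (simp add: case_prod_unfold)
qed

text \<open>
  Absolute summability over \<open>(j, l)\<close> is transported to \<open>(k, l)\<close> with \<open>k = j + l\<close> by a shear of the
  lattice.
\<close>
lemma convolution_summable:
  assumes "(\<lambda>k. cmod (b k)) summable_on UNIV" "(\<lambda>k. cmod (c k)) summable_on UNIV"
  shows "(\<lambda>k. cmod (convolution b c k)) summable_on UNIV"
proof -
  have s: "(\<lambda>(k, l). cmod (b (k - l) * c l)) summable_on UNIV \<times> UNIV"
    using summable_shear[OF assms] by simp
  have "(\<lambda>k. \<Sum>\<^sub>\<infinity>l. cmod (b (k - l) * c l)) summable_on UNIV"
    by (rule summable_on_Sigma_banach[OF s])
  then show ?thesis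
  proof (rule summable_on_comparison_test)
    fix k
    have "(\<lambda>l. cmod (b (k - l) * c l)) summable_on UNIV"
      using summable_on_SigmaD1[OF s, of k] by simp
    then show "cmod (convolution b c k) \<le> (\<Sum>\<^sub>\<infinity>l. cmod (b (k - l) * c l))"
      unfolding convolution_def by (rule norm_infsum_bound)
  qed auto
qed

proposition trig_series_mult:
  assumes b: "(\<lambda>k. cmod (b k)) summable_on UNIV" and c: "(\<lambda>k. cmod (c k)) summable_on UNIV"
  shows "trig_series b x * trig_series c x = trig_series (convolution b c) x"
proof -
  let ?f = "\<lambda>j l. (b j * torus_char j x) * (c l * torus_char l x)"
  have s: "(\<lambda>(k, l). ?f (k - l) l) summable_on UNIV \<times> UNIV"
    by (rule abs_summable_summable)
       (use summable_shear[OF b c] in \<open>simp add: norm_mult case_prod_unfold\<close>)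
  have s': "(\<lambda>(j, l). ?f j l) summable_on UNIV \<times> UNIV"
    using s summable_on_reindex_bij_betw[OF bij_betw_shear, of "\<lambda>(j, l). ?f j l"] by (simp add: case_prod_unfold)
  have "trig_series b x * trig_series c x = (\<Sum>\<^sub>\<infinity>j. \<Sum>\<^sub>\<infinity>l. ?f j l)"
    unfolding trig_series_def by (simp add: infsum_cmult_right' infsum_cmult_left')
  also have "\<dots> = (\<Sum>\<^sub>\<infinity>(j, l)\<in>UNIV. ?f j l)"
    using infsum_Sigma'_banach[OF s'] by simp
  also have "\<dots> = (\<Sum>\<^sub>\<infinity>(k, l)\<in>UNIV. ?f (k - l) l)"
    using infsum_reindex_bij_betw[OF bij_betw_shear, of "\<lambda>(j, l). ?f j l"] by (simp add: case_prod_unfold)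
  also have "\<dots> = (\<Sum>\<^sub>\<infinity>k. \<Sum>\<^sub>\<infinity>l. ?f (k - l) l)"
    using infsum_Sigma'_banach[OF s] by simp
  also have "\<dots> = (\<Sum>\<^sub>\<infinity>k. \<Sum>\<^sub>\<infinity>l. (b (k - l) * c l) * torus_char k x)"
  proof (intro infsum_cong)
    fix k l
    show "?f (k - l) l = (b (k - l) * c l) * torus_char k x"
      using torus_char_add[of "k - l" l x] by simp
  qed
  also have "\<dots> = trig_series (convolution b c) x"
    unfolding trig_series_def convolution_def by (simp add: infsum_cmult_left')
  finally show ?thesis .
qed

section \<open>A Gronwall inequality for truncated energies\<close>

text \<open>
  The mean value theorem for one-sided derivatives at the end points, in the form of a comparison.
\<close>
lemma mvt_compare:
  fixes f g :: "real \<Rightarrow> real"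
  assumes "0 \<le> t" "t \<le> \<tau>"
    and f: "\<And>u. u \<in> {0..\<tau>} \<Longrightarrow> (f has_real_derivative f' u) (at u within {0..\<tau>})"
    and g: "\<And>u. u \<in> {0..\<tau>} \<Longrightarrow> (g has_real_derivative g' u) (at u within {0..\<tau>})"
    and le: "\<And>u. u \<in> {0..\<tau>} \<Longrightarrow> f' u \<le> g' u"
  shows "f t - f 0 \<le> g t - g 0"
proof -
  have "\<exists>u\<in>{0..t}. (\<lambda>u. f u - g u) t - (\<lambda>u. f u - g u) 0 = (\<lambda>x. (f' u - g' u) * x) (t - 0)"
  proof (rule mvt_very_simple)
    fix u assume "0 \<le> u" "u \<le> t"
    then have "((\<lambda>u. f u - g u) has_real_derivative (f' u - g' u)) (at u within {0..\<tau>})"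
      using assms by (intro DERIV_diff f g) auto
    then show "((\<lambda>u. f u - g u) has_derivative (\<lambda>x. (f' u - g' u) * x)) (at u within {0..t})"
      unfolding has_field_derivative_def by (rule has_derivative_subset) (use assms(2) in auto)
  qed (use assms in auto)
  then obtain u where u: "u \<in> {0..t}" "f t - g t - (f 0 - g 0) = (f' u - g' u) * t" by auto
  have "(f' u - g' u) * t \<le> 0" using u(1) assms by (intro mult_nonpos_nonneg) auto
  then show ?thesis using u(2) by linarith
qed

text \<open>
  A Gronwall inequality for a quantity \<open>V\<close> which is only known to be bounded and to be the limit of
  differentiable truncations \<open>E n\<close>; the derivatives of the truncations are bounded in terms of
  \<open>V\<close> itself. As \<open>V\<close> need not be continuous, the usual argument is replaced by one with the
  supremum \<open>Z\<close> of \<open>exp (- 2 c t) V t\<close>: integrating \<open>c V \<le> c Z exp (2 c t)\<close> returns only half of \<open>Z\<close>, which can be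
  absorbed. The hypothesis \<open>lim\<close> says that \<open>V t\<close> is the limit of \<open>E n t\<close> in the weak sense of
  inheriting upper bounds.
\<close>
lemma gronwall_truncated:
  fixes V :: "real \<Rightarrow> real" and E E' :: "nat \<Rightarrow> real \<Rightarrow> real"
  assumes c: "c > 0" and \<tau>: "0 \<le> \<tau>" and d: "0 \<le> d" and e0: "\<And>n. 0 \<le> e n" and e: "e \<longlonglongrightarrow> 0"
    and V: "\<And>t. t \<in> {0..\<tau>} \<Longrightarrow> 0 \<le> V t" "\<And>t. t \<in> {0..\<tau>} \<Longrightarrow> V t \<le> R"
    and E: "\<And>n t. t \<in> {0..\<tau>} \<Longrightarrow> (E n has_real_derivative E' n t) (at t within {0..\<tau>})"
    and E': "\<And>n t. t \<in> {0..\<tau>} \<Longrightarrow> E' n t \<le> c * V t + d + e n"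
    and init: "\<And>n. E n 0 \<le> V0"
    and lim: "\<And>t B \<beta>. t \<in> {0..\<tau>} \<Longrightarrow> \<beta> \<longlonglongrightarrow> 0 \<Longrightarrow> (\<And>n. E n t \<le> B + \<beta> n) \<Longrightarrow> V t \<le> B"
    and V0: "0 \<le> V0" and t: "t \<in> {0..\<tau>}"
  shows "V t \<le> 2 * (V0 + \<tau> * d) * exp (2 * c * t)"
proof -
  define \<kappa> where "\<kappa> = 2 * c"
  have \<kappa>: "\<kappa> > 0" using c by (simp add: \<kappa>_def)
  define Z where "Z = (SUP t\<in>{0..\<tau>}. exp (- \<kappa> * t) * V t)"
  have bdd: "bdd_above ((\<lambda>t. exp (- \<kappa> * t) * V t) ` {0..\<tau>})"
  proof (rule bdd_aboveI2)
    fix t assume "t \<in> {0..\<tau>}"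
    then show "exp (- \<kappa> * t) * V t \<le> R"
      using V[of t] \<kappa> mult_mono[of "exp (- \<kappa> * t)" 1 "V t" R] by auto
  qed
  have VZ: "V t \<le> Z * exp (\<kappa> * t)" if "t \<in> {0..\<tau>}" for t
  proof -
    have "exp (- \<kappa> * t) * V t \<le> Z" unfolding Z_def by (rule cSUP_upper[OF that bdd])
    then show ?thesis by (simp add: exp_minus field_simps)
  qed
  have Z0: "0 \<le> Z" using VZ[of 0] V(1)[of 0] \<tau> by simp
  have step: "V t \<le> V0 + \<tau> * d + Z / 2 * exp (\<kappa> * t)" if t: "t \<in> {0..\<tau>}" for t
  proof (rule lim[OF t, of "\<lambda>n. \<tau> * e n"])
    show "(\<lambda>n. \<tau> * e n) \<longlonglongrightarrow> 0" using tendsto_mult_right_zero[OF e] by simp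
    fix n
    have "E n t - E n 0 \<le> (\<lambda>t. Z / 2 * exp (\<kappa> * t) + (d + e n) * t) t - (\<lambda>t. Z / 2 * exp (\<kappa> * t) + (d + e n) * t) 0"
    proof (rule mvt_compare[of t \<tau> "E n" "E' n" _ "\<lambda>u. c * (Z * exp (\<kappa> * u)) + (d + e n)"])
      fix u assume u: "u \<in> {0..\<tau>}"
      show "((\<lambda>t. Z / 2 * exp (\<kappa> * t) + (d + e n) * t) has_real_derivative c * (Z * exp (\<kappa> * u)) + (d + e n)) (at u within {0..\<tau>})"
        by (auto intro!: derivative_eq_intros simp: \<kappa>_def)
      show "E' n u \<le> c * (Z * exp (\<kappa> * u)) + (d + e n)"
        using E'[OF u, of n] mult_left_mono[OF VZ[OF u], of c] c by linarith
    qed (use t E in auto)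
    moreover have "(d + e n) * t \<le> (d + e n) * \<tau>" using t d e0[of n] by (intro mult_left_mono) auto
    ultimately show "E n t \<le> V0 + \<tau> * d + Z / 2 * exp (\<kappa> * t) + \<tau> * e n"
      using init[of n] Z0 by (simp add: algebra_simps)
  qed
  have "Z \<le> V0 + \<tau> * d + Z / 2"
    unfolding Z_def
  proof (rule cSUP_least)
    fix t assume t: "t \<in> {0..\<tau>}"
    have "exp (- \<kappa> * t) * V t \<le> exp (- \<kappa> * t) * (V0 + \<tau> * d + Z / 2 * exp (\<kappa> * t))"
      by (intro mult_left_mono step t) auto
    also have "\<dots> = exp (- \<kappa> * t) * (V0 + \<tau> * d) + Z / 2"
      by (simp add: exp_minus field_simps)
    also have "\<dots> \<le> 1 * (V0 + \<tau> * d) + Z / 2"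
      using \<kappa> t V0 \<tau> d by (intro add_right_mono mult_right_mono) auto
    finally show "exp (- \<kappa> * t) * V t \<le> V0 + \<tau> * d + (SUP t\<in>{0..\<tau>}. exp (- \<kappa> * t) * V t) / 2"
      by (simp add: Z_def)
  qed (use \<tau> in auto)
  then have "Z \<le> 2 * (V0 + \<tau> * d)" by simp
  then have "Z * exp (\<kappa> * t) \<le> 2 * (V0 + \<tau> * d) * exp (\<kappa> * t)" by (intro mult_right_mono) auto
  with VZ[OF t] show ?thesis unfolding \<kappa>_def by (rule order_trans)
qed

section \<open>Convolution inequalities\<close>

lemma infsum_finite_sum:
  fixes f :: "'a \<Rightarrow> 'b \<Rightarrow> 'c::{topological_comm_monoid_add,t2_space}"
  assumes "finite K" "\<And>k. k \<in> K \<Longrightarrow> f k summable_on A"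
  shows "(\<Sum>\<^sub>\<infinity>l\<in>A. \<Sum>k\<in>K. f k l) = (\<Sum>k\<in>K. \<Sum>\<^sub>\<infinity>l\<in>A. f k l)" and "(\<lambda>l. \<Sum>k\<in>K. f k l) summable_on A"
  using assms
proof (induction K rule: finite_induct)
  case (insert k K)
  { case 1 then show ?case using insert by (simp add: infsum_add) }
  { case 2 then show ?case using insert by (simp add: summable_on_add) }
qed auto

lemma summable_le_infsum:
  fixes g :: "'a \<Rightarrow> real"
  assumes "g summable_on UNIV" "\<And>x. 0 \<le> g x"
  shows "g x \<le> infsum g UNIV"
  using finite_sum_le_infsum[OF assms(1), of "{x}"] assms(2) by simp

lemma summable_bounded_mult:
  fixes g h :: "'a \<Rightarrow> real"
  assumes "h summable_on UNIV" "\<And>x. 0 \<le> h x" "\<And>x. 0 \<le> g x" "\<And>x. g x \<le> B"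
  shows "(\<lambda>x. g x * h x) summable_on UNIV"
  by (rule summable_on_comparison_test[OF summable_on_cmult_right[OF assms(1), of B]]) (use assms in \<open>auto intro: mult_right_mono\<close>)

text \<open>
  For fixed \<open>l\<close> the sum over \<open>k\<close> is estimated by the Cauchy-Schwarz inequality; what remains is the
  sum of \<open>h\<close>.
\<close>
lemma young_l2_l1:
  fixes f g h :: "freq \<Rightarrow> real"
  assumes K: "finite K" and nn: "\<And>k. 0 \<le> f k" "\<And>k. 0 \<le> g k" "\<And>k. 0 \<le> h k"
    and g: "(\<lambda>k. (g k)\<^sup>2) summable_on UNIV" and h: "h summable_on UNIV"
  shows "(\<lambda>l. g (k - l) * h l) summable_on UNIV"
    and "(\<Sum>k\<in>K. f k * (\<Sum>\<^sub>\<infinity>l. g (k - l) * h l)) \<le> sqrt (\<Sum>k\<in>K. (f k)\<^sup>2) * sqrt (\<Sum>\<^sub>\<infinity>k. (g k)\<^sup>2) * infsum h UNIV"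
proof -
  let ?G = "\<Sum>\<^sub>\<infinity>k. (g k)\<^sup>2"
  have gB: "g k \<le> sqrt ?G" for k
    using summable_le_infsum[OF g, of k] nn(2)[of k] real_le_rsqrt by simp
  show s: "(\<lambda>l. g (k - l) * h l) summable_on UNIV" for k
    by (rule summable_bounded_mult[OF h nn(3) nn(2) gB])
  have "(\<Sum>k\<in>K. f k * (\<Sum>\<^sub>\<infinity>l. g (k - l) * h l)) = (\<Sum>k\<in>K. (\<Sum>\<^sub>\<infinity>l. f k * (g (k - l) * h l)))"
    by (simp add: infsum_cmult_right')
  also have "\<dots> = (\<Sum>\<^sub>\<infinity>l. \<Sum>k\<in>K. f k * (g (k - l) * h l))"
    by (rule infsum_finite_sum(1)[symmetric, OF K summable_on_cmult_right[OF s]])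
  also have "\<dots> \<le> (\<Sum>\<^sub>\<infinity>l. sqrt (\<Sum>k\<in>K. (f k)\<^sup>2) * sqrt ?G * h l)"
  proof (rule infsum_mono)
    show "(\<lambda>l. \<Sum>k\<in>K. f k * (g (k - l) * h l)) summable_on UNIV"
      by (rule infsum_finite_sum(2)[OF K summable_on_cmult_right[OF s]])
    show "(\<lambda>l. sqrt (\<Sum>k\<in>K. (f k)\<^sup>2) * sqrt ?G * h l) summable_on UNIV"
      by (rule summable_on_cmult_right[OF h])
    fix l
    have "(\<Sum>k\<in>K. (g (k - l))\<^sup>2) = (\<Sum>j\<in>(\<lambda>k. k - l) ` K. (g j)\<^sup>2)"
      by (subst sum.reindex) (auto intro: inj_onI)
    also have "\<dots> \<le> ?G" by (rule finite_sum_le_infsum[OF g]) (use K in auto)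
    finally have 1: "sqrt (\<Sum>k\<in>K. (g (k - l))\<^sup>2) \<le> sqrt ?G" by simp
    have "(\<Sum>k\<in>K. f k * g (k - l)) \<le> sqrt (\<Sum>k\<in>K. (f k)\<^sup>2) * sqrt (\<Sum>k\<in>K. (g (k - l))\<^sup>2)"
      using L2_set_mult_ineq[of f "\<lambda>k. g (k - l)" K] nn by (simp add: L2_set_def)
    also have "\<dots> \<le> sqrt (\<Sum>k\<in>K. (f k)\<^sup>2) * sqrt ?G"
      by (intro mult_left_mono 1) (auto intro: sum_nonneg)
    finally have "(\<Sum>k\<in>K. f k * g (k - l)) * h l \<le> sqrt (\<Sum>k\<in>K. (f k)\<^sup>2) * sqrt ?G * h l"
      by (rule mult_right_mono[OF _ nn(3)])
    then show "(\<Sum>k\<in>K. f k * (g (k - l) * h l)) \<le> sqrt (\<Sum>k\<in>K. (f k)\<^sup>2) * sqrt ?G * h l"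
      by (simp add: sum_distrib_right mult.assoc)
  qed
  also have "\<dots> = sqrt (\<Sum>k\<in>K. (f k)\<^sup>2) * sqrt ?G * infsum h UNIV" by (rule infsum_cmult_right')
  finally show "(\<Sum>k\<in>K. f k * (\<Sum>\<^sub>\<infinity>l. g (k - l) * h l)) \<le> sqrt (\<Sum>k\<in>K. (f k)\<^sup>2) * sqrt ?G * infsum h UNIV" .
qed

lemma bij_betw_reflect: "bij_betw (\<lambda>l. k - l) (UNIV :: freq set) UNIV"
  by (rule bij_betwI[where g = "\<lambda>l. k - l"]) auto

lemma young_l1_l2:
  fixes f g h :: "freq \<Rightarrow> real"
  assumes K: "finite K" and nn: "\<And>k. 0 \<le> f k" "\<And>k. 0 \<le> g k" "\<And>k. 0 \<le> h k"
    and g: "g summable_on UNIV" and h: "(\<lambda>k. (h k)\<^sup>2) summable_on UNIV"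
  shows "(\<lambda>l. g (k - l) * h l) summable_on UNIV"
    and "(\<Sum>k\<in>K. f k * (\<Sum>\<^sub>\<infinity>l. g (k - l) * h l)) \<le> sqrt (\<Sum>k\<in>K. (f k)\<^sup>2) * sqrt (\<Sum>\<^sub>\<infinity>k. (h k)\<^sup>2) * infsum g UNIV"
proof -
  have *: "(\<Sum>\<^sub>\<infinity>l. g (k - l) * h l) = (\<Sum>\<^sub>\<infinity>l. h (k - l) * g l)" for k
    using infsum_reindex_bij_betw[OF bij_betw_reflect[of k], of "\<lambda>l. g (k - l) * h l"] by (simp add: mult.commute)
  show "(\<lambda>l. g (k - l) * h l) summable_on UNIV"
    using young_l2_l1(1)[OF K nn(1,3,2) h g, of k] summable_on_reindex_bij_betw[OF bij_betw_reflect[of k], of "\<lambda>l. g (k - l) * h l"]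
    by (simp add: mult.commute)
  show "(\<Sum>k\<in>K. f k * (\<Sum>\<^sub>\<infinity>l. g (k - l) * h l)) \<le> sqrt (\<Sum>k\<in>K. (f k)\<^sup>2) * sqrt (\<Sum>\<^sub>\<infinity>k. (h k)\<^sup>2) * infsum g UNIV"
    unfolding * by (rule young_l2_l1(2)[OF K nn(1,3,2) h g])
qed

section \<open>The transport term in Fourier variables\<close>

definition transport_symbol :: "real \<Rightarrow> freq \<Rightarrow> freq \<Rightarrow> real" where
  "transport_symbol \<nu> j l = M1_symbol \<nu> j * real_of_int (fst l) + M2_symbol \<nu> j * real_of_int (snd l)"

text \<open>
  The Fourier coefficients of \<open>u \<bullet> \<nabla>\<theta>\<close>, where \<open>\<theta>\<close> has the coefficients \<open>a\<close> and the velocity \<open>u\<close> is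
  computed from the coefficients \<open>b\<close>.
\<close>
definition transport :: "real \<Rightarrow> coeffs \<Rightarrow> coeffs \<Rightarrow> coeffs" where
  "transport \<nu> b a k = (\<Sum>\<^sub>\<infinity>l. \<i> * of_real (transport_symbol \<nu> (k - l) l) * (b (k - l) * a l))"

lemma transport_symbol_add: "transport_symbol \<nu> j (k + l) = transport_symbol \<nu> j k + transport_symbol \<nu> j l"
  by (simp add: transport_symbol_def algebra_simps)

lemma M_symbol_uminus [simp]: "M1_symbol \<nu> (- k) = M1_symbol \<nu> k" "M2_symbol \<nu> (- k) = M2_symbol \<nu> k"
  by (simp_all add: M1_symbol_def M2_symbol_def freq_sq_def)

lemma transport_symbol_uminus [simp]: "transport_symbol \<nu> (- j) l = transport_symbol \<nu> j l"
  by (simp add: transport_symbol_def)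

text \<open>
  The velocity is divergence free.
\<close>
lemma transport_symbol_self [simp]: "transport_symbol \<nu> j j = 0"
  by (simp add: transport_symbol_def M1_symbol_def M2_symbol_def power2_eq_square)

lemma M_symbol_quotient_le:
  "\<bar>real_of_int (fst k) * real_of_int (snd k) / freq_sq k\<bar> \<le> 1" "\<bar>- (real_of_int (fst k))\<^sup>2 / freq_sq k\<bar> \<le> 1"
proof -
  show "\<bar>- (real_of_int (fst k))\<^sup>2 / freq_sq k\<bar> \<le> 1"
    by (cases "freq_sq k = 0") (auto simp: freq_sq_def divide_le_eq_1 sum_power2_gt_zero_iff)
  have "2 * (\<bar>real_of_int (fst k)\<bar> * \<bar>real_of_int (snd k)\<bar>) \<le> freq_sq k"
    using sum_squares_bound[of "\<bar>real_of_int (fst k)\<bar>" "\<bar>real_of_int (snd k)\<bar>"] by (simp add: freq_sq_def)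
  moreover have "0 \<le> \<bar>real_of_int (fst k)\<bar> * \<bar>real_of_int (snd k)\<bar>" by simp
  ultimately have "\<bar>real_of_int (fst k)\<bar> * \<bar>real_of_int (snd k)\<bar> \<le> freq_sq k" by linarith
  then show "\<bar>real_of_int (fst k) * real_of_int (snd k) / freq_sq k\<bar> \<le> 1"
    by (cases "freq_sq k = 0") (auto simp: abs_mult divide_le_eq_1 less_le)
qed

lemma M_symbol_le:
  assumes "0 \<le> \<nu>"
  shows "\<bar>M1_symbol \<nu> k\<bar> \<le> 1" "\<bar>M2_symbol \<nu> k\<bar> \<le> 1"
proof -
  have "0 \<le> \<nu> * freq_sq k" using assms by simp
  then have "\<bar>1 / (1 + \<nu> * freq_sq k)\<bar> \<le> 1" by simp
  from mult_mono[OF this M_symbol_quotient_le(1)[of k]] mult_mono[OF this M_symbol_quotient_le(2)[of k]]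
  show "\<bar>M1_symbol \<nu> k\<bar> \<le> 1" "\<bar>M2_symbol \<nu> k\<bar> \<le> 1"
    by (auto simp: M1_symbol_def M2_symbol_def abs_mult)
qed

text \<open>
  The Brinkman regularisation is a perturbation of order \<open>\<nu>\<close> at the price of two derivatives.
\<close>
lemma M_symbol_diff_le:
  assumes "0 \<le> \<nu>"
  shows "\<bar>M1_symbol \<nu> k - M1_symbol 0 k\<bar> \<le> \<nu> * (bracket k)\<^sup>2" "\<bar>M2_symbol \<nu> k - M2_symbol 0 k\<bar> \<le> \<nu> * (bracket k)\<^sup>2"
proof -
  have "\<bar>1 / (1 + \<nu> * freq_sq k) - 1\<bar> \<le> \<nu> * (bracket k)\<^sup>2"
  proof -
    have p: "0 \<le> \<nu> * freq_sq k" using assms by simp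
    have "\<bar>1 / (1 + z) - 1\<bar> \<le> z" if "0 \<le> z" for z :: real
    proof -
      have "(1 - z) * (1 + z) \<le> 1" by (simp add: algebra_simps)
      then have "1 - z \<le> 1 / (1 + z)" using that by (simp add: pos_le_divide_eq)
      moreover have "1 / (1 + z) \<le> 1" using that by simp
      ultimately show ?thesis using that by (simp add: abs_le_iff)
    qed
    from this[OF p] have "\<bar>1 / (1 + \<nu> * freq_sq k) - 1\<bar> \<le> \<nu> * freq_sq k" .
    also have "\<dots> \<le> \<nu> * (bracket k)\<^sup>2" using assms by (simp add: bracket_def mult_left_mono)
    finally show ?thesis .
  qed
  then have *: "\<bar>(1 / (1 + \<nu> * freq_sq k) - 1) * z\<bar> \<le> \<nu> * (bracket k)\<^sup>2" if "\<bar>z\<bar> \<le> 1" for z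
    unfolding abs_mult using that mult_mono[of "\<bar>1 / (1 + \<nu> * freq_sq k) - 1\<bar>" "\<nu> * (bracket k)\<^sup>2" "\<bar>z\<bar>" 1] assms by simp
  define c where "c = 1 / (1 + \<nu> * freq_sq k)"
  define q where "q = real_of_int (fst k) * real_of_int (snd k) / freq_sq k"
  define r where "r = - (real_of_int (fst k))\<^sup>2 / freq_sq k"
  have "M1_symbol \<nu> k - M1_symbol 0 k = (if k = 0 then 0 else c * q - q)"
    "M2_symbol \<nu> k - M2_symbol 0 k = (if k = 0 then 0 else c * r - r)"
    by (simp_all only: M1_symbol_def M2_symbol_def c_def q_def r_def split: if_split) simp_all
  moreover have "\<bar>c * q - q\<bar> \<le> \<nu> * (bracket k)\<^sup>2" "\<bar>c * r - r\<bar> \<le> \<nu> * (bracket k)\<^sup>2"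
    using *[OF M_symbol_quotient_le(1)[of k]] *[OF M_symbol_quotient_le(2)[of k]]
    unfolding c_def q_def r_def by (simp_all only: left_diff_distrib mult_1_left)
  ultimately show "\<bar>M1_symbol \<nu> k - M1_symbol 0 k\<bar> \<le> \<nu> * (bracket k)\<^sup>2" "\<bar>M2_symbol \<nu> k - M2_symbol 0 k\<bar> \<le> \<nu> * (bracket k)\<^sup>2"
    using assms by auto
qed

lemma transport_symbol_le:
  assumes "0 \<le> \<nu>" shows "\<bar>transport_symbol \<nu> j l\<bar> \<le> 2 * bracket l"
proof -
  have "\<bar>transport_symbol \<nu> j l\<bar> \<le> \<bar>M1_symbol \<nu> j\<bar> * \<bar>real_of_int (fst l)\<bar> + \<bar>M2_symbol \<nu> j\<bar> * \<bar>real_of_int (snd l)\<bar>"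
    unfolding transport_symbol_def by (metis abs_mult abs_triangle_ineq)
  also have "\<dots> \<le> 1 * bracket l + 1 * bracket l"
    by (intro add_mono mult_mono M_symbol_le assms freq_le_bracket) auto
  finally show ?thesis by simp
qed

lemma transport_symbol_diff_le:
  assumes "0 \<le> \<nu>" shows "\<bar>transport_symbol \<nu> j l - transport_symbol 0 j l\<bar> \<le> 2 * \<nu> * (bracket j)\<^sup>2 * bracket l"
proof -
  have "transport_symbol \<nu> j l - transport_symbol 0 j l
     = (M1_symbol \<nu> j - M1_symbol 0 j) * real_of_int (fst l) + (M2_symbol \<nu> j - M2_symbol 0 j) * real_of_int (snd l)"
    by (simp add: transport_symbol_def algebra_simps)
  then have "\<bar>transport_symbol \<nu> j l - transport_symbol 0 j l\<bar>
     \<le> \<bar>M1_symbol \<nu> j - M1_symbol 0 j\<bar> * \<bar>real_of_int (fst l)\<bar> + \<bar>M2_symbol \<nu> j - M2_symbol 0 j\<bar> * \<bar>real_of_int (snd l)\<bar>"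
    by (metis abs_mult abs_triangle_ineq)
  also have "\<dots> \<le> (\<nu> * (bracket j)\<^sup>2) * bracket l + (\<nu> * (bracket j)\<^sup>2) * bracket l"
    using assms by (intro add_mono mult_mono M_symbol_diff_le freq_le_bracket) auto
  finally show ?thesis by (simp add: mult_ac)
qed

definition wiener_summable :: "coeffs \<Rightarrow> bool" where
  "wiener_summable a \<longleftrightarrow> (\<lambda>k. bracket k * cmod (a k)) summable_on UNIV"

text \<open>
  Up to constants, this norm dominates the suprema of the function, of its gradient and of the gradient of its
  velocity, and it is a weighted \<open>l\<^sup>1\<close> norm, as needed for Young's inequality.
\<close>
definition wiener :: "coeffs \<Rightarrow> real" where
  "wiener a = (\<Sum>\<^sub>\<infinity>k. bracket k * cmod (a k))"

text \<open>
  The coefficient sequences of real functions.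
\<close>
definition hermitian :: "coeffs \<Rightarrow> bool" where
  "hermitian a \<longleftrightarrow> (\<forall>k. a (- k) = cnj (a k))"

lemma wiener_le: "wiener_summable a \<Longrightarrow> bracket k * cmod (a k) \<le> wiener a"
  unfolding wiener_summable_def wiener_def by (rule summable_le_infsum) auto

lemma wiener_nonneg: "0 \<le> wiener a"
  unfolding wiener_def by (rule infsum_nonneg) simp

lemma cmod_le_bracket_cmod: "cmod (a k) \<le> bracket k * cmod (a k)"
  by (simp add: mult_le_cancel_right1)

lemma transport_summable:
  assumes \<nu>: "0 \<le> \<nu>" and b: "wiener_summable b" and a: "wiener_summable a"
  shows "(\<lambda>l. cmod (\<i> * of_real (transport_symbol \<nu> (k - l) l) * (b (k - l) * a l))) summable_on UNIV"
    and "(\<lambda>l. \<i> * of_real (transport_symbol \<nu> (k - l) l) * (b (k - l) * a l)) summable_on UNIV"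
proof -
  show *: "(\<lambda>l. cmod (\<i> * of_real (transport_symbol \<nu> (k - l) l) * (b (k - l) * a l))) summable_on UNIV"
  proof (rule summable_on_comparison_test)
    show "(\<lambda>l. (2 * wiener b) * (bracket l * cmod (a l))) summable_on UNIV"
      using a unfolding wiener_summable_def by (rule summable_on_cmult_right)
    fix l
    have "cmod (b (k - l)) \<le> wiener b"
      using wiener_le[OF b, of "k - l"] cmod_le_bracket_cmod[of b "k - l"] by linarith
    then have "\<bar>transport_symbol \<nu> (k - l) l\<bar> * (cmod (b (k - l)) * cmod (a l)) \<le> (2 * bracket l) * (wiener b * cmod (a l))"
      by (intro mult_mono transport_symbol_le \<nu> order_refl) (auto simp: wiener_nonneg)
    then show "cmod (\<i> * of_real (transport_symbol \<nu> (k - l) l) * (b (k - l) * a l)) \<le> (2 * wiener b) * (bracket l * cmod (a l))"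
      by (simp add: norm_mult mult_ac)
  qed auto
  show "(\<lambda>l. \<i> * of_real (transport_symbol \<nu> (k - l) l) * (b (k - l) * a l)) summable_on UNIV"
    by (rule abs_summable_summable[OF *])
qed

text \<open>
  With \<open>X k l\<close> denoting the summand of the trilinear form, \<open>cnj (X k l) = - X l k\<close>: for this, replace \<open>l\<close> by \<open>k\<close>
  in the symbol (the symbol of \<open>k - l\<close> annihilates \<open>k - l\<close>) and use that the symbol is even and \<open>b\<close> hermitian.
  Hence the symmetric part \<open>\<phi> k \<phi> l X k l\<close>, a finite double sum, is purely imaginary and only the
  commutator \<open>\<phi> k - \<phi> l\<close> is left.
\<close>
proposition transport_cancellation:
  fixes \<phi> :: "freq \<Rightarrow> real"
  assumes \<nu>: "0 \<le> \<nu>" and b: "wiener_summable b" "hermitian b" and w: "wiener_summable w"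
    and K: "finite K" and \<phi>: "{k. \<phi> k \<noteq> 0} \<subseteq> K"
  shows "Re (\<Sum>k\<in>K. of_real ((\<phi> k)\<^sup>2) * (cnj (w k) * transport \<nu> b w k))
      = Re (\<Sum>k\<in>K. \<Sum>\<^sub>\<infinity>l. of_real (\<phi> k * (\<phi> k - \<phi> l)) * (cnj (w k) * (\<i> * of_real (transport_symbol \<nu> (k - l) l) * (b (k - l) * w l))))"
proof -
  define X where "X k l = cnj (w k) * (\<i> * of_real (transport_symbol \<nu> (k - l) l) * (b (k - l) * w l))" for k l
  have Xs: "X k summable_on UNIV" for k
    unfolding X_def by (intro summable_on_cmult_right transport_summable \<nu> b w)
  have anti: "cnj (X k l) = - X l k" for k l
  proof -
    have "transport_symbol \<nu> (k - l) l = transport_symbol \<nu> (k - l) k"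
      using transport_symbol_add[of \<nu> "k - l" "k - l" l] by simp
    also have "\<dots> = transport_symbol \<nu> (l - k) k"
      using transport_symbol_uminus[of \<nu> "k - l" k] by simp
    finally have s: "transport_symbol \<nu> (k - l) l = transport_symbol \<nu> (l - k) k" .
    have "b (l - k) = cnj (b (k - l))" using b(2) unfolding hermitian_def by (metis minus_diff_eq)
    then show ?thesis by (simp add: X_def s)
  qed
  define S where "S = (\<Sum>k\<in>K. \<Sum>l\<in>K. of_real (\<phi> k * \<phi> l) * X k l)"
  have "cnj S = (\<Sum>k\<in>K. \<Sum>l\<in>K. - (of_real (\<phi> l * \<phi> k) * X l k))"
    unfolding S_def cnj_sum complex_cnj_mult anti by (simp add: mult.commute)
  also have "\<dots> = - S" unfolding S_def by (subst sum.swap) (simp add: sum_negf)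
  finally have "Re (cnj S) = - Re S" by simp
  then have S0: "Re S = 0" by simp
  have inner: "(\<Sum>\<^sub>\<infinity>l. of_real (\<phi> k * \<phi> l) * X k l) = (\<Sum>l\<in>K. of_real (\<phi> k * \<phi> l) * X k l)"
    and inner_s: "(\<lambda>l. of_real (\<phi> k * \<phi> l) * X k l) summable_on UNIV" for k
  proof -
    have "((\<lambda>l. of_real (\<phi> k * \<phi> l) * X k l) has_sum (\<Sum>l\<in>K. of_real (\<phi> k * \<phi> l) * X k l)) UNIV"
      by (rule has_sum_finite_neutralI) (use K \<phi> in auto)
    then show "(\<Sum>\<^sub>\<infinity>l. of_real (\<phi> k * \<phi> l) * X k l) = (\<Sum>l\<in>K. of_real (\<phi> k * \<phi> l) * X k l)"
      "(\<lambda>l. of_real (\<phi> k * \<phi> l) * X k l) summable_on UNIV"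
      using infsumI has_sum_imp_summable by blast+
  qed
  have split: "of_real ((\<phi> k)\<^sup>2) * (cnj (w k) * transport \<nu> b w k)
     = (\<Sum>l\<in>K. of_real (\<phi> k * \<phi> l) * X k l) + (\<Sum>\<^sub>\<infinity>l. of_real (\<phi> k * (\<phi> k - \<phi> l)) * X k l)" for k
  proof -
    have 0: "(\<lambda>l. of_real ((\<phi> k)\<^sup>2) * X k l) summable_on UNIV" by (intro summable_on_cmult_right Xs)
    have e: "of_real (\<phi> k * (\<phi> k - \<phi> l)) * X k l = of_real ((\<phi> k)\<^sup>2) * X k l + - (of_real (\<phi> k * \<phi> l) * X k l)" for l
      by (simp add: algebra_simps power2_eq_square)
    have "(\<Sum>\<^sub>\<infinity>l. of_real (\<phi> k * (\<phi> k - \<phi> l)) * X k l)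
        = (\<Sum>\<^sub>\<infinity>l. of_real ((\<phi> k)\<^sup>2) * X k l) + (\<Sum>\<^sub>\<infinity>l. - (of_real (\<phi> k * \<phi> l) * X k l))"
      unfolding e by (rule infsum_add[OF 0]) (use inner_s in \<open>simp add: summable_on_uminus\<close>)
    also have "\<dots> = (\<Sum>\<^sub>\<infinity>l. of_real ((\<phi> k)\<^sup>2) * X k l) - (\<Sum>l\<in>K. of_real (\<phi> k * \<phi> l) * X k l)"
      by (simp only: infsum_uminus inner) simp
    also have "(\<Sum>\<^sub>\<infinity>l. of_real ((\<phi> k)\<^sup>2) * X k l) = of_real ((\<phi> k)\<^sup>2) * (cnj (w k) * transport \<nu> b w k)"
      unfolding X_def transport_def by (simp only: infsum_cmult_right')
    finally show ?thesis by simp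
  qed
  have "Re (\<Sum>k\<in>K. of_real ((\<phi> k)\<^sup>2) * (cnj (w k) * transport \<nu> b w k))
     = Re S + Re (\<Sum>k\<in>K. \<Sum>\<^sub>\<infinity>l. of_real (\<phi> k * (\<phi> k - \<phi> l)) * X k l)"
    unfolding split sum.distrib S_def by simp
  then show ?thesis unfolding S0 by (simp add: X_def)
qed

section \<open>Sobolev norms of coefficient sequences\<close>

definition sobolev_summable :: "real \<Rightarrow> coeffs \<Rightarrow> bool" where
  "sobolev_summable s a \<longleftrightarrow> (\<lambda>k. (bracket k powr s * cmod (a k))\<^sup>2) summable_on UNIV"

definition sobolev_sq :: "real \<Rightarrow> coeffs \<Rightarrow> real" where
  "sobolev_sq s a = (\<Sum>\<^sub>\<infinity>k. (bracket k powr s * cmod (a k))\<^sup>2)"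

lemma sobolev_sq_nonneg [simp]: "0 \<le> sobolev_sq s a"
  unfolding sobolev_sq_def by (rule infsum_nonneg) simp

lemma sobolev_summable_mono:
  assumes "sobolev_summable s a" "r \<le> s"
  shows "sobolev_summable r a" "sobolev_sq r a \<le> sobolev_sq s a"
proof -
  have le: "(bracket k powr r * cmod (a k))\<^sup>2 \<le> (bracket k powr s * cmod (a k))\<^sup>2" for k
    by (intro power_mono mult_right_mono powr_mono) (use assms in auto)
  show s: "sobolev_summable r a"
    using assms(1) unfolding sobolev_summable_def
    by (rule summable_on_comparison_test) (use le in auto)
  show "sobolev_sq r a \<le> sobolev_sq s a"
    using s assms(1) le unfolding sobolev_sq_def sobolev_summable_def by (intro infsum_mono) auto
qed

lemma sobolev_coefficient_le: "sobolev_summable s a \<Longrightarrow> (bracket k powr s * cmod (a k))\<^sup>2 \<le> sobolev_sq s a"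
  unfolding sobolev_summable_def sobolev_sq_def by (rule summable_le_infsum) auto

lemma sobolev_diff:
  assumes "sobolev_summable s a" "sobolev_summable s b"
  shows "sobolev_summable s (\<lambda>k. a k - b k)" "sobolev_sq s (\<lambda>k. a k - b k) \<le> 2 * sobolev_sq s a + 2 * sobolev_sq s b"
proof -
  let ?f = "\<lambda>a k. (bracket k powr s * cmod (a k))\<^sup>2"
  have sm: "(\<lambda>k. 2 * ?f a k + 2 * ?f b k) summable_on UNIV"
    using assms unfolding sobolev_summable_def by (intro summable_on_add summable_on_cmult_right)
  have le: "?f (\<lambda>k. a k - b k) k \<le> 2 * ?f a k + 2 * ?f b k" for k
  proof -
    have "bracket k powr s * cmod (a k - b k) \<le> bracket k powr s * cmod (a k) + bracket k powr s * cmod (b k)"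
      using mult_left_mono[OF norm_triangle_ineq4[of "a k" "b k"], of "bracket k powr s"] by (simp add: distrib_left)
    then have "?f (\<lambda>k. a k - b k) k \<le> (bracket k powr s * cmod (a k) + bracket k powr s * cmod (b k))\<^sup>2"
      by (rule power_mono) simp
    also have "\<dots> \<le> 2 * ?f a k + 2 * ?f b k"
      using sum_squares_bound[of "bracket k powr s * cmod (a k)" "bracket k powr s * cmod (b k)"]
      by (simp only: power2_sum)
    finally show ?thesis .
  qed
  show s: "sobolev_summable s (\<lambda>k. a k - b k)"
    unfolding sobolev_summable_def by (rule summable_on_comparison_test[OF sm le]) simp
  have "sobolev_sq s (\<lambda>k. a k - b k) \<le> (\<Sum>\<^sub>\<infinity>k. 2 * ?f a k + 2 * ?f b k)"
    unfolding sobolev_sq_def by (rule infsum_mono[OF s[unfolded sobolev_summable_def] sm le])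
  also have "\<dots> = 2 * sobolev_sq s a + 2 * sobolev_sq s b"
    using assms unfolding sobolev_sq_def sobolev_summable_def
    by (subst infsum_add) (auto intro: summable_on_cmult_right simp: infsum_cmult_right')
  finally show "sobolev_sq s (\<lambda>k. a k - b k) \<le> 2 * sobolev_sq s a + 2 * sobolev_sq s b" .
qed

lemma summable_int_powr:
  assumes "p > 1" shows "(\<lambda>n::int. (1 + (real_of_int n)\<^sup>2) powr (- p / 2)) summable_on UNIV"
proof -
  have nat: "(\<lambda>n::nat. (1 + (real n)\<^sup>2) powr (- p / 2)) summable_on UNIV"
  proof (subst summable_on_UNIV_nonneg_real_iff)
    show "summable (\<lambda>n::nat. (1 + (real n)\<^sup>2) powr (- p / 2))"
    proof (rule summable_comparison_test_ev)
      show "summable (\<lambda>n. real n powr (- p))" using assms by (simp add: summable_real_powr_iff)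
      show "\<forall>\<^sub>F n in sequentially. norm ((1 + (real n)\<^sup>2) powr (- p / 2)) \<le> real n powr (- p)"
        using eventually_gt_at_top[of 0]
      proof eventually_elim
        case (elim n)
        have "(1 + (real n)\<^sup>2) powr (- p / 2) \<le> ((real n)\<^sup>2) powr (- p / 2)"
          using elim assms by (intro powr_mono2') auto
        also have "((real n)\<^sup>2) powr (- p / 2) = (real n powr 2) powr (- p / 2)" using elim by (simp add: powr_numeral)
        also have "\<dots> = real n powr (- p)" by (simp only: powr_powr) simp
        finally show ?case by simp
      qed
    qed
  qed auto
  have U: "(UNIV :: int set) = range int \<union> range (\<lambda>n. - int n)"
    by (auto intro: range_eqI) (metis int_cases2 rangeI)
  show ?thesis
    unfolding U by (intro summable_on_union; subst summable_on_reindex) (use nat in \<open>auto simp: o_def inj_on_def\<close>)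
qed

text \<open>
  Since \<open>1 + m\<^sup>2 + n\<^sup>2\<close> dominates both \<open>1 + m\<^sup>2\<close> and \<open>1 + n\<^sup>2\<close>, half of the negative exponent can be spent on
  each factor, which reduces the lattice sum to a product of two convergent sums over the integers.
\<close>
lemma summable_bracket:
  assumes "s > 2" shows "(\<lambda>k. (bracket k powr (1 - s))\<^sup>2) summable_on UNIV"
proof -
  define g where "g n = (1 + (real_of_int n)\<^sup>2) powr (- (s - 1) / 2)" for n :: int
  have g: "g summable_on UNIV" unfolding g_def using summable_int_powr[of "s - 1"] assms by simp
  have g0: "0 \<le> g n" for n by (simp add: g_def)
  have "(\<lambda>(m, n). g m * g n) summable_on UNIV \<times> UNIV"
    by (rule summable_on_SigmaI[where g = "\<lambda>m. g m * infsum g UNIV"])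
       (auto intro!: has_sum_cmult_right has_sum_infsum g summable_on_cmult_left simp: g0)
  then have "(\<lambda>(m, n). g m * g n) summable_on UNIV" by simp
  then show ?thesis
  proof (rule summable_on_comparison_test)
    fix k :: freq
    obtain m n where k: "k = (m, n)" by fastforce
    define x where "x = 1 + (real_of_int m)\<^sup>2"
    define y where "y = 1 + (real_of_int n)\<^sup>2"
    have xy: "1 \<le> x" "1 \<le> y" by (auto simp: x_def y_def)
    define z where "z = 1 + freq_sq k"
    have z: "x \<le> z" "y \<le> z" by (auto simp: x_def y_def z_def k freq_sq_def)
    have "(bracket k powr (1 - s))\<^sup>2 = z powr (1 - s)"
      using bracket_powr[of k "1 - s"] by (simp add: z_def)
    also have "\<dots> = z powr (- (s - 1) / 2) * z powr (- (s - 1) / 2)"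
    proof -
      have "1 - s = - (s - 1) / 2 + - (s - 1) / 2" by (simp add: field_simps)
      then show ?thesis by (metis powr_add)
    qed
    also have "\<dots> \<le> x powr (- (s - 1) / 2) * y powr (- (s - 1) / 2)"
      using xy z assms by (intro mult_mono powr_mono2') auto
    finally show "(bracket k powr (1 - s))\<^sup>2 \<le> (case k of (m, n) \<Rightarrow> g m * g n)"
      by (simp add: k g_def x_def y_def)
  qed auto
qed

text \<open>
  Write the left side as \<open>(bracket k powr s * cmod z) * bracket k powr (1 - s)\<close> and apply Young's
  inequality with parameter \<open>\<eta>\<close>; the second factor is square summable for \<open>s > 2\<close>.
\<close>
lemma bracket_cmod_split:
  assumes "\<eta> > 0"
  shows "bracket k * cmod z \<le> \<eta> * (bracket k powr s * cmod z)\<^sup>2 + (bracket k powr (1 - s))\<^sup>2 / (4 * \<eta>)"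
proof -
  define x where "x = bracket k powr s * cmod z"
  define y where "y = bracket k powr (1 - s)"
  have "bracket k * cmod z = x * y"
    by (simp add: x_def y_def mult_ac flip: powr_add mult.assoc)
  moreover have "0 \<le> (2 * \<eta> * x - y)\<^sup>2 / (4 * \<eta>)" using assms by simp
  moreover have "(2 * \<eta> * x - y)\<^sup>2 / (4 * \<eta>) = \<eta> * x\<^sup>2 + y\<^sup>2 / (4 * \<eta>) - x * y"
    using assms by (simp add: power2_eq_square field_simps)
  ultimately show ?thesis unfolding x_def[symmetric] y_def[symmetric] by linarith
qed

lemma sobolev_imp_wiener:
  assumes s: "s > 2" and a: "sobolev_summable s a"
  shows "wiener_summable a" "wiener a \<le> sobolev_sq s a + (\<Sum>\<^sub>\<infinity>k. (bracket k powr (1 - s))\<^sup>2)"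
proof -
  let ?f = "\<lambda>k. (bracket k powr s * cmod (a k))\<^sup>2" and ?g = "\<lambda>k. (bracket k powr (1 - s))\<^sup>2"
  have le: "bracket k * cmod (a k) \<le> ?f k + ?g k" for k
    using bracket_cmod_split[of 1 k "a k" s] zero_le_power2[of "bracket k powr (1 - s)"] by linarith
  have sm: "(\<lambda>k. ?f k + ?g k) summable_on UNIV"
    using a summable_bracket[OF s] unfolding sobolev_summable_def by (rule summable_on_add)
  show w: "wiener_summable a"
    unfolding wiener_summable_def by (rule summable_on_comparison_test[OF sm le]) simp
  have "wiener a \<le> (\<Sum>\<^sub>\<infinity>k. ?f k + ?g k)"
    unfolding wiener_def by (rule infsum_mono[OF w[unfolded wiener_summable_def] sm le])
  also have "\<dots> = sobolev_sq s a + infsum ?g UNIV"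
    unfolding sobolev_sq_def using a summable_bracket[OF s] unfolding sobolev_summable_def by (rule infsum_add)
  finally show "wiener a \<le> sobolev_sq s a + infsum ?g UNIV" .
qed

text \<open>
  The quantitative form of the compact embedding of \<open>H\<^sup>s\<close>, \<open>s > 2\<close>, into the space normed by \<open>wiener\<close>:
  high frequencies are controlled by the bound \<open>R\<close>, low ones by their individual size.
\<close>
lemma wiener_small:
  assumes s: "s > 2" and e: "\<epsilon> > 0" and R: "0 \<le> R"
  obtains F \<delta> where "finite F" "\<delta> > 0"
    "\<And>w. \<lbrakk>sobolev_summable s w; sobolev_sq s w \<le> R; \<And>k. k \<in> F \<Longrightarrow> cmod (w k) \<le> \<delta>\<rbrakk> \<Longrightarrow> wiener w \<le> \<epsilon>"
proof -
  \<comment> \<open>a third of \<open>\<epsilon>\<close> each for the low frequencies, for the \<open>H\<^sup>s\<close> part and for the tail of the lattice sum\<close>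
  define \<eta> where "\<eta> = \<epsilon> / (3 * (R + 1))"
  have \<eta>: "\<eta> > 0" using e R by (simp add: \<eta>_def)
  let ?g = "\<lambda>k. (bracket k powr (1 - s))\<^sup>2"
  obtain F where F: "finite F" "\<bar>infsum ?g (- F)\<bar> \<le> 4 * \<eta> * \<epsilon> / 3"
    using summable_tail_small[OF summable_bracket[OF s], of "4 * \<eta> * \<epsilon> / 3"] \<eta> e by auto
  define S where "S = (\<Sum>k\<in>F. bracket k)"
  have S: "0 \<le> S" unfolding S_def by (intro sum_nonneg) simp
  define \<delta> where "\<delta> = \<epsilon> / (3 * (S + 1))"
  have \<delta>: "\<delta> > 0" using e S by (simp add: \<delta>_def)
  have "wiener w \<le> \<epsilon>" if w: "sobolev_summable s w" "sobolev_sq s w \<le> R" and small: "\<And>k. k \<in> F \<Longrightarrow> cmod (w k) \<le> \<delta>" for w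
  proof -
    let ?f = "\<lambda>k. (bracket k powr s * cmod (w k))\<^sup>2"
    have f: "?f summable_on UNIV" using w(1) unfolding sobolev_summable_def .
    have ws: "(\<lambda>k. bracket k * cmod (w k)) summable_on UNIV"
      using sobolev_imp_wiener(1)[OF s w(1)] unfolding wiener_summable_def .
    have fF: "?f summable_on - F" "?g summable_on - F"
      using f summable_bracket[OF s] by (auto intro: summable_on_subset_banach)
    have "(\<Sum>k\<in>F. bracket k * cmod (w k)) \<le> (\<Sum>k\<in>F. bracket k * \<delta>)"
      by (intro sum_mono mult_left_mono small) auto
    also have "\<dots> = S * \<delta>" by (simp add: S_def sum_distrib_right)
    also have "\<dots> \<le> \<epsilon> / 3" using S e by (simp add: \<delta>_def field_simps)
    finally have 1: "(\<Sum>k\<in>F. bracket k * cmod (w k)) \<le> \<epsilon> / 3" .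
    have "(\<Sum>\<^sub>\<infinity>k\<in>-F. bracket k * cmod (w k)) \<le> (\<Sum>\<^sub>\<infinity>k\<in>-F. \<eta> * ?f k + (1 / (4 * \<eta>)) * ?g k)"
      by (intro infsum_mono summable_on_add summable_on_cmult_right fF summable_on_subset_banach[OF ws])
         (use bracket_cmod_split[OF \<eta>, of _ _ s] in auto)
    also have "\<dots> = \<eta> * infsum ?f (- F) + (1 / (4 * \<eta>)) * infsum ?g (- F)"
      by (subst infsum_add) (auto intro: summable_on_cmult_right fF simp only: infsum_cmult_right')
    also have "\<dots> \<le> \<eta> * R + (1 / (4 * \<eta>)) * (4 * \<eta> * \<epsilon> / 3)"
    proof (intro add_mono mult_left_mono)
      have "infsum ?f (- F) \<le> infsum ?f UNIV" by (rule infsum_mono2[OF fF(1) f]) auto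
      then show "infsum ?f (- F) \<le> R" using w(2) by (simp add: sobolev_sq_def)
    qed (use F \<eta> in auto)
    also have "\<eta> * R \<le> \<epsilon> / 3" using R e by (simp add: \<eta>_def field_simps)
    also have "(1 / (4 * \<eta>)) * (4 * \<eta> * \<epsilon> / 3) = \<epsilon> / 3" using \<eta> by simp
    finally have 2: "(\<Sum>\<^sub>\<infinity>k\<in>-F. bracket k * cmod (w k)) \<le> \<epsilon> / 3 + \<epsilon> / 3" by simp
    show ?thesis unfolding wiener_def infsum_split_finite[OF F(1) ws] using 1 2 e by linarith
  qed
  with F \<delta> that show ?thesis by blast
qed

text \<open>
  The same for \<open>H\<^sup>s\<^sup>-\<^sup>1\<close>: beyond frequency \<open>N\<close> the square of the lower norm gains at least a factor \<open>1 / N\<close>.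
\<close>
lemma sobolev_lower_small:
  assumes e: "\<epsilon> > 0" and R: "0 \<le> R"
  obtains F \<delta> where "finite F" "\<delta> > 0"
    "\<And>w. \<lbrakk>sobolev_summable s w; sobolev_sq s w \<le> R; \<And>k. k \<in> F \<Longrightarrow> cmod (w k) \<le> \<delta>\<rbrakk> \<Longrightarrow> sobolev_sq (s - 1) w \<le> \<epsilon>"
proof -
  define N where "N = 2 * (R + 1) / \<epsilon> + 1"
  have N: "N \<ge> 1" "R / N \<le> \<epsilon> / 2"
  proof -
    show "N \<ge> 1" using e R by (simp add: N_def)
    have "R \<le> \<epsilon> / 2 * N" using e R by (simp add: N_def field_simps)
    then show "R / N \<le> \<epsilon> / 2" using \<open>N \<ge> 1\<close> by (simp add: pos_divide_le_eq)
  qed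
  define F where "F = {k. bracket k \<le> N}"
  have F: "finite F" unfolding F_def by (rule finite_bracket_le)
  define S where "S = (\<Sum>k\<in>F. (bracket k powr (s - 1))\<^sup>2)"
  have S: "0 \<le> S" unfolding S_def by (intro sum_nonneg) simp
  define \<delta> where "\<delta> = sqrt (\<epsilon> / (2 * (S + 1)))"
  have \<delta>: "\<delta> > 0" "\<delta>\<^sup>2 = \<epsilon> / (2 * (S + 1))" using e S by (simp_all add: \<delta>_def)
  have "sobolev_sq (s - 1) w \<le> \<epsilon>"
    if w: "sobolev_summable s w" "sobolev_sq s w \<le> R" and small: "\<And>k. k \<in> F \<Longrightarrow> cmod (w k) \<le> \<delta>" for w
  proof -
    let ?f = "\<lambda>k. (bracket k powr s * cmod (w k))\<^sup>2" and ?g = "\<lambda>k. (bracket k powr (s - 1) * cmod (w k))\<^sup>2"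
    have f: "?f summable_on UNIV" using w(1) unfolding sobolev_summable_def .
    have g: "?g summable_on UNIV" using sobolev_summable_mono(1)[OF w(1), of "s - 1"] by (simp add: sobolev_summable_def)
    have fF: "?f summable_on - F" "?g summable_on - F" using f g by (auto intro: summable_on_subset_banach)
    have "sum ?g F \<le> (\<Sum>k\<in>F. (bracket k powr (s - 1))\<^sup>2 * \<delta>\<^sup>2)"
      unfolding power_mult_distrib by (intro sum_mono mult_left_mono power_mono small) auto
    also have "\<dots> = S * \<delta>\<^sup>2" by (simp add: S_def sum_distrib_right)
    also have "\<dots> \<le> \<epsilon> / 2" using S e unfolding \<delta>(2) by (simp add: field_simps)
    finally have 1: "sum ?g F \<le> \<epsilon> / 2" .
    have "infsum ?g (- F) \<le> (\<Sum>\<^sub>\<infinity>k\<in>-F. (1 / N) * ?f k)"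
    proof (rule infsum_mono[OF fF(2) summable_on_cmult_right[OF fF(1)]])
      fix k assume "k \<in> - F"
      then have k: "N < bracket k" by (simp add: F_def)
      have "bracket k powr s = bracket k powr (s - 1) * bracket k"
        using powr_add[of "bracket k" "s - 1" 1] by simp
      then have "?f k = (bracket k)\<^sup>2 * ?g k" by (simp add: power_mult_distrib)
      moreover have "N * 1 \<le> bracket k * bracket k" using k N by (intro mult_mono) auto
      then have "N * ?g k \<le> (bracket k)\<^sup>2 * ?g k" by (intro mult_right_mono) (auto simp: power2_eq_square)
      ultimately have "N * ?g k \<le> ?f k" by (simp only:)
      then have "(1 / N) * (N * ?g k) \<le> (1 / N) * ?f k" using N(1) by (intro mult_left_mono) auto
      then show "?g k \<le> (1 / N) * ?f k" using N(1) by (simp only: mult.assoc[symmetric]) simp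
    qed
    also have "\<dots> = (1 / N) * infsum ?f (- F)" by (rule infsum_cmult_right')
    also have "\<dots> \<le> (1 / N) * R"
    proof (intro mult_left_mono)
      have "infsum ?f (- F) \<le> infsum ?f UNIV" by (rule infsum_mono2[OF fF(1) f]) auto
      then show "infsum ?f (- F) \<le> R" using w(2) by (simp add: sobolev_sq_def)
    qed (use N in auto)
    also have "\<dots> \<le> \<epsilon> / 2" using N(2) by simp
    finally have 2: "infsum ?g (- F) \<le> \<epsilon> / 2" .
    show ?thesis unfolding sobolev_sq_def infsum_split_finite[OF F g] using 1 2 by linarith
  qed
  with F \<delta> that show ?thesis by blast
qed

text \<open>
  Fatou's lemma for sums, which discharges the hypothesis \<open>lim\<close> of \<open>gronwall_truncated\<close>.
\<close>
lemma truncated_sum_limit: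
  fixes \<phi> :: "nat \<Rightarrow> freq \<Rightarrow> real" and \<omega> :: "freq \<Rightarrow> real"
  assumes sm: "(\<lambda>k. (\<omega> k * cmod (a k))\<^sup>2) summable_on UNIV"
    and lim: "\<And>k. (\<lambda>n. \<phi> n k) \<longlonglongrightarrow> \<omega> k" and K: "\<And>n. finite (K n)" "\<And>n k. k \<notin> K n \<Longrightarrow> \<phi> n k = 0"
    and \<beta>: "\<beta> \<longlonglongrightarrow> 0" and le: "\<And>n. (\<Sum>k\<in>K n. (\<phi> n k * cmod (a k))\<^sup>2) \<le> B + \<beta> n"
  shows "(\<Sum>\<^sub>\<infinity>k. (\<omega> k * cmod (a k))\<^sup>2) \<le> B"
proof (rule infsum_le_finite_sums[OF sm])
  fix F :: "freq set" assume F: "finite F"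
  have "(\<Sum>k\<in>F. (\<phi> n k * cmod (a k))\<^sup>2) \<le> B + \<beta> n" for n
  proof -
    have "(\<Sum>k\<in>F. (\<phi> n k * cmod (a k))\<^sup>2) = (\<Sum>k\<in>F \<inter> K n. (\<phi> n k * cmod (a k))\<^sup>2)"
      using F K by (intro sum.mono_neutral_right) auto
    also have "\<dots> \<le> (\<Sum>k\<in>K n. (\<phi> n k * cmod (a k))\<^sup>2)"
      using K by (intro sum_mono2) auto
    finally show ?thesis using le[of n] by linarith
  qed
  moreover have "(\<lambda>n. \<Sum>k\<in>F. (\<phi> n k * cmod (a k))\<^sup>2) \<longlonglongrightarrow> (\<Sum>k\<in>F. (\<omega> k * cmod (a k))\<^sup>2)"
    by (intro tendsto_sum tendsto_power tendsto_mult lim tendsto_const)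
  moreover have "(\<lambda>n. B + \<beta> n) \<longlonglongrightarrow> B" using tendsto_add[OF tendsto_const \<beta>, of B] by simp
  ultimately show "(\<Sum>k\<in>F. (\<omega> k * cmod (a k))\<^sup>2) \<le> B"
    by (intro LIMSEQ_le) auto
qed

section \<open>Truncated Sobolev weights\<close>

definition cutoff :: "nat \<Rightarrow> real \<Rightarrow> real" where
  "cutoff n r = max 0 (1 - r / (real n + 1))"

text \<open>
  The weight of \<open>H\<^sup>s\<close>, cut off linearly to frequencies below \<open>n + 1\<close>. A sharp cutoff would destroy the
  commutator estimate; the linear one keeps the Lipschitz constant of the weight of order \<open>s - 1\<close>,
  uniformly in \<open>n\<close>.
\<close>
definition weight :: "real \<Rightarrow> nat \<Rightarrow> freq \<Rightarrow> real" where
  "weight s n k = bracket k powr s * cutoff n (bracket k)"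

definition low_freq :: "nat \<Rightarrow> freq set" where
  "low_freq n = {k. bracket k \<le> real n + 1}"

lemma finite_low_freq [simp]: "finite (low_freq n)"
  unfolding low_freq_def by (rule finite_bracket_le)

lemma cutoff_bounds: "0 \<le> cutoff n r" "0 \<le> r \<Longrightarrow> cutoff n r \<le> 1"
  by (auto simp: cutoff_def)

lemma cutoff_eq_0: "real n + 1 \<le> r \<Longrightarrow> cutoff n r = 0"
  by (simp add: cutoff_def max_def field_simps)

lemma cutoff_lipschitz: "\<bar>cutoff n a - cutoff n b\<bar> \<le> \<bar>a - b\<bar> / (real n + 1)"
proof -
  have "\<bar>cutoff n a - cutoff n b\<bar> \<le> \<bar>a / (real n + 1) - b / (real n + 1)\<bar>"
  proof -
    have "\<bar>max 0 (1 - x) - max 0 (1 - y)\<bar> \<le> \<bar>x - y\<bar>" for x y :: real by (auto simp: max_def)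
    then show ?thesis unfolding cutoff_def .
  qed
  also have "\<dots> = \<bar>a - b\<bar> / (real n + 1)"
    by (simp flip: diff_divide_distrib)
  finally show ?thesis .
qed

lemma weight_bounds: "0 \<le> weight s n k" "weight s n k \<le> bracket k powr s"
  using cutoff_bounds[where n = n and r = "bracket k"] unfolding weight_def by (auto simp: mult_left_le)

lemma weight_outside: "k \<notin> low_freq n \<Longrightarrow> weight s n k = 0"
  by (simp add: weight_def low_freq_def cutoff_eq_0)

lemma weight_support: "{k. weight s n k \<noteq> 0} \<subseteq> low_freq n"
  using weight_outside by blast

lemma weight_tendsto: "(\<lambda>n. weight s n k) \<longlonglongrightarrow> bracket k powr s"
proof -
  have "(\<lambda>n. bracket k * inverse (real (Suc n))) \<longlonglongrightarrow> 0"
    by (intro tendsto_mult_right_zero LIMSEQ_inverse_real_of_nat)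
  then have "(\<lambda>n. bracket k / (real n + 1)) \<longlonglongrightarrow> 0" by (simp add: divide_inverse add.commute)
  then have "(\<lambda>n. bracket k powr s * max 0 (1 - bracket k / (real n + 1))) \<longlonglongrightarrow> bracket k powr s * max 0 (1 - 0)"
    by (intro tendsto_mult tendsto_max tendsto_diff tendsto_const)
  then show ?thesis by (simp add: weight_def cutoff_def)
qed

lemma powr_diff_le:
  fixes a b s :: real
  assumes "1 \<le> a" "a \<le> b" "1 \<le> s"
  shows "b powr s - a powr s \<le> s * b powr (s - 1) * (b - a)"
proof (cases "a = b")
  case False
  then have "a < b" using assms by simp
  then obtain z where z: "a < z" "z < b" "b powr s - a powr s = (b - a) * (s * z powr (s - 1))"
    using MVT2[of a b "\<lambda>x. x powr s" "\<lambda>x. s * x powr (s - 1)"] assms by (force intro!: has_real_derivative_powr)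
  have "s * z powr (s - 1) \<le> s * b powr (s - 1)"
    using z assms by (intro mult_left_mono powr_mono2) auto
  then have "(b - a) * (s * z powr (s - 1)) \<le> (b - a) * (s * b powr (s - 1))"
    using assms by (intro mult_left_mono) auto
  then show ?thesis using z(3) by (simp add: mult_ac)
qed simp

text \<open>
  Where the cutoff is not \<open>0\<close> one has \<open>a \<le> n + 1\<close>, so its slope \<open>1 / (n + 1)\<close> is at most \<open>1 / a\<close> and costs
  one power of \<open>a\<close>, just like differentiating \<open>a powr s\<close>.
\<close>
lemma powr_cutoff_diff_le:
  fixes a b s :: real
  assumes ab: "1 \<le> a" "a \<le> b" and s: "1 \<le> s"
  shows "\<bar>b powr s * cutoff n b - a powr s * cutoff n a\<bar> \<le> (s + 1) * b powr (s - 1) * (b - a)"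
proof -
  have e: "b powr s * cutoff n b - a powr s * cutoff n a
      = cutoff n b * (b powr s - a powr s) + a powr s * (cutoff n b - cutoff n a)"
    by (simp add: algebra_simps)
  have p: "0 \<le> b powr s - a powr s" using ab s by (simp add: powr_mono2)
  have 1: "\<bar>cutoff n b * (b powr s - a powr s)\<bar> \<le> s * b powr (s - 1) * (b - a)"
  proof -
    have "cutoff n b * (b powr s - a powr s) \<le> 1 * (b powr s - a powr s)"
      using cutoff_bounds(2)[where n = n and r = b] ab p by (intro mult_right_mono) auto
    then show ?thesis using powr_diff_le[OF ab s] p cutoff_bounds(1)[where n = n and r = b] by (simp add: abs_mult)
  qed
  have 2: "\<bar>a powr s * (cutoff n b - cutoff n a)\<bar> \<le> b powr (s - 1) * (b - a)"
  proof (cases "a \<le> real n + 1")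
    case True
    have "\<bar>a powr s * (cutoff n b - cutoff n a)\<bar> \<le> a powr s * ((b - a) / (real n + 1))"
      using mult_left_mono[OF cutoff_lipschitz[of n b a], of "a powr s"] ab by (simp add: abs_mult)
    also have "\<dots> \<le> a powr s * ((b - a) / a)"
      using True ab by (intro mult_left_mono divide_left_mono) auto
    also have "\<dots> = a powr (s - 1) * (b - a)"
      using ab powr_add[of a "s - 1" 1] by simp
    also have "\<dots> \<le> b powr (s - 1) * (b - a)"
      using ab s by (intro mult_right_mono powr_mono2) auto
    finally show ?thesis .
  next
    case False
    then have "cutoff n a = 0" "cutoff n b = 0" using ab by (auto intro: cutoff_eq_0)
    then show ?thesis using ab by simp
  qed
  have "(s + 1) * b powr (s - 1) * (b - a) = s * b powr (s - 1) * (b - a) + b powr (s - 1) * (b - a)"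
    by (simp add: algebra_simps)
  then show ?thesis unfolding e using 1 2
      abs_triangle_ineq[of "cutoff n b * (b powr s - a powr s)" "a powr s * (cutoff n b - cutoff n a)"]
    by linarith
qed

text \<open>
  The larger of the two frequencies is at most \<open>bracket (k - l) + bracket l\<close>. Splitting its power distributes
  the \<open>s\<close> derivatives so that, in each term, one factor carries at most one of them.
\<close>
lemma weight_diff_le:
  assumes s: "1 \<le> s"
  shows "\<bar>weight s n k - weight s n l\<bar> \<le> (s + 1) * 2 powr (s - 1) * (bracket (k - l) powr s + bracket (k - l) * bracket l powr (s - 1))"
proof -
  define M where "M = max (bracket k) (bracket l)"
  define x where "x = bracket (k - l)"
  define y where "y = bracket l"
  have xy: "1 \<le> x" "1 \<le> y" by (simp_all add: x_def y_def)
  have M: "M \<le> x + y" "1 \<le> M" using bracket_triangle[of k l] by (auto simp: M_def x_def y_def le_max_iff_disj)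
  have "\<bar>weight s n k - weight s n l\<bar> \<le> (s + 1) * M powr (s - 1) * \<bar>bracket k - bracket l\<bar>"
  proof (cases "bracket l \<le> bracket k")
    case True
    then show ?thesis using powr_cutoff_diff_le[of "bracket l" "bracket k" s n] s
      by (simp add: weight_def M_def max_def abs_if)
  next
    case False
    then show ?thesis using powr_cutoff_diff_le[of "bracket k" "bracket l" s n] s
      by (simp add: weight_def M_def max_def abs_minus_commute)
  qed
  also have "\<dots> \<le> (s + 1) * (2 powr (s - 1) * (x powr (s - 1) + y powr (s - 1))) * x"
  proof (intro mult_mono mult_left_mono)
    have "M powr (s - 1) \<le> (2 * max x y) powr (s - 1)"
      using M s by (intro powr_mono2) auto
    also have "\<dots> = 2 powr (s - 1) * max x y powr (s - 1)"
      using xy by (simp add: powr_mult)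
    also have "\<dots> \<le> 2 powr (s - 1) * (x powr (s - 1) + y powr (s - 1))"
      by (intro mult_left_mono) (auto simp: max_def)
    finally show "M powr (s - 1) \<le> 2 powr (s - 1) * (x powr (s - 1) + y powr (s - 1))" .
    show "\<bar>bracket k - bracket l\<bar> \<le> x" unfolding x_def by (rule abs_bracket_diff_le)
  qed (use s in auto)
  also have "\<dots> = (s + 1) * 2 powr (s - 1) * (x powr s + x * y powr (s - 1))"
  proof -
    have "x powr s = x powr (s - 1) * x" using powr_add[of x "s - 1" 1] xy by simp
    then show ?thesis by (simp add: algebra_simps)
  qed
  finally show ?thesis unfolding x_def y_def .
qed

section \<open>Energy estimates\<close>

lemma norm_infsum_le_infsum:
  fixes x :: "'a \<Rightarrow> 'b::banach"
  assumes g: "g summable_on A" and le: "\<And>l. l \<in> A \<Longrightarrow> norm (x l) \<le> g l"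
  shows "norm (infsum x A) \<le> infsum g A"
proof (rule norm_infsum_le[OF has_sum_infsum has_sum_infsum[OF g] le])
  show "x summable_on A"
    by (rule abs_summable_summable[OF Infinite_Sum.abs_summable_on_comparison_test'[OF g le]])
qed

lemma abs_Re_sum_le:
  assumes "finite K" "\<And>k. k \<in> K \<Longrightarrow> cmod (z k) \<le> B k"
  shows "\<bar>Re (sum z K)\<bar> \<le> sum B K"
  using abs_Re_le_cmod[of "sum z K"] norm_sum[of z K] sum_mono[of K "\<lambda>k. cmod (z k)" B] assms by fastforce

definition sobolev_const :: "real \<Rightarrow> real" where
  "sobolev_const s = (s + 1) * 2 powr (s - 1)"

text \<open>
  After the cancellation, the commutator and the symbol leave
  \<open>bracket (k - l) powr s * bracket l\<close> and \<open>bracket (k - l) * bracket l powr s\<close>. In each term one factor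
  carries all \<open>s\<close> derivatives and is measured in \<open>l\<^sup>2\<close>, the other carries one and is measured in \<open>l\<^sup>1\<close>.
\<close>
proposition sobolev_energy_estimate:
  assumes s: "2 < s" and \<nu>: "0 \<le> \<nu>" and herm: "hermitian a" and a: "sobolev_summable s a"
  shows "\<bar>Re (\<Sum>k\<in>low_freq n. of_real ((weight s n k)\<^sup>2) * (cnj (a k) * transport \<nu> a a k))\<bar>
    \<le> 4 * sobolev_const s * wiener a * sobolev_sq s a"
proof -
  define C where "C = sobolev_const s"
  have C: "0 \<le> C" using s by (simp add: C_def sobolev_const_def)
  note w = sobolev_imp_wiener(1)[OF s a]
  define g where "g k = bracket k powr s * cmod (a k)" for k
  define h where "h k = bracket k * cmod (a k)" for k
  define f where "f k = weight s n k * cmod (a k)" for k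
  have nn: "0 \<le> f k" "0 \<le> g k" "0 \<le> h k" for k by (simp_all add: f_def g_def h_def weight_bounds)
  have g: "(\<lambda>k. (g k)\<^sup>2) summable_on UNIV" using a by (simp add: g_def sobolev_summable_def)
  have h: "h summable_on UNIV" using w by (simp add: h_def[abs_def] wiener_summable_def)
  have fg: "sqrt (\<Sum>k\<in>low_freq n. (f k)\<^sup>2) \<le> sqrt (sobolev_sq s a)"
  proof -
    have "(\<Sum>k\<in>low_freq n. (f k)\<^sup>2) \<le> (\<Sum>k\<in>low_freq n. (g k)\<^sup>2)"
      by (intro sum_mono power_mono) (auto simp: f_def g_def weight_bounds mult_right_mono)
    also have "\<dots> \<le> sobolev_sq s a" unfolding sobolev_sq_def g_def[symmetric]
      by (rule finite_sum_le_infsum[OF g]) auto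
    finally show ?thesis by simp
  qed
  have s1: "(\<lambda>l. g (k - l) * h l) summable_on UNIV" for k
    by (rule young_l2_l1(1)[OF finite.emptyI nn g h])
  have s2: "(\<lambda>l. h (k - l) * g l) summable_on UNIV" for k
    by (rule young_l1_l2(1)[OF finite.emptyI nn(1,3,2) h g])
  have sym: "\<bar>weight s n k - weight s n l\<bar> * \<bar>transport_symbol \<nu> (k - l) l\<bar> * (cmod (a (k - l)) * cmod (a l))
      \<le> 2 * C * (g (k - l) * h l) + 2 * C * (h (k - l) * g l)" for k l
  proof -
    have "\<bar>weight s n k - weight s n l\<bar> * \<bar>transport_symbol \<nu> (k - l) l\<bar>
      \<le> (C * (bracket (k - l) powr s + bracket (k - l) * bracket l powr (s - 1))) * (2 * bracket l)"
      unfolding C_def sobolev_const_def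
      by (intro mult_mono weight_diff_le transport_symbol_le \<nu>) (use s in auto)
    also have "\<dots> = 2 * C * (bracket (k - l) powr s * bracket l + bracket (k - l) * bracket l powr s)"
    proof -
      have "bracket l powr s = bracket l powr (s - 1) * bracket l" using powr_add[of "bracket l" "s - 1" 1] by simp
      then show ?thesis by (simp add: algebra_simps)
    qed
    finally have "\<bar>weight s n k - weight s n l\<bar> * \<bar>transport_symbol \<nu> (k - l) l\<bar> * (cmod (a (k - l)) * cmod (a l))
       \<le> 2 * C * (bracket (k - l) powr s * bracket l + bracket (k - l) * bracket l powr s) * (cmod (a (k - l)) * cmod (a l))"
      by (rule mult_right_mono) simp
    then show ?thesis by (simp add: g_def h_def algebra_simps)
  qed
  have term_le: "cmod (\<Sum>\<^sub>\<infinity>l. of_real (weight s n k * (weight s n k - weight s n l)) *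
        (cnj (a k) * (\<i> * of_real (transport_symbol \<nu> (k - l) l) * (a (k - l) * a l))))
      \<le> 2 * C * (f k * (\<Sum>\<^sub>\<infinity>l. g (k - l) * h l)) + 2 * C * (f k * (\<Sum>\<^sub>\<infinity>l. h (k - l) * g l))"
    (is "cmod (infsum ?x UNIV) \<le> _") for k
  proof -
    have "cmod (infsum ?x UNIV) \<le> (\<Sum>\<^sub>\<infinity>l. f k * (2 * C * (g (k - l) * h l) + 2 * C * (h (k - l) * g l)))"
    proof (rule norm_infsum_le_infsum)
      show "(\<lambda>l. f k * (2 * C * (g (k - l) * h l) + 2 * C * (h (k - l) * g l))) summable_on UNIV"
        by (intro summable_on_cmult_right summable_on_add s1 s2)
      fix l
      have "cmod (?x l) = f k * (\<bar>weight s n k - weight s n l\<bar> * \<bar>transport_symbol \<nu> (k - l) l\<bar> * (cmod (a (k - l)) * cmod (a l)))"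
        by (simp add: norm_mult f_def weight_bounds abs_mult mult_ac flip: of_real_diff of_real_mult)
      then show "cmod (?x l) \<le> f k * (2 * C * (g (k - l) * h l) + 2 * C * (h (k - l) * g l))"
        using mult_left_mono[OF sym nn(1)] by simp
    qed
    also have "\<dots> = 2 * C * (f k * (\<Sum>\<^sub>\<infinity>l. g (k - l) * h l)) + 2 * C * (f k * (\<Sum>\<^sub>\<infinity>l. h (k - l) * g l))"
      unfolding infsum_cmult_right' infsum_add[OF summable_on_cmult_right[OF s1] summable_on_cmult_right[OF s2]]
      by (simp only: distrib_left mult.left_commute)
    finally show ?thesis .
  qed
  have "\<bar>Re (\<Sum>k\<in>low_freq n. of_real ((weight s n k)\<^sup>2) * (cnj (a k) * transport \<nu> a a k))\<bar>
     \<le> (\<Sum>k\<in>low_freq n. 2 * C * (f k * (\<Sum>\<^sub>\<infinity>l. g (k - l) * h l)) + 2 * C * (f k * (\<Sum>\<^sub>\<infinity>l. h (k - l) * g l)))"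
    unfolding transport_cancellation[where \<phi> = "weight s n" and K = "low_freq n", OF \<nu> w herm w finite_low_freq weight_support]
    by (rule abs_Re_sum_le[OF finite_low_freq term_le])
  also have "\<dots> = 2 * C * (\<Sum>k\<in>low_freq n. f k * (\<Sum>\<^sub>\<infinity>l. g (k - l) * h l)) + 2 * C * (\<Sum>k\<in>low_freq n. f k * (\<Sum>\<^sub>\<infinity>l. h (k - l) * g l))"
    by (simp add: sum.distrib sum_distrib_left)
  also have "\<dots> \<le> 2 * C * (sqrt (sobolev_sq s a) * sqrt (sobolev_sq s a) * wiener a) + 2 * C * (sqrt (sobolev_sq s a) * sqrt (sobolev_sq s a) * wiener a)"
  proof -
    have G: "(\<Sum>\<^sub>\<infinity>k. (g k)\<^sup>2) = sobolev_sq s a" by (simp add: g_def sobolev_sq_def)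
    have H: "infsum h UNIV = wiener a" by (simp add: h_def[abs_def] wiener_def)
    have "sqrt (\<Sum>k\<in>low_freq n. (f k)\<^sup>2) * sqrt (sobolev_sq s a) * wiener a \<le> sqrt (sobolev_sq s a) * sqrt (sobolev_sq s a) * wiener a"
      by (intro mult_right_mono fg) (auto simp: wiener_nonneg)
    note le = order_trans[OF _ this]
    show ?thesis
      using C le[OF young_l2_l1(2)[where f = f and g = g and h = h, OF finite_low_freq[of n] nn g h, unfolded G H]]
        le[OF young_l1_l2(2)[where f = f and g = h and h = g, OF finite_low_freq[of n] nn(1,3,2) h g, unfolded G H]]
      by (intro add_mono mult_left_mono) simp_all
  qed
  also have "\<dots> = 4 * sobolev_const s * wiener a * sobolev_sq s a" by (simp add: C_def)
  finally show ?thesis .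
qed

lemma energy_has_derivative:
  assumes "finite K" "\<And>k. ((\<lambda>t. a t k) has_vector_derivative a' k) (at t within S)"
  shows "((\<lambda>t. \<Sum>k\<in>K. (\<phi> k * cmod (a t k))\<^sup>2) has_real_derivative
     2 * Re (\<Sum>k\<in>K. of_real ((\<phi> k)\<^sup>2) * (cnj (a t k) * a' k))) (at t within S)"
proof -
  have "((\<lambda>t. (\<phi> k * cmod (a t k))\<^sup>2) has_real_derivative 2 * Re (of_real ((\<phi> k)\<^sup>2) * (cnj (a t k) * a' k))) (at t within S)" for k
  proof -
    have re: "((\<lambda>t. Re (a t k)) has_real_derivative Re (a' k)) (at t within S)"
      and im: "((\<lambda>t. Im (a t k)) has_real_derivative Im (a' k)) (at t within S)"
      using bounded_linear.has_vector_derivative[OF bounded_linear_Re assms(2)[of k]]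
        bounded_linear.has_vector_derivative[OF bounded_linear_Im assms(2)[of k]]
      by (simp_all add: has_real_derivative_iff_has_vector_derivative)
    have "((\<lambda>t. (\<phi> k)\<^sup>2 * ((Re (a t k))\<^sup>2 + (Im (a t k))\<^sup>2)) has_real_derivative
        (\<phi> k)\<^sup>2 * (2 * Re (a t k) * Re (a' k) + 2 * Im (a t k) * Im (a' k))) (at t within S)"
      using DERIV_cmult[OF DERIV_add[OF DERIV_power[OF re, of 2] DERIV_power[OF im, of 2]], of "(\<phi> k)\<^sup>2"]
      by (simp add: mult_ac)
    then show ?thesis
      by (simp add: power_mult_distrib cmod_power2 algebra_simps flip: of_real_power)
  qed
  from DERIV_sum[of K, OF this] show ?thesis
    by (simp add: Re_sum sum_distrib_left)
qed

lemma sobolev_sq_0: "sobolev_sq 0 a = (\<Sum>\<^sub>\<infinity>k. (cmod (a k))\<^sup>2)"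
  "sobolev_summable 0 a \<longleftrightarrow> (\<lambda>k. (cmod (a k))\<^sup>2) summable_on UNIV"
  by (simp_all add: sobolev_sq_def sobolev_summable_def bracket_neq_0)

text \<open>
  The difference of the nonlinear terms, for \<open>w = a - c\<close>: transport of \<open>w\<close> by the full velocity, transport of
  \<open>c\<close> by the velocity of \<open>w\<close>, and the effect of changing the symbol on \<open>c\<close> alone.
\<close>
lemma transport_difference:
  assumes \<nu>: "0 \<le> \<nu>" and a: "wiener_summable a" and c: "wiener_summable c" and w: "wiener_summable (\<lambda>k. a k - c k)"
  shows "transport \<nu> a a k - transport 0 c c k = transport \<nu> a (\<lambda>k. a k - c k) k
     + (transport \<nu> (\<lambda>k. a k - c k) c k + (\<Sum>\<^sub>\<infinity>l. \<i> * of_real (transport_symbol \<nu> (k - l) l - transport_symbol 0 (k - l) l) * (c (k - l) * c l)))"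
proof -
  define t where "t \<mu> b d l = \<i> * of_real (transport_symbol \<mu> (k - l) l) * (b (k - l) * d l)" for \<mu> and b d :: coeffs and l
  let ?w = "\<lambda>k. a k - c k"
  have s: "t \<mu> b d summable_on UNIV" if "0 \<le> \<mu>" "wiener_summable b" "wiener_summable d" for \<mu> b d
    unfolding t_def by (rule transport_summable[OF that])
  have T: "transport \<mu> b d k = infsum (t \<mu> b d) UNIV" for \<mu> b d
    by (simp add: transport_def t_def[abs_def])
  have "transport \<nu> a a k - transport 0 c c k = infsum (\<lambda>l. t \<nu> a a l - t 0 c c l) UNIV"
    unfolding T by (intro infsum_diff(1)[symmetric] s \<nu> a c) simp
  also have "\<dots> = infsum (\<lambda>l. t \<nu> a ?w l + (t \<nu> ?w c l + (t \<nu> c c l - t 0 c c l))) UNIV"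
    by (intro infsum_cong) (simp add: t_def algebra_simps)
  also have "\<dots> = infsum (t \<nu> a ?w) UNIV + (infsum (t \<nu> ?w c) UNIV + infsum (\<lambda>l. t \<nu> c c l - t 0 c c l) UNIV)"
    by (subst infsum_add, (intro s \<nu> a w c summable_on_add infsum_diff(2); simp)+, subst infsum_add) (intro s \<nu> a w c infsum_diff(2) refl; simp)+
  also have "(\<lambda>l. t \<nu> c c l - t 0 c c l) = (\<lambda>l. \<i> * of_real (transport_symbol \<nu> (k - l) l - transport_symbol 0 (k - l) l) * (c (k - l) * c l))"
    by (simp add: t_def fun_eq_iff algebra_simps)
  finally show ?thesis unfolding T .
qed

text \<open>
  The three parts of \<open>transport_difference\<close> in turn. The first one would cancel completely for the weight \<open>1\<close>;
  the cutoff, of slope \<open>1 / (n + 1)\<close>, leaves an error which depends on \<open>a\<close> but vanishes as \<open>n\<close> grows. In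
  the other two the derivative falls on \<open>c\<close>, so that the limiting constants do not involve \<open>a\<close>.
\<close>
proposition difference_energy_estimate:
  fixes a c :: coeffs
  assumes \<nu>: "0 \<le> \<nu>" and s: "2 < s" and herm: "hermitian a" and a: "sobolev_summable s a" and c: "sobolev_summable s c"
  defines "w \<equiv> \<lambda>k. a k - c k"
  shows "\<bar>Re (\<Sum>k\<in>low_freq n. of_real ((weight 0 n k)\<^sup>2) * (cnj (w k) * (transport \<nu> a a k - transport 0 c c k)))\<bar>
    \<le> 3 * wiener c * sobolev_sq 0 w + wiener c * (\<nu>\<^sup>2 * sobolev_sq s c) + 2 * wiener a * (wiener w)\<^sup>2 / (real n + 1)"
proof -
  note wa = sobolev_imp_wiener(1)[OF s a] and wc = sobolev_imp_wiener(1)[OF s c]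
  have sw: "sobolev_summable s w" unfolding w_def by (rule sobolev_diff[OF a c])
  note ww = sobolev_imp_wiener(1)[OF s sw]
  have w0: "sobolev_summable 0 w" using sobolev_summable_mono(1)[OF sw, of 0] s by simp
  have c2: "sobolev_summable 2 c" "sobolev_sq 2 c \<le> sobolev_sq s c" using sobolev_summable_mono[OF c, of 2] s by auto
  define D where "D k = (\<Sum>\<^sub>\<infinity>l. \<i> * of_real (transport_symbol \<nu> (k - l) l - transport_symbol 0 (k - l) l) * (c (k - l) * c l))" for k
  define f where "f k = (weight 0 n k)\<^sup>2 * cmod (w k)" for k
  define V where "V = sobolev_sq 0 w"
  have V: "(\<lambda>k. (cmod (w k))\<^sup>2) summable_on UNIV" "V = (\<Sum>\<^sub>\<infinity>k. (cmod (w k))\<^sup>2)" "0 \<le> V"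
    using w0 by (simp_all add: V_def sobolev_sq_0) (simp add: sobolev_sq_0[symmetric])
  define h where "h k = bracket k * cmod (c k)" for k
  have h: "h summable_on UNIV" "infsum h UNIV = wiener c" using wc by (simp_all add: h_def[abs_def] wiener_def wiener_summable_def)
  define g where "g k = (bracket k)\<^sup>2 * cmod (c k)" for k
  have g: "(\<lambda>k. (g k)\<^sup>2) summable_on UNIV" "(\<Sum>\<^sub>\<infinity>k. (g k)\<^sup>2) = sobolev_sq 2 c"
    using c2(1) by (simp_all add: g_def sobolev_summable_def sobolev_sq_def powr_numeral)
  have wt1: "weight 0 n k \<le> 1" for k using weight_bounds(2)[where s = 0 and n = n and k = k] by (simp add: bracket_neq_0)
  have wt2: "(weight 0 n k)\<^sup>2 \<le> 1" for k using wt1[of k] weight_bounds(1)[of 0 n k] by (simp add: power_le_one)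
  have nn: "0 \<le> f k" "0 \<le> g k" "0 \<le> h k" "0 \<le> cmod (w k)" for k by (simp_all add: f_def g_def h_def)
  have fV: "sqrt (\<Sum>k\<in>low_freq n. (f k)\<^sup>2) \<le> sqrt V"
  proof -
    have "(\<Sum>k\<in>low_freq n. (f k)\<^sup>2) \<le> (\<Sum>k\<in>low_freq n. (cmod (w k))\<^sup>2)"
      by (intro sum_mono power_mono) (use wt2 in \<open>auto simp: f_def mult_left_le_one_le\<close>)
    also have "\<dots> \<le> V" unfolding V(2) by (rule finite_sum_le_infsum[OF V(1)]) auto
    finally show ?thesis by simp
  qed
  have T1: "\<bar>Re (\<Sum>k\<in>low_freq n. of_real ((weight 0 n k)\<^sup>2) * (cnj (w k) * transport \<nu> a w k))\<bar> \<le> 2 * wiener a * (wiener w)\<^sup>2 / (real n + 1)"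
  proof -
    have le: "cmod (\<Sum>\<^sub>\<infinity>l. of_real (weight 0 n k * (weight 0 n k - weight 0 n l)) *
        (cnj (w k) * (\<i> * of_real (transport_symbol \<nu> (k - l) l) * (a (k - l) * w l))))
      \<le> cmod (w k) * (2 * wiener a * wiener w / (real n + 1))" (is "cmod (infsum ?x UNIV) \<le> _") for k
    proof -
      have "cmod (infsum ?x UNIV) \<le> (\<Sum>\<^sub>\<infinity>l. cmod (w k) * (2 * wiener a / (real n + 1)) * (bracket l * cmod (w l)))"
      proof (rule norm_infsum_le_infsum)
        show "(\<lambda>l. cmod (w k) * (2 * wiener a / (real n + 1)) * (bracket l * cmod (w l))) summable_on UNIV"
          using ww unfolding wiener_summable_def by (rule summable_on_cmult_right)
        fix l
        have "\<bar>weight 0 n k - weight 0 n l\<bar> = \<bar>cutoff n (bracket k) - cutoff n (bracket l)\<bar>"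
          by (simp add: weight_def bracket_neq_0)
        also have "\<dots> \<le> \<bar>bracket k - bracket l\<bar> / (real n + 1)" by (rule cutoff_lipschitz)
        also have "\<dots> \<le> bracket (k - l) / (real n + 1)"
          by (intro divide_right_mono abs_bracket_diff_le) simp
        finally have d: "\<bar>weight 0 n k - weight 0 n l\<bar> \<le> bracket (k - l) / (real n + 1)" .
        have "cmod (?x l) = weight 0 n k * \<bar>weight 0 n k - weight 0 n l\<bar> * \<bar>transport_symbol \<nu> (k - l) l\<bar> * cmod (a (k - l)) * (cmod (w k) * cmod (w l))"
          by (simp add: norm_mult weight_bounds abs_mult mult_ac flip: of_real_diff of_real_mult)
        also have "\<dots> \<le> 1 * (bracket (k - l) / (real n + 1)) * (2 * bracket l) * cmod (a (k - l)) * (cmod (w k) * cmod (w l))"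
          by (intro mult_right_mono mult_mono wt1 d transport_symbol_le \<nu>) (auto simp: weight_bounds)
        also have "\<dots> = (bracket (k - l) * cmod (a (k - l))) * (2 / (real n + 1) * (cmod (w k) * (bracket l * cmod (w l))))"
          by (simp add: field_simps)
        also have "\<dots> \<le> wiener a * (2 / (real n + 1) * (cmod (w k) * (bracket l * cmod (w l))))"
          by (intro mult_right_mono wiener_le wa) auto
        finally show "cmod (?x l) \<le> cmod (w k) * (2 * wiener a / (real n + 1)) * (bracket l * cmod (w l))"
          by (simp add: mult_ac)
      qed
      also have "\<dots> = cmod (w k) * (2 * wiener a / (real n + 1)) * wiener w" unfolding wiener_def[of w] by (rule infsum_cmult_right')
      finally show ?thesis by simp
    qed
    have "\<bar>Re (\<Sum>k\<in>low_freq n. of_real ((weight 0 n k)\<^sup>2) * (cnj (w k) * transport \<nu> a w k))\<bar>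
       \<le> (\<Sum>k\<in>low_freq n. cmod (w k) * (2 * wiener a * wiener w / (real n + 1)))"
      unfolding transport_cancellation[where \<phi> = "weight 0 n" and K = "low_freq n", OF \<nu> wa herm ww finite_low_freq weight_support]
      by (rule abs_Re_sum_le[OF finite_low_freq le])
    also have "\<dots> = (\<Sum>k\<in>low_freq n. cmod (w k)) * (2 * wiener a * wiener w / (real n + 1))" by (simp only: sum_distrib_right)
    also have "\<dots> \<le> wiener w * (2 * wiener a * wiener w / (real n + 1))"
    proof (rule mult_right_mono)
      have "(\<Sum>k\<in>low_freq n. cmod (w k)) \<le> (\<Sum>k\<in>low_freq n. bracket k * cmod (w k))"
        by (intro sum_mono cmod_le_bracket_cmod)
      also have "\<dots> \<le> wiener w" unfolding wiener_def
        by (rule finite_sum_le_infsum) (use ww in \<open>auto simp: wiener_summable_def\<close>)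
      finally show "(\<Sum>k\<in>low_freq n. cmod (w k)) \<le> wiener w" .
    qed (simp add: wiener_nonneg)
    also have "\<dots> = 2 * wiener a * (wiener w)\<^sup>2 / (real n + 1)" by (simp add: power2_eq_square)
    finally show ?thesis .
  qed
  have T2: "\<bar>Re (\<Sum>k\<in>low_freq n. of_real ((weight 0 n k)\<^sup>2) * (cnj (w k) * transport \<nu> w c k))\<bar> \<le> 2 * wiener c * V"
  proof -
    have sm: "(\<lambda>l. cmod (w (k - l)) * h l) summable_on UNIV" for k
      by (rule young_l2_l1(1)[OF finite.emptyI nn(1,4,3) V(1) h(1)])
    have le: "cmod (of_real ((weight 0 n k)\<^sup>2) * (cnj (w k) * transport \<nu> w c k)) \<le> 2 * (f k * (\<Sum>\<^sub>\<infinity>l. cmod (w (k - l)) * h l))" for k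
    proof -
      have "cmod (transport \<nu> w c k) \<le> (\<Sum>\<^sub>\<infinity>l. 2 * (cmod (w (k - l)) * h l))"
        unfolding transport_def
      proof (rule norm_infsum_le_infsum[OF summable_on_cmult_right[OF sm]])
        fix l show "cmod (\<i> * of_real (transport_symbol \<nu> (k - l) l) * (w (k - l) * c l)) \<le> 2 * (cmod (w (k - l)) * h l)"
          using mult_right_mono[OF transport_symbol_le[OF \<nu>, of "k - l" l], of "cmod (w (k - l)) * cmod (c l)"]
          by (simp add: norm_mult h_def mult_ac)
      qed
      then have "f k * cmod (transport \<nu> w c k) \<le> f k * (2 * (\<Sum>\<^sub>\<infinity>l. cmod (w (k - l)) * h l))"
        unfolding infsum_cmult_right' by (intro mult_left_mono nn)
      then show ?thesis by (simp add: norm_mult f_def mult_ac norm_power)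
    qed
    have "\<bar>Re (\<Sum>k\<in>low_freq n. of_real ((weight 0 n k)\<^sup>2) * (cnj (w k) * transport \<nu> w c k))\<bar>
       \<le> (\<Sum>k\<in>low_freq n. 2 * (f k * (\<Sum>\<^sub>\<infinity>l. cmod (w (k - l)) * h l)))"
      by (rule abs_Re_sum_le[OF finite_low_freq le])
    also have "\<dots> = 2 * (\<Sum>k\<in>low_freq n. f k * (\<Sum>\<^sub>\<infinity>l. cmod (w (k - l)) * h l))" by (simp only: sum_distrib_left)
    also have "\<dots> \<le> 2 * (sqrt (\<Sum>k\<in>low_freq n. (f k)\<^sup>2) * sqrt V * wiener c)"
      using young_l2_l1(2)[where f = f and g = "\<lambda>k. cmod (w k)" and h = h, OF finite_low_freq[of n] nn(1,4,3) V(1) h(1)] unfolding V(2) h(2) by simp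
    also have "\<dots> \<le> 2 * (sqrt V * sqrt V * wiener c)"
      by (intro mult_left_mono mult_right_mono fV) (use V(3) in \<open>simp_all add: wiener_nonneg\<close>)
    also have "\<dots> = 2 * wiener c * V" using V(3) by simp
    finally show ?thesis .
  qed
  have T3: "\<bar>Re (\<Sum>k\<in>low_freq n. of_real ((weight 0 n k)\<^sup>2) * (cnj (w k) * D k))\<bar> \<le> wiener c * (V + \<nu>\<^sup>2 * sobolev_sq s c)"
  proof -
    have sm: "(\<lambda>l. g (k - l) * h l) summable_on UNIV" for k
      by (rule young_l2_l1(1)[OF finite.emptyI nn(1,2,3) g(1) h(1)])
    have le: "cmod (of_real ((weight 0 n k)\<^sup>2) * (cnj (w k) * D k)) \<le> (2 * \<nu>) * (f k * (\<Sum>\<^sub>\<infinity>l. g (k - l) * h l))" for k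
    proof -
      have "cmod (D k) \<le> (\<Sum>\<^sub>\<infinity>l. (2 * \<nu>) * (g (k - l) * h l))"
        unfolding D_def
      proof (rule norm_infsum_le_infsum[OF summable_on_cmult_right[OF sm]])
        fix l show "cmod (\<i> * of_real (transport_symbol \<nu> (k - l) l - transport_symbol 0 (k - l) l) * (c (k - l) * c l)) \<le> (2 * \<nu>) * (g (k - l) * h l)"
          using mult_right_mono[OF transport_symbol_diff_le[OF \<nu>, of "k - l" l], of "cmod (c (k - l)) * cmod (c l)"]
          by (simp add: norm_mult g_def h_def mult_ac del: of_real_diff)
      qed
      then have "f k * cmod (D k) \<le> f k * ((2 * \<nu>) * (\<Sum>\<^sub>\<infinity>l. g (k - l) * h l))"
        unfolding infsum_cmult_right' by (intro mult_left_mono nn)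
      then show ?thesis by (simp add: norm_mult f_def mult_ac norm_power)
    qed
    have "\<bar>Re (\<Sum>k\<in>low_freq n. of_real ((weight 0 n k)\<^sup>2) * (cnj (w k) * D k))\<bar>
       \<le> (\<Sum>k\<in>low_freq n. (2 * \<nu>) * (f k * (\<Sum>\<^sub>\<infinity>l. g (k - l) * h l)))"
      by (rule abs_Re_sum_le[OF finite_low_freq le])
    also have "\<dots> = (2 * \<nu>) * (\<Sum>k\<in>low_freq n. f k * (\<Sum>\<^sub>\<infinity>l. g (k - l) * h l))" by (simp only: sum_distrib_left)
    also have "\<dots> \<le> (2 * \<nu>) * (sqrt (\<Sum>k\<in>low_freq n. (f k)\<^sup>2) * sqrt (sobolev_sq 2 c) * wiener c)"
      using young_l2_l1(2)[where f = f and g = g and h = h, OF finite_low_freq[of n] nn(1,2,3) g(1) h(1)] \<nu> unfolding g(2) h(2) by (intro mult_left_mono) auto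
    also have "\<dots> \<le> (2 * \<nu>) * (sqrt V * sqrt (sobolev_sq s c) * wiener c)"
      by (intro mult_left_mono mult_right_mono mult_mono fV) (use c2(2) \<nu> V(3) in \<open>simp_all add: wiener_nonneg\<close>)
    also have "\<dots> = wiener c * (2 * sqrt V * (\<nu> * sqrt (sobolev_sq s c)))" by simp
    also have "\<dots> \<le> wiener c * ((sqrt V)\<^sup>2 + (\<nu> * sqrt (sobolev_sq s c))\<^sup>2)"
      by (intro mult_left_mono sum_squares_bound wiener_nonneg)
    also have "\<dots> = wiener c * (V + \<nu>\<^sup>2 * sobolev_sq s c)" using V(3) by (simp add: power_mult_distrib)
    finally show ?thesis .
  qed
  have split: "(\<Sum>k\<in>low_freq n. of_real ((weight 0 n k)\<^sup>2) * (cnj (w k) * (transport \<nu> a a k - transport 0 c c k)))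
    = (\<Sum>k\<in>low_freq n. of_real ((weight 0 n k)\<^sup>2) * (cnj (w k) * transport \<nu> a w k))
     + ((\<Sum>k\<in>low_freq n. of_real ((weight 0 n k)\<^sup>2) * (cnj (w k) * transport \<nu> w c k))
     + (\<Sum>k\<in>low_freq n. of_real ((weight 0 n k)\<^sup>2) * (cnj (w k) * D k)))"
    unfolding transport_difference[OF \<nu> wa wc ww[unfolded w_def], folded w_def, folded D_def]
    by (simp only: distrib_left sum.distrib)
  have "\<bar>Re (x + (y + z))\<bar> \<le> b1 + (b2 + b3)" if "\<bar>Re x\<bar> \<le> b1" "\<bar>Re y\<bar> \<le> b2" "\<bar>Re z\<bar> \<le> b3" for x y z b1 b2 b3
    using that by simp
  from this[OF T1 T2 T3] show ?thesis unfolding split V_def[symmetric] by (simp add: algebra_simps)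
qed

section \<open>Growth of solutions and of their differences\<close>

text \<open>
  The Fourier image of the notion of solution, with the bound in \<open>H\<^sup>s\<close> valid at every time.
\<close>
definition coefficient_solution :: "real \<Rightarrow> real \<Rightarrow> real \<Rightarrow> (real \<Rightarrow> coeffs) \<Rightarrow> bool" where
  "coefficient_solution \<nu> s T a \<longleftrightarrow>
    (\<forall>t\<in>{0..T}. hermitian (a t) \<and> sobolev_summable s (a t) \<and>
      (\<forall>k. ((\<lambda>\<tau>. a \<tau> k) has_vector_derivative - transport \<nu> (a t) (a t) k) (at t within {0..T}))) \<and>
    (\<exists>R. \<forall>t\<in>{0..T}. sobolev_sq s (a t) \<le> R)"

lemma coefficient_solutionD:
  assumes "coefficient_solution \<nu> s T a" "t \<in> {0..T}"
  shows "hermitian (a t)" "sobolev_summable s (a t)"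
    "((\<lambda>\<tau>. a \<tau> k) has_vector_derivative - transport \<nu> (a t) (a t) k) (at t within {0..T})"
  using assms unfolding coefficient_solution_def by blast+

lemma coefficient_solution_bounded:
  assumes "coefficient_solution \<nu> s T a"
  obtains R where "\<And>t. t \<in> {0..T} \<Longrightarrow> sobolev_sq s (a t) \<le> R"
  using assms unfolding coefficient_solution_def by blast

lemma coefficient_solution_subinterval:
  assumes "coefficient_solution \<nu> s T a" "\<tau> \<le> T"
  shows "coefficient_solution \<nu> s \<tau> a"
proof -
  have sub: "{0..\<tau>} \<subseteq> {0..T}" using assms(2) by auto
  show ?thesis
    using assms(1) sub unfolding coefficient_solution_def
    by (meson has_vector_derivative_within_subset subsetD)
qed

text \<open>
  Gronwall's inequality for the truncated energies. The bootstrap relies on the growth rate being independent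
  of \<open>\<nu>\<close> and seeing the solution only through its \<open>wiener\<close> norm.
\<close>
lemma sobolev_growth:
  assumes sol: "coefficient_solution \<nu> s \<tau> a" and s: "2 < s" and \<nu>: "0 \<le> \<nu>"
    and A: "\<And>t. t \<in> {0..\<tau>} \<Longrightarrow> wiener (a t) \<le> A" and t: "t \<in> {0..\<tau>}"
  shows "sobolev_sq s (a t) \<le> 2 * sobolev_sq s (a 0) * exp (2 * (8 * sobolev_const s * A + 1) * t)"
proof -
  obtain R where R: "\<And>t. t \<in> {0..\<tau>} \<Longrightarrow> sobolev_sq s (a t) \<le> R"
    using coefficient_solution_bounded[OF sol] by blast
  note sol' = coefficient_solutionD[OF sol]
  have \<tau>: "0 \<le> \<tau>" using t by simp
  have C: "0 \<le> sobolev_const s" using s by (simp add: sobolev_const_def)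
  have A0: "0 \<le> A" using A[of 0] \<tau> wiener_nonneg[of "a 0"] by simp
  define E where "E n t = (\<Sum>k\<in>low_freq n. (weight s n k * cmod (a t k))\<^sup>2)" for n t
  define E' where "E' n t = 2 * Re (\<Sum>k\<in>low_freq n. of_real ((weight s n k)\<^sup>2) * (cnj (a t k) * - transport \<nu> (a t) (a t) k))" for n t
  have "sobolev_sq s (a t) \<le> 2 * (sobolev_sq s (a 0) + \<tau> * 0) * exp (2 * (8 * sobolev_const s * A + 1) * t)"
  proof (rule gronwall_truncated[where V = "\<lambda>t. sobolev_sq s (a t)" and e = "\<lambda>_. 0" and E = E and E' = E'])
    show "0 < 8 * sobolev_const s * A + 1" using C A0 by (simp add: add_nonneg_pos)
    show "(E n has_real_derivative E' n t) (at t within {0..\<tau>})" if "t \<in> {0..\<tau>}" for n t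
      unfolding E_def[abs_def] E'_def by (rule energy_has_derivative[OF finite_low_freq sol'(3)[OF that]])
    show "E' n t \<le> (8 * sobolev_const s * A + 1) * sobolev_sq s (a t) + 0 + 0" if t: "t \<in> {0..\<tau>}" for n t
    proof -
      have "E' n t = - 2 * Re (\<Sum>k\<in>low_freq n. of_real ((weight s n k)\<^sup>2) * (cnj (a t k) * transport \<nu> (a t) (a t) k))"
        by (simp add: E'_def sum_negf)
      also have "\<dots> \<le> 2 * (4 * sobolev_const s * wiener (a t) * sobolev_sq s (a t))"
        using sobolev_energy_estimate[OF s \<nu> sol'(1,2)[OF t], of n] by linarith
      also have "\<dots> \<le> 2 * (4 * sobolev_const s * A * sobolev_sq s (a t))"
        using A[OF t] C by (intro mult_left_mono mult_right_mono) auto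
      also have "\<dots> \<le> (8 * sobolev_const s * A + 1) * sobolev_sq s (a t) + 0 + 0"
        by (simp add: algebra_simps)
      finally show ?thesis .
    qed
    show "E n 0 \<le> sobolev_sq s (a 0)" for n
    proof -
      have sm: "(\<lambda>k. (bracket k powr s * cmod (a 0 k))\<^sup>2) summable_on UNIV"
        using sol'(2)[of 0] \<tau> by (simp add: sobolev_summable_def)
      have "E n 0 \<le> (\<Sum>k\<in>low_freq n. (bracket k powr s * cmod (a 0 k))\<^sup>2)"
        unfolding E_def by (intro sum_mono power_mono mult_right_mono weight_bounds) (auto simp: weight_bounds)
      also have "\<dots> \<le> sobolev_sq s (a 0)"
        unfolding sobolev_sq_def by (rule finite_sum_le_infsum[OF sm]) auto
      finally show ?thesis .
    qed
    show "sobolev_sq s (a t) \<le> B" if "t \<in> {0..\<tau>}" "\<beta> \<longlonglongrightarrow> 0" "\<And>n. E n t \<le> B + \<beta> n" for t B \<beta>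
      unfolding sobolev_sq_def using sol'(2)[OF that(1)] unfolding sobolev_summable_def
      by (rule truncated_sum_limit[OF _ weight_tendsto finite_low_freq weight_outside that(2)])
         (use that(3) in \<open>auto simp: E_def\<close>)
  qed (use \<tau> t R in auto)
  then show ?thesis by simp
qed

text \<open>
  The constants depend on bounds for the limit \<open>c\<close> only; those for \<open>a\<close>, which may be large, enter just through
  the error \<open>e n\<close> that disappears with the truncation.
\<close>
lemma difference_growth:
  assumes sola: "coefficient_solution \<nu> s \<tau> a" and solc: "coefficient_solution 0 s \<tau> c" and s: "2 < s" and \<nu>: "0 \<le> \<nu>"
    and init: "a 0 = c 0"
    and A: "\<And>t. t \<in> {0..\<tau>} \<Longrightarrow> wiener (c t) \<le> A" and R: "\<And>t. t \<in> {0..\<tau>} \<Longrightarrow> sobolev_sq s (c t) \<le> R"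
    and t: "t \<in> {0..\<tau>}"
  shows "sobolev_sq 0 (\<lambda>k. a t k - c t k) \<le> 4 * \<tau> * A * R * \<nu>\<^sup>2 * exp (2 * (6 * A + 1) * t)"
proof -
  obtain Ra where Ra: "\<And>t. t \<in> {0..\<tau>} \<Longrightarrow> sobolev_sq s (a t) \<le> Ra"
    using coefficient_solution_bounded[OF sola] by blast
  note sa = coefficient_solutionD[OF sola] and sc = coefficient_solutionD(2,3)[OF solc]
  define w where "w t k = a t k - c t k" for t k
  have w_eq: "w t = (\<lambda>k. a t k - c t k)" for t by (simp add: w_def fun_eq_iff)
  have \<tau>: "0 \<le> \<tau>" using t by simp
  have A0: "0 \<le> A" using A[of 0] \<tau> wiener_nonneg[of "c 0"] by simp
  have R0: "0 \<le> R" using order_trans[OF sobolev_sq_nonneg R[of 0]] \<tau> by simp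
  define K where "K = (\<Sum>\<^sub>\<infinity>k. (bracket k powr (1 - s))\<^sup>2)"
  have wa: "wiener (a t) \<le> Ra + K" if "t \<in> {0..\<tau>}" for t
    using sobolev_imp_wiener(2)[OF s sa(2)[OF that]] Ra[OF that] by (simp add: K_def)
  have sw: "sobolev_summable s (w t)" "sobolev_sq s (w t) \<le> 2 * Ra + 2 * R" if "t \<in> {0..\<tau>}" for t
    using sobolev_diff[OF sa(2)[OF that] sc(1)[OF that]] Ra[OF that] R[OF that] unfolding w_eq by simp_all
  have ww: "wiener (w t) \<le> (2 * Ra + 2 * R) + K" if "t \<in> {0..\<tau>}" for t
    using sobolev_imp_wiener(2)[OF s sw(1)[OF that]] sw(2)[OF that] by (simp add: K_def)
  have w0: "sobolev_summable 0 (w t)" "sobolev_sq 0 (w t) \<le> 2 * Ra + 2 * R" if "t \<in> {0..\<tau>}" for t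
    using sobolev_summable_mono[OF sw(1)[OF that], of 0] s sw(2)[OF that] by auto
  have pos: "0 \<le> Ra + K" using wa[of 0] \<tau> wiener_nonneg[of "a 0"] by simp
  define e where "e n = 4 * (Ra + K) * (2 * Ra + 2 * R + K)\<^sup>2 / (real n + 1)" for n
  define E where "E n t = (\<Sum>k\<in>low_freq n. (weight 0 n k * cmod (w t k))\<^sup>2)" for n t
  define E' where "E' n t = 2 * Re (\<Sum>k\<in>low_freq n. of_real ((weight 0 n k)\<^sup>2) * (cnj (w t k) *
      (- transport \<nu> (a t) (a t) k - - transport 0 (c t) (c t) k)))" for n t
  have "sobolev_sq 0 (w t) \<le> 2 * (0 + \<tau> * (2 * A * R * \<nu>\<^sup>2)) * exp (2 * (6 * A + 1) * t)"
  proof (rule gronwall_truncated[where V = "\<lambda>t. sobolev_sq 0 (w t)" and e = e and E = E and E' = E'])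
    show "0 < 6 * A + 1" using A0 by simp
    show "0 \<le> 2 * A * R * \<nu>\<^sup>2" using A0 R0 by simp
    show "0 \<le> e n" for n using pos by (simp add: e_def)
    have "(\<lambda>n. 4 * (Ra + K) * (2 * Ra + 2 * R + K)\<^sup>2 * inverse (real (Suc n))) \<longlonglongrightarrow> 0"
      by (intro tendsto_mult_right_zero LIMSEQ_inverse_real_of_nat)
    then show "e \<longlonglongrightarrow> 0" by (simp add: e_def[abs_def] divide_inverse add.commute)
    show "(E n has_real_derivative E' n t) (at t within {0..\<tau>})" if "t \<in> {0..\<tau>}" for n t
      unfolding E_def[abs_def] E'_def
      by (rule energy_has_derivative[OF finite_low_freq]) (unfold w_def, intro has_vector_derivative_diff sa(3)[OF that] sc(2)[OF that])
    show "E' n t \<le> (6 * A + 1) * sobolev_sq 0 (w t) + 2 * A * R * \<nu>\<^sup>2 + e n" if t: "t \<in> {0..\<tau>}" for n t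
    proof -
      have "E' n t = - 2 * Re (\<Sum>k\<in>low_freq n. of_real ((weight 0 n k)\<^sup>2) * (cnj (w t k) * (transport \<nu> (a t) (a t) k - transport 0 (c t) (c t) k)))"
      proof -
        have *: "- x - - y = - (x - y)" for x y :: complex by simp
        show ?thesis unfolding E'_def * mult_minus_right sum_negf by simp
      qed
      also have "\<dots> \<le> 2 * (3 * wiener (c t) * sobolev_sq 0 (w t) + wiener (c t) * (\<nu>\<^sup>2 * sobolev_sq s (c t)) + 2 * wiener (a t) * (wiener (w t))\<^sup>2 / (real n + 1))"
        using difference_energy_estimate[OF \<nu> s sa(1,2)[OF t] sc(1)[OF t], of n, folded w_eq] by (simp add: w_def)
      also have "\<dots> \<le> 2 * (3 * A * sobolev_sq 0 (w t) + A * (\<nu>\<^sup>2 * R) + 2 * (Ra + K) * (2 * Ra + 2 * R + K)\<^sup>2 / (real n + 1))"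
        using A[OF t] R[OF t] wa[OF t] ww[OF t] A0 pos
        by (intro mult_left_mono add_mono mult_mono divide_right_mono power_mono) (auto simp: wiener_nonneg)
      also have "\<dots> \<le> (6 * A + 1) * sobolev_sq 0 (w t) + 2 * A * R * \<nu>\<^sup>2 + e n"
        by (simp add: e_def algebra_simps)
      finally show ?thesis .
    qed
    show "E n 0 \<le> 0" for n by (simp add: E_def w_def init)
    show "sobolev_sq 0 (w t) \<le> B" if "t \<in> {0..\<tau>}" "\<beta> \<longlonglongrightarrow> 0" "\<And>n. E n t \<le> B + \<beta> n" for t B \<beta>
      unfolding sobolev_sq_def using w0(1)[OF that(1)] unfolding sobolev_summable_def
      by (rule truncated_sum_limit[OF _ weight_tendsto finite_low_freq weight_outside that(2)])
         (use that(3) in \<open>auto simp: E_def\<close>)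
  qed (use \<tau> t w0 in auto)
  then show ?thesis unfolding w_eq by (simp add: mult_ac)
qed

section \<open>The bootstrap\<close>

lemma wiener_triangle:
  assumes a: "wiener_summable a" and b: "wiener_summable b"
  shows "\<bar>wiener a - wiener b\<bar> \<le> wiener (\<lambda>k. a k - b k)"
proof -
  have sm: "wiener_summable (\<lambda>k. a k - b k)" if "wiener_summable a" "wiener_summable b" for a b
  proof -
    have "(\<lambda>k. bracket k * cmod (a k) + bracket k * cmod (b k)) summable_on UNIV"
      using that unfolding wiener_summable_def by (rule summable_on_add)
    then show ?thesis unfolding wiener_summable_def
      by (rule summable_on_comparison_test)
         (auto simp: norm_triangle_ineq4 mult_left_mono simp flip: distrib_left)
  qed
  have le: "wiener a \<le> wiener (\<lambda>k. a k - b k) + wiener b" if "wiener_summable a" "wiener_summable b" for a b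
  proof -
    have "wiener a \<le> (\<Sum>\<^sub>\<infinity>k. bracket k * cmod (a k - b k) + bracket k * cmod (b k))"
      unfolding wiener_def using that sm[OF that] unfolding wiener_summable_def
      by (intro infsum_mono summable_on_add)
         (auto simp: mult_left_mono norm_triangle_sub add.commute simp flip: distrib_left)
    also have "\<dots> = wiener (\<lambda>k. a k - b k) + wiener b"
      unfolding wiener_def using that sm[OF that] unfolding wiener_summable_def by (intro infsum_add)
    finally show ?thesis .
  qed
  have "wiener (\<lambda>k. b k - a k) = wiener (\<lambda>k. a k - b k)"
    unfolding wiener_def by (simp add: norm_minus_commute)
  then show ?thesis using le[OF a b] le[OF b a] by linarith
qed

text \<open>
  Increments in time are bounded in \<open>H\<^sup>s\<close> and small in each coefficient, so \<open>wiener_small\<close> applies.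
\<close>
lemma continuous_wiener:
  fixes S :: "real set"
  assumes s: "2 < s" and w: "\<And>t. t \<in> S \<Longrightarrow> sobolev_summable s (w t)" "\<And>t. t \<in> S \<Longrightarrow> sobolev_sq s (w t) \<le> R"
    and cont: "\<And>k. continuous_on S (\<lambda>t. w t k)"
  shows "continuous_on S (\<lambda>t. wiener (w t))"
  unfolding continuous_on_iff
proof (intro ballI allI impI)
  fix t and e :: real assume t: "t \<in> S" and e: "0 < e"
  have R: "0 \<le> 4 * R" using w(2)[OF t] order_trans[OF sobolev_sq_nonneg, of s "w t" R] by simp
  obtain F \<delta> where F: "finite F" "\<delta> > 0"
    "\<And>v. \<lbrakk>sobolev_summable s v; sobolev_sq s v \<le> 4 * R; \<And>k. k \<in> F \<Longrightarrow> cmod (v k) \<le> \<delta>\<rbrakk> \<Longrightarrow> wiener v \<le> e / 2"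
    using wiener_small[OF s half_gt_zero[OF e] R] by blast
  have "\<forall>\<^sub>F u in at t within S. \<forall>k\<in>F. dist (w u k) (w t k) < \<delta>"
    using F(1)
  proof (rule eventually_ball_finite, intro ballI)
    fix k
    have "((\<lambda>t. w t k) \<longlongrightarrow> w t k) (at t within S)" using cont t by (simp add: continuous_on_def)
    then show "\<forall>\<^sub>F u in at t within S. dist (w u k) (w t k) < \<delta>" using F(2) by (rule tendstoD)
  qed
  then obtain d where d: "d > 0" "\<And>u. u \<in> S \<Longrightarrow> u \<noteq> t \<Longrightarrow> dist u t < d \<Longrightarrow> \<forall>k\<in>F. dist (w u k) (w t k) < \<delta>"
    unfolding eventually_at by blast
  have "dist (wiener (w u)) (wiener (w t)) < e" if u: "u \<in> S" "dist u t < d" for u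
  proof (cases "u = t")
    case False
    have "wiener (\<lambda>k. w u k - w t k) \<le> e / 2"
    proof (rule F(3))
      show "sobolev_summable s (\<lambda>k. w u k - w t k)" by (rule sobolev_diff[OF w(1)[OF u(1)] w(1)[OF t]])
      show "sobolev_sq s (\<lambda>k. w u k - w t k) \<le> 4 * R"
        using sobolev_diff(2)[OF w(1)[OF u(1)] w(1)[OF t]] w(2)[OF u(1)] w(2)[OF t] by linarith
      show "cmod (w u k - w t k) \<le> \<delta>" if "k \<in> F" for k
        using d(2)[OF u(1) False u(2)] that by (auto simp: dist_norm less_imp_le)
    qed
    then show ?thesis
      using wiener_triangle[OF sobolev_imp_wiener(1)[OF s w(1)[OF u(1)]] sobolev_imp_wiener(1)[OF s w(1)[OF t]]] e
      by (simp add: dist_real_def)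
  qed (use e in simp)
  then show "\<exists>d>0. \<forall>u\<in>S. dist u t < d \<longrightarrow> dist (wiener (w u)) (wiener (w t)) < e"
    using d(1) by blast
qed

text \<open>
  If \<open>G\<close> exceeded \<open>1\<close> somewhere, consider the first time \<open>u\<close> at which it reaches \<open>1\<close>; up to and including \<open>u\<close>
  the hypothesis of the improvement \<open>boot\<close> holds, which contradicts \<open>G u \<ge> 1\<close>.
\<close>
lemma continuity_argument:
  fixes G :: "real \<Rightarrow> real"
  assumes cont: "continuous_on {0..T} G" and G0: "G 0 < 1"
    and boot: "\<And>\<tau>. \<tau> \<in> {0..T} \<Longrightarrow> \<forall>t\<in>{0..\<tau>}. G t \<le> 1 \<Longrightarrow> G \<tau> < 1"
    and t: "t \<in> {0..T}"
  shows "G t \<le> 1"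
proof (rule ccontr)
  assume "\<not> G t \<le> 1"
  define B where "B = {u \<in> {0..t}. 1 \<le> G u}"
  have sub: "{0..t} \<subseteq> {0..T}" using t by auto
  have "closed B"
    unfolding B_def
    by (rule continuous_on_closed_Collect_le[OF continuous_on_const continuous_on_subset[OF cont sub] closed_atLeastAtMost])
  then have "compact ({0..t} \<inter> B)" by (intro compact_Int_closed compact_Icc)
  moreover have "{0..t} \<inter> B = B" by (auto simp: B_def)
  ultimately have "compact B" by simp
  have "B \<noteq> {}" using t \<open>\<not> G t \<le> 1\<close> by (auto simp: B_def intro!: exI[of _ t])
  obtain u where u: "u \<in> B" "\<forall>v\<in>B. u \<le> v"
    using compact_attains_inf[OF \<open>compact B\<close> \<open>B \<noteq> {}\<close>] by blast
  have ut: "0 \<le> u" "u \<le> t" "1 \<le> G u" using u(1) by (auto simp: B_def)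
  have below: "G v < 1" if "0 \<le> v" "v < u" for v
  proof (rule ccontr)
    assume "\<not> G v < 1"
    then have "v \<in> B" using that ut by (simp add: B_def)
    with u(2) that show False by fastforce
  qed
  have "G u \<le> 1"
  proof (rule ccontr)
    assume "\<not> G u \<le> 1"
    moreover have "continuous_on {0..u} G" by (rule continuous_on_subset[OF cont]) (use ut t in auto)
    ultimately have "\<exists>v\<ge>0. v \<le> u \<and> G v = 1"
      by (intro IVT') (use G0 ut in linarith)+
    then obtain v where "0 \<le> v" "v \<le> u" "G v = 1" by blast
    then show False using below[of v] \<open>\<not> G u \<le> 1\<close> by (cases "v = u") auto
  qed
  moreover have "\<forall>v\<in>{0..u}. G v \<le> 1"
  proof
    fix v assume "v \<in> {0..u}"
    then show "G v \<le> 1" using below[of v] \<open>G u \<le> 1\<close> by (cases "v = u") auto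
  qed
  ultimately show False using boot[of u] ut t by auto
qed

text \<open>
  The bootstrap. In \<open>bound\<close>, the hypothesis that \<open>wiener w\<close> is at most \<open>1\<close> up to time \<open>\<tau>\<close> gives an \<open>H\<^sup>s\<close> bound
  \<open>R1\<close> independent of \<open>\<nu>\<close>; together with the bound \<open>small\<close> of order \<open>\<nu>\<close> on each coefficient it improves the
  hypothesis (\<open>boot\<close>), which therefore holds up to time \<open>T\<close>.
\<close>
proposition coefficient_convergence:
  assumes s: "2 < s" and T: "0 \<le> T" and solc: "coefficient_solution 0 s T c"
    and sola: "\<And>\<nu>. 0 < \<nu> \<Longrightarrow> coefficient_solution \<nu> s T (a \<nu>)"
    and init: "\<And>\<nu>. 0 < \<nu> \<Longrightarrow> a \<nu> 0 = c 0" and t: "t \<in> {0..T}"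
  shows "((\<lambda>\<nu>. sobolev_sq (s - 1) (\<lambda>k. a \<nu> t k - c t k)) \<longlongrightarrow> 0) (at_right 0)"
proof -
  obtain R0 where R0: "\<And>t. t \<in> {0..T} \<Longrightarrow> sobolev_sq s (c t) \<le> R0"
    using coefficient_solution_bounded[OF solc] by blast
  have R0_nn: "0 \<le> R0" using order_trans[OF sobolev_sq_nonneg R0[of 0]] T by simp
  note sc = coefficient_solutionD(2,3)[OF solc] and sa = coefficient_solutionD(2,3)[OF sola]
  define A where "A = R0 + (\<Sum>\<^sub>\<infinity>k. (bracket k powr (1 - s))\<^sup>2)"
  have A: "wiener (c t) \<le> A" if "t \<in> {0..T}" for t
    using sobolev_imp_wiener(2)[OF s sc(1)[OF that]] R0[OF that] by (simp add: A_def)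
  have A_nn: "0 \<le> A" using A[of 0] T wiener_nonneg[of "c 0"] by simp
  define C where "C = sobolev_const s"
  have C: "0 \<le> C" using s by (simp add: C_def sobolev_const_def)
  define R where "R = 2 * R0 * exp (2 * (8 * C * (A + 1) + 1) * T)"
  have R_nn: "0 \<le> R" using R0_nn by (simp add: R_def)
  define R1 where "R1 = 2 * R + 2 * R0"
  have R1_nn: "0 \<le> R1" using R_nn R0_nn by (simp add: R1_def)
  define M where "M = sqrt (4 * T * A * R0 * exp (2 * (6 * A + 1) * T))"
  have M_nn: "0 \<le> M" using T A_nn R0_nn by (simp add: M_def)
  define w where "w \<nu> t k = a \<nu> t k - c t k" for \<nu> t k
  have w_eq: "w \<nu> t = (\<lambda>k. a \<nu> t k - c t k)" for \<nu> t by (simp add: w_def fun_eq_iff)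
  have sw: "sobolev_summable s (w \<nu> t)" if "0 < \<nu>" "t \<in> {0..T}" for \<nu> t
    unfolding w_eq by (rule sobolev_diff[OF sa(1)[OF that] sc(1)[OF that(2)]])
  have small: "cmod (w \<nu> t k) \<le> M * \<nu>" if \<nu>: "0 < \<nu>" and t: "t \<in> {0..T}" for \<nu> t k
  proof -
    have "sobolev_summable 0 (w \<nu> t)" using sobolev_summable_mono(1)[OF sw[OF \<nu> t], of 0] s by simp
    from sobolev_coefficient_le[OF this, of k]
    have "(cmod (w \<nu> t k))\<^sup>2 \<le> sobolev_sq 0 (w \<nu> t)" by (simp add: bracket_neq_0)
    also have "\<dots> \<le> 4 * T * A * R0 * \<nu>\<^sup>2 * exp (2 * (6 * A + 1) * t)"
      unfolding w_eq by (rule difference_growth[OF sola[OF \<nu>] solc s less_imp_le[OF \<nu>] init[OF \<nu>] A R0 t])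
    also have "\<dots> \<le> 4 * T * A * R0 * \<nu>\<^sup>2 * exp (2 * (6 * A + 1) * T)"
      using T A_nn R0_nn t by (intro mult_left_mono) auto
    also have "\<dots> = (M * \<nu>)\<^sup>2" using T A_nn R0_nn by (simp add: M_def power_mult_distrib)
    finally show ?thesis using M_nn \<nu> by (intro power2_le_imp_le[of "cmod (w \<nu> t k)"]) auto
  qed
  have bound: "sobolev_sq s (w \<nu> \<tau>) \<le> R1"
    if \<nu>: "0 < \<nu>" and \<tau>: "\<tau> \<in> {0..T}" and G: "\<forall>u\<in>{0..\<tau>}. wiener (w \<nu> u) \<le> 1" for \<nu> \<tau>
  proof -
    have "sobolev_sq s (a \<nu> \<tau>) \<le> 2 * sobolev_sq s (a \<nu> 0) * exp (2 * (8 * sobolev_const s * (A + 1) + 1) * \<tau>)"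
    proof (rule sobolev_growth[OF coefficient_solution_subinterval[OF sola[OF \<nu>]] s less_imp_le[OF \<nu>]])
      fix u assume u: "u \<in> {0..\<tau>}"
      then have uT: "u \<in> {0..T}" using \<tau> by auto
      show "wiener (a \<nu> u) \<le> A + 1"
        using wiener_triangle[OF sobolev_imp_wiener(1)[OF s sa(1)[OF \<nu> uT]] sobolev_imp_wiener(1)[OF s sc(1)[OF uT]]]
          G u A[OF uT] unfolding w_eq by fastforce
    qed (use \<tau> in auto)
    also have "\<dots> \<le> 2 * R0 * exp (2 * (8 * C * (A + 1) + 1) * T)"
      unfolding C_def[symmetric] init[OF \<nu>] using R0[of 0] T \<tau> C A_nn R0_nn
      by (intro mult_mono) (auto intro!: mult_left_mono)
    finally have "sobolev_sq s (a \<nu> \<tau>) \<le> R" by (simp add: R_def)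
    then show ?thesis
      using sobolev_diff(2)[OF sa(1)[OF \<nu> \<tau>] sc(1)[OF \<tau>]] R0[OF \<tau>] unfolding w_eq R1_def by linarith
  qed
  obtain F \<delta> where F: "finite F" "\<delta> > 0"
    "\<And>v. \<lbrakk>sobolev_summable s v; sobolev_sq s v \<le> R1; \<And>k. k \<in> F \<Longrightarrow> cmod (v k) \<le> \<delta>\<rbrakk> \<Longrightarrow> wiener v \<le> 1 / 2"
    using wiener_small[OF s half_gt_zero[OF zero_less_one] R1_nn] by blast
  have ev: "\<forall>\<^sub>F \<nu> in at_right 0. 0 < \<nu> \<and> M * \<nu> \<le> d" if "d > 0" for d :: real
  proof -
    have "((\<lambda>\<nu>. M * \<nu>) \<longlongrightarrow> M * 0) (at_right 0)" by (intro tendsto_intros)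
    then have "\<forall>\<^sub>F \<nu> in at_right 0. M * \<nu> < d" using that by (intro order_tendstoD(2)) auto
    then show ?thesis using eventually_at_right_less[of "0::real"] by eventually_elim auto
  qed
  have final: "sobolev_sq s (w \<nu> t) \<le> R1" if \<nu>: "0 < \<nu>" "M * \<nu> \<le> \<delta>" for \<nu>
  proof -
    have boot: "wiener (w \<nu> \<tau>) < 1" if \<tau>: "\<tau> \<in> {0..T}" and "\<forall>u\<in>{0..\<tau>}. wiener (w \<nu> u) \<le> 1" for \<tau>
    proof -
      have "wiener (w \<nu> \<tau>) \<le> 1 / 2"
        by (rule F(3)[OF sw[OF \<nu>(1) \<tau>] bound[OF \<nu>(1) that]]) (use small[OF \<nu>(1) \<tau>] \<nu>(2) in \<open>auto intro: order_trans\<close>)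
      then show ?thesis by simp
    qed
    obtain Ra where Ra: "\<And>t. t \<in> {0..T} \<Longrightarrow> sobolev_sq s (a \<nu> t) \<le> Ra"
      using coefficient_solution_bounded[OF sola[OF \<nu>(1)]] by blast
    have cont: "continuous_on {0..T} (\<lambda>t. wiener (w \<nu> t))"
    proof (rule continuous_wiener[OF s])
      fix t assume t: "t \<in> {0..T}"
      show "sobolev_summable s (w \<nu> t)" by (rule sw[OF \<nu>(1) t])
      show "sobolev_sq s (w \<nu> t) \<le> 2 * Ra + 2 * R0"
        using sobolev_diff(2)[OF sa(1)[OF \<nu>(1) t] sc(1)[OF t]] Ra[OF t] R0[OF t] unfolding w_eq by linarith
    next
      fix k
      show "continuous_on {0..T} (\<lambda>t. w \<nu> t k)"
        unfolding w_def continuous_on_eq_continuous_within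
        by (intro ballI continuous_diff has_vector_derivative_continuous[OF sa(2)[OF \<nu>(1)]]
            has_vector_derivative_continuous[OF sc(2)])
    qed
    have "\<forall>u\<in>{0..t}. wiener (w \<nu> u) \<le> 1"
    proof
      fix u assume "u \<in> {0..t}"
      then have u: "u \<in> {0..T}" using t by auto
      show "wiener (w \<nu> u) \<le> 1"
      proof (rule continuity_argument[OF cont _ boot u])
        show "wiener (w \<nu> 0) < 1" by (simp add: w_def wiener_def init[OF \<nu>(1)])
      qed
    qed
    then show ?thesis by (rule bound[OF \<nu>(1) t])
  qed
  show ?thesis
    unfolding w_eq[symmetric]
  proof (rule tendstoI)
    fix e :: real assume e: "e > 0"
    obtain F' \<delta>' where F': "finite F'" "\<delta>' > 0"
      "\<And>v. \<lbrakk>sobolev_summable s v; sobolev_sq s v \<le> R1; \<And>k. k \<in> F' \<Longrightarrow> cmod (v k) \<le> \<delta>'\<rbrakk> \<Longrightarrow> sobolev_sq (s - 1) v \<le> e / 2"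
      using sobolev_lower_small[OF half_gt_zero[OF e] R1_nn] by blast
    show "\<forall>\<^sub>F \<nu> in at_right 0. dist (sobolev_sq (s - 1) (w \<nu> t)) 0 < e"
      using ev[OF F(2)] ev[OF F'(2)]
    proof eventually_elim
      case (elim \<nu>)
      have "sobolev_sq (s - 1) (w \<nu> t) \<le> e / 2"
      proof (rule F'(3)[OF sw[OF _ t] final])
        show "cmod (w \<nu> t k) \<le> \<delta>'" for k using small[of \<nu> t k] t elim by (auto intro: order_trans)
      qed (use elim in auto)
      then show ?case using e by simp
    qed
  qed
qed

section \<open>The Fourier coefficients of a solution\<close>

lemma sobolev_norm_eq: "sobolev_norm s f = sqrt (sobolev_sq s (fourier_coeff f))"
  by (simp add: sobolev_norm_def sobolev_sq_def bracket_powr power_mult_distrib)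

lemma in_sobolev_imp_summable: "in_sobolev s f \<Longrightarrow> sobolev_summable s (fourier_coeff f)"
  by (simp add: in_sobolev_def sobolev_summable_def bracket_powr power_mult_distrib)

lemma hermitian_fourier_coeff: "hermitian (fourier_coeff f)"
proof -
  have "cnj (LINT x|torus. of_real (f x) * cnj (torus_char k x))
     = (LINT x|torus. cnj (of_real (f x) * cnj (torus_char k x)))" for k
    by (rule Bochner_Integration.integral_cnj[symmetric])
  then show ?thesis unfolding hermitian_def fourier_coeff_def by (simp add: torus_char_uminus)
qed

lemma cnj_trig_series:
  assumes "hermitian c" shows "cnj (trig_series c x) = trig_series c x"
proof -
  have b: "bij_betw uminus (UNIV :: freq set) UNIV" by (rule bij_betwI[where g = uminus]) auto
  have "cnj (trig_series c x) = (\<Sum>\<^sub>\<infinity>k. c (- k) * torus_char (- k) x)"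
  proof -
    have h: "c (- k) = cnj (c k)" for k using assms unfolding hermitian_def by blast
    show ?thesis
      unfolding trig_series_def infsum_cnj[symmetric] by (simp only: h torus_char_uminus complex_cnj_mult)
  qed
  also have "\<dots> = trig_series c x"
    unfolding trig_series_def by (rule infsum_reindex_bij_betw[OF b, of "\<lambda>k. c k * torus_char k x"])
  finally show ?thesis .
qed

lemma of_real_Re_trig_series: "hermitian c \<Longrightarrow> of_real (Re (trig_series c x)) = trig_series c x"
  using cnj_trig_series[of c x] by (simp add: complex_eq_iff)

lemma torus_periodic_trig_series: "torus_periodic (trig_series c)"
  using torus_periodic_char by (simp add: torus_periodic_def trig_series_def)

text \<open>
  The function and its Fourier series are continuous with the same coefficients.
\<close>
proposition fourier_inversion:
  assumes f: "continuous_on UNIV f" and per: "torus_periodic f"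
    and sm: "wiener_summable (fourier_coeff f)"
  shows "of_real (f x) = trig_series (fourier_coeff f) x"
proof -
  let ?c = "fourier_coeff f"
  have c: "(\<lambda>k. cmod (?c k)) summable_on UNIV"
    using sm unfolding wiener_summable_def by (rule summable_of_bracket_summable)
  note re = of_real_Re_trig_series[OF hermitian_fourier_coeff[of f]]
  define h where "h x = f x - Re (trig_series ?c x)" for x
  have "h x = 0"
  proof (rule zero_fourier_imp_zero)
    show "continuous_on UNIV h"
      unfolding h_def by (intro continuous_intros f continuous_trig_series c)
    show "torus_periodic h"
      using per torus_periodic_trig_series[of ?c] by (simp add: torus_periodic_def h_def)
    fix k
    have cf: "continuous_on torus_cell f" by (rule continuous_on_subset[OF f subset_UNIV])
    have "(LINT x|torus. of_real (h x) * torus_char k x)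
      = (LINT x|torus. of_real (f x) * cnj (torus_char (- k) x) - trig_series ?c x * cnj (torus_char (- k) x))"
      by (simp add: h_def re torus_char_uminus left_diff_distrib)
    also have "\<dots> = (LINT x|torus. of_real (f x) * cnj (torus_char (- k) x))
       - (LINT x|torus. trig_series ?c x * cnj (torus_char (- k) x))"
      by (intro Bochner_Integration.integral_diff integrable_continuous_torus_cell continuous_intros continuous_trig_series c cf)
    also have "\<dots> = 0"
      unfolding trig_series_coefficient[OF c] by (simp add: fourier_coeff_def)
    finally show "(LINT x|torus. of_real (h x) * torus_char k x) = 0" .
  qed
  then show ?thesis using re[of x] by (simp add: h_def)
qed

lemma fourier_coeff_trig_series:
  assumes "(\<lambda>k. cmod (c k)) summable_on UNIV" and "\<And>x. of_real (g x) = trig_series c x"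
  shows "fourier_coeff g k = c k"
  unfolding fourier_coeff_def assms(2) trig_series_coefficient[OF assms(1)] by simp

lemma cmod_symbol_mult_le: "\<bar>m\<bar> \<le> 1 \<Longrightarrow> cmod (of_real m * z) \<le> cmod z"
  by (simp add: norm_mult mult_left_le_one_le)

text \<open>
  The symbols are even, so the velocity of a real function is real and taking the real part in its
  definition loses nothing.
\<close>
lemma velocity_eq_trig_series:
  assumes \<nu>: "0 \<le> \<nu>"
  shows "of_real (brinkman_velocity \<nu> f x $ 1) = trig_series (\<lambda>k. of_real (M1_symbol \<nu> k) * fourier_coeff f k) x"
    and "of_real (brinkman_velocity \<nu> f x $ 2) = trig_series (\<lambda>k. of_real (M2_symbol \<nu> k) * fourier_coeff f k) x"
proof -
  have "hermitian (\<lambda>k. of_real (M1_symbol \<nu> k) * fourier_coeff f k)" "hermitian (\<lambda>k. of_real (M2_symbol \<nu> k) * fourier_coeff f k)"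
    using hermitian_fourier_coeff[of f] by (auto simp: hermitian_def)
  from of_real_Re_trig_series[OF this(1), of x] of_real_Re_trig_series[OF this(2), of x]
  show "of_real (brinkman_velocity \<nu> f x $ 1) = trig_series (\<lambda>k. of_real (M1_symbol \<nu> k) * fourier_coeff f k) x"
    "of_real (brinkman_velocity \<nu> f x $ 2) = trig_series (\<lambda>k. of_real (M2_symbol \<nu> k) * fourier_coeff f k) x"
    unfolding brinkman_velocity_def fourier_multiplier_def trig_series_def by simp_all
qed

lemma transport_eq_convolution:
  assumes \<nu>: "0 \<le> \<nu>" and c: "wiener_summable c"
  shows "transport \<nu> c c k = convolution (\<lambda>k. of_real (M1_symbol \<nu> k) * c k) (\<lambda>k. \<i> * of_int (fst k) * c k) k
      + convolution (\<lambda>k. of_real (M2_symbol \<nu> k) * c k) (\<lambda>k. \<i> * of_int (snd k) * c k) k"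
proof -
  have sm: "(\<lambda>l. of_real (m (k - l)) * c (k - l) * (\<i> * of_int (p l) * c l)) summable_on UNIV"
    if m: "\<And>j. \<bar>m j\<bar> \<le> 1" and p: "\<And>l. \<bar>real_of_int (p l)\<bar> \<le> bracket l" for m and p :: "freq \<Rightarrow> int"
  proof (rule abs_summable_summable, rule summable_on_comparison_test)
    show "(\<lambda>l. wiener c * (bracket l * cmod (c l))) summable_on UNIV"
      using c unfolding wiener_summable_def by (rule summable_on_cmult_right)
    fix l
    have "cmod (of_real (m (k - l)) * c (k - l)) \<le> wiener c"
      using cmod_symbol_mult_le[OF m[of "k - l"], of "c (k - l)"] cmod_le_bracket_cmod[of c "k - l"] wiener_le[OF c, of "k - l"] by linarith
    moreover have "cmod (\<i> * of_int (p l) * c l) \<le> bracket l * cmod (c l)"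
      using mult_right_mono[OF p[of l], of "cmod (c l)"] by (simp add: norm_mult)
    ultimately show "cmod (of_real (m (k - l)) * c (k - l) * (\<i> * of_int (p l) * c l)) \<le> wiener c * (bracket l * cmod (c l))"
      unfolding norm_mult[of "of_real (m (k - l)) * c (k - l)"] by (intro mult_mono) (auto simp: wiener_nonneg)
  qed auto
  have "transport \<nu> c c k = (\<Sum>\<^sub>\<infinity>l. of_real (M1_symbol \<nu> (k - l)) * c (k - l) * (\<i> * of_int (fst l) * c l)
      + of_real (M2_symbol \<nu> (k - l)) * c (k - l) * (\<i> * of_int (snd l) * c l))"
    unfolding transport_def by (intro infsum_cong) (simp add: transport_symbol_def algebra_simps)
  also have "\<dots> = convolution (\<lambda>k. of_real (M1_symbol \<nu> k) * c k) (\<lambda>k. \<i> * of_int (fst k) * c k) k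
      + convolution (\<lambda>k. of_real (M2_symbol \<nu> k) * c k) (\<lambda>k. \<i> * of_int (snd k) * c k) k"
    unfolding convolution_def by (intro infsum_add sm M_symbol_le \<nu> freq_le_bracket)
  finally show ?thesis .
qed

text \<open>
  Velocity and gradient are absolutely convergent series, and the coefficients of their product are given by
  convolution. This needs one derivative of \<open>f\<close> in \<open>l\<^sup>1\<close>, which also bounds the product.
\<close>
proposition advection_term:
  assumes \<nu>: "0 \<le> \<nu>" and f: "\<And>x. f differentiable (at x)" and per: "torus_periodic f"
    and sm: "wiener_summable (fourier_coeff f)"
  defines "g \<equiv> \<lambda>x. frechet_derivative f (at x) (brinkman_velocity \<nu> f x)"
  shows "of_real (g x) = trig_series (transport \<nu> (fourier_coeff f) (fourier_coeff f)) x"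
    and "(\<lambda>k. cmod (transport \<nu> (fourier_coeff f) (fourier_coeff f) k)) summable_on UNIV"
    and "\<bar>g x\<bar> \<le> 2 * (wiener (fourier_coeff f))\<^sup>2"
proof -
  define c where "c = fourier_coeff f"
  define m1 where "m1 k = of_real (M1_symbol \<nu> k) * c k" for k
  define m2 where "m2 k = of_real (M2_symbol \<nu> k) * c k" for k
  define d1 where "d1 k = \<i> * of_int (fst k) * c k" for k
  define d2 where "d2 k = \<i> * of_int (snd k) * c k" for k
  have w: "wiener_summable c" using sm by (simp add: c_def)
  have w': "(\<lambda>k. bracket k * cmod (c k)) summable_on UNIV" using w by (simp add: wiener_summable_def)
  note c = summable_of_bracket_summable[OF w']
  have cw: "(\<Sum>\<^sub>\<infinity>k. cmod (z k)) \<le> wiener c" if "\<And>k. cmod (z k) \<le> bracket k * cmod (c k)" "(\<lambda>k. cmod (z k)) summable_on UNIV" for z :: coeffs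
    unfolding wiener_def by (rule infsum_mono[OF that(2) w' that(1)])
  have m_le: "cmod (m1 k) \<le> cmod (c k)" "cmod (m2 k) \<le> cmod (c k)" for k
    unfolding m1_def m2_def by (intro cmod_symbol_mult_le M_symbol_le \<nu>)+
  have m: "(\<lambda>k. cmod (m1 k)) summable_on UNIV" "(\<lambda>k. cmod (m2 k)) summable_on UNIV"
    by (rule summable_on_comparison_test[OF c]; use m_le in simp)+
  have d: "(\<lambda>k. cmod (d1 k)) summable_on UNIV" "(\<lambda>k. cmod (d2 k)) summable_on UNIV"
    unfolding d1_def d2_def by (rule summable_freq[OF w'])+
  have d_le: "cmod (d1 k) \<le> bracket k * cmod (c k)" "cmod (d2 k) \<le> bracket k * cmod (c k)" for k
    using mult_right_mono[OF freq_le_bracket(1)[of k], of "cmod (c k)"] mult_right_mono[OF freq_le_bracket(2)[of k], of "cmod (c k)"]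
    by (simp_all add: d1_def d2_def norm_mult)
  have m_le': "cmod (m1 k) \<le> bracket k * cmod (c k)" "cmod (m2 k) \<le> bracket k * cmod (c k)" for k
    using m_le[of k] cmod_le_bracket_cmod[of c k] by linarith+
  have cont: "continuous_on UNIV f"
    using f differentiable_imp_continuous_within continuous_at_imp_continuous_on by blast
  note inv = fourier_inversion[OF cont per sm, folded c_def]
  have u: "of_real (brinkman_velocity \<nu> f x $ 1) = trig_series m1 x" "of_real (brinkman_velocity \<nu> f x $ 2) = trig_series m2 x" for x
    unfolding m1_def m2_def c_def by (rule velocity_eq_trig_series[OF \<nu>])+
  have deriv: "of_real (frechet_derivative f (at x) v) = of_real (v $ 1) * trig_series d1 x + of_real (v $ 2) * trig_series d2 x" for x v
  proof -
    have "((\<lambda>y. complex_of_real (f y)) has_derivative (\<lambda>v. of_real (v $ 1) * trig_series d1 x + of_real (v $ 2) * trig_series d2 x)) (at x)"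
      using has_derivative_trig_series[OF w', of x] unfolding inv d1_def d2_def by (simp add: eta_contract_eq)
    moreover have "((\<lambda>y. complex_of_real (f y)) has_derivative (\<lambda>v. of_real (frechet_derivative f (at x) v))) (at x)"
      using f[of x] unfolding frechet_derivative_works by (rule has_derivative_of_real)
    ultimately have "(\<lambda>v. of_real (v $ 1) * trig_series d1 x + of_real (v $ 2) * trig_series d2 x) = (\<lambda>v. of_real (frechet_derivative f (at x) v))"
      by (rule has_derivative_unique)
    from fun_cong[OF this, of v] show ?thesis by simp
  qed
  have g: "of_real (g x) = trig_series m1 x * trig_series d1 x + trig_series m2 x * trig_series d2 x" for x
    unfolding g_def deriv u ..
  have T: "transport \<nu> c c = (\<lambda>k. convolution m1 d1 k + convolution m2 d2 k)"
    unfolding m1_def m2_def d1_def d2_def by (rule ext) (rule transport_eq_convolution[OF \<nu> w])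
  note cs = convolution_summable[OF m(1) d(1)] convolution_summable[OF m(2) d(2)]
  show "of_real (g x) = trig_series (transport \<nu> (fourier_coeff f) (fourier_coeff f)) x"
  proof -
    have "of_real (g x) = trig_series (convolution m1 d1) x + trig_series (convolution m2 d2) x"
      unfolding g trig_series_mult[OF m(1) d(1)] trig_series_mult[OF m(2) d(2)] ..
    also have "\<dots> = trig_series (transport \<nu> c c) x"
      unfolding trig_series_def T distrib_right
      by (intro infsum_add[symmetric] trig_series_summable cs)
    finally show ?thesis by (simp add: c_def)
  qed
  show "(\<lambda>k. cmod (transport \<nu> (fourier_coeff f) (fourier_coeff f) k)) summable_on UNIV"
    unfolding c_def[symmetric] T
    by (rule summable_on_comparison_test[OF summable_on_add[OF cs]]) (auto intro: norm_triangle_ineq)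
  have "cmod (of_real (g x)) \<le> wiener c * wiener c + wiener c * wiener c"
    unfolding g
    by (intro order_trans[OF norm_triangle_ineq] add_mono order_trans[OF norm_mult_ineq] mult_mono
        order_trans[OF norm_trig_series_le] cw m d m_le' d_le norm_ge_zero wiener_nonneg)
  then show "\<bar>g x\<bar> \<le> 2 * (wiener (fourier_coeff f))\<^sup>2"
    by (simp add: c_def power2_eq_square)
qed

lemma fourier_coeff_tendsto:
  fixes f :: "nat \<Rightarrow> real^2 \<Rightarrow> real"
  assumes "\<And>n. continuous_on UNIV (f n)" "\<And>x. (\<lambda>n. f n x) \<longlonglongrightarrow> g x" "\<And>n x. \<bar>f n x\<bar> \<le> B"
  shows "(\<lambda>n. fourier_coeff (f n) k) \<longlonglongrightarrow> fourier_coeff g k"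
  unfolding fourier_coeff_def
proof (intro tendsto_divide tendsto_const)
  have fc: "continuous_on torus_cell (f n)" for n by (rule continuous_on_subset[OF assms(1) subset_UNIV])
  have m: "(\<lambda>x. of_real (f n x) * cnj (torus_char k x)) \<in> borel_measurable (torus)" for n
    by (intro borel_measurable_integrable integrable_continuous_torus_cell continuous_intros fc)
  have l: "(\<lambda>n. of_real (f n x) * cnj (torus_char k x)) \<longlonglongrightarrow> of_real (g x) * cnj (torus_char k x)" for x
    by (intro tendsto_intros assms(2))
  show "(\<lambda>n. LINT x|torus. of_real (f n x) * cnj (torus_char k x)) \<longlonglongrightarrow>
      (LINT x|torus. of_real (g x) * cnj (torus_char k x))"
  proof (rule integral_dominated_convergence[where w = "\<lambda>_. B"])
    show "(\<lambda>x. of_real (g x) * cnj (torus_char k x)) \<in> borel_measurable (torus)"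
      by (rule borel_measurable_LIMSEQ_metric[OF m l])
    show "integrable (torus) (\<lambda>_. B)"
      by (intro integrable_continuous_torus_cell continuous_intros)
  qed (use m l assms(3) in \<open>auto simp: norm_mult\<close>)
qed auto

text \<open>
  A set of full measure meets every interval.
\<close>
lemma AE_interval_dense:
  fixes t T e :: real
  assumes ae: "AE t in lebesgue_on {0..T}. P t" and T: "0 < T" and t: "t \<in> {0..T}" and e: "0 < e"
  obtains u where "u \<in> {0..T}" "P u" "\<bar>u - t\<bar> < e"
proof -
  define I where "I = {max 0 (t - e / 2)..min T (t + e / 2)}"
  have lt: "max 0 (t - e / 2) < min T (t + e / 2)" using T t e by auto
  have "\<exists>u\<in>I. P u"
  proof (rule ccontr)
    assume no: "\<not> (\<exists>u\<in>I. P u)"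
    have "AE u in lebesgue. u \<in> {0..T} \<longrightarrow> P u"
      using ae by (subst (asm) AE_restrict_space_iff) auto
    then have "AE u in lebesgue. u \<notin> I"
      by eventually_elim (use no in \<open>auto simp: I_def\<close>)
    then have "I \<in> null_sets lebesgue" by (subst AE_iff_null_sets) (auto simp: I_def)
    then have "emeasure lebesgue I = 0" by auto
    moreover have "emeasure lebesgue {p..q} > 0" if "p < q" for p q :: real
      using that by (simp add: ennreal_less_zero_iff)
    ultimately show False using lt unfolding I_def by fastforce
  qed
  then obtain u where "u \<in> I" "P u" by blast
  moreover have "u \<in> {0..T}" "\<bar>u - t\<bar> < e" using \<open>u \<in> I\<close> e by (auto simp: I_def abs_less_iff)
  ultimately show ?thesis using that by blast
qed

lemma has_vector_derivative_sequentially: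
  fixes f :: "real \<Rightarrow> 'a::real_normed_vector"
  assumes "\<And>X. (\<And>n. X n \<in> S - {t}) \<Longrightarrow> X \<longlonglongrightarrow> t \<Longrightarrow> (\<lambda>n. (f (X n) - f t) /\<^sub>R (X n - t)) \<longlonglongrightarrow> D"
  shows "(f has_vector_derivative D) (at t within S)"
proof -
  have "((\<lambda>u. (f u - f t) /\<^sub>R (u - t)) \<longlongrightarrow> D) (at t within S)"
    unfolding tendsto_at_iff_sequentially o_def using assms by blast
  then have "((\<lambda>u. norm ((f u - f t) /\<^sub>R (u - t) - D)) \<longlongrightarrow> 0) (at t within S)"
    by (intro tendsto_norm_zero) (simp add: LIM_zero)
  then have "((\<lambda>u. norm ((f u - f t) - (u - t) *\<^sub>R D) / norm (u - t)) \<longlongrightarrow> 0) (at t within S)"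
  proof (rule Lim_transform_eventually)
    show "\<forall>\<^sub>F u in at t within S. norm ((f u - f t) /\<^sub>R (u - t) - D) = norm ((f u - f t) - (u - t) *\<^sub>R D) / norm (u - t)"
      unfolding eventually_at_filter
    proof (intro always_eventually allI impI)
      fix u assume "u \<noteq> t"
      then have "(f u - f t) - (u - t) *\<^sub>R D = (u - t) *\<^sub>R ((f u - f t) /\<^sub>R (u - t) - D)"
        by (simp add: scaleR_diff_right)
      then show "norm ((f u - f t) /\<^sub>R (u - t) - D) = norm ((f u - f t) - (u - t) *\<^sub>R D) / norm (u - t)"
        using \<open>u \<noteq> t\<close> by simp
    qed
  qed
  then show ?thesis
    unfolding has_vector_derivative_def has_derivative_iff_norm
    by (simp add: bounded_linear_scaleR_left)
qed

text \<open>
  The \<open>H\<^sup>s\<close> bound \<open>C\<close> is given for almost every time. Every time \<open>t\<close> is a limit of such times \<open>X n\<close>; the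
  equation makes \<open>\<theta>\<close> continuous in time at each point, dominated convergence carries this over to the
  coefficients, and the bound survives in the limit by lower semicontinuity. Now the time
  derivative of \<open>\<theta>\<close> is bounded on all of \<open>[0,T]\<close>, so the difference quotients are dominated and the
  coefficients may be differentiated under the integral.
\<close>
proposition solution_coefficients:
  assumes sol: "IPMB_solution \<nu> s T \<theta>0 \<theta>" and s: "2 < s" and T: "0 < T" and \<nu>: "0 \<le> \<nu>"
  shows "coefficient_solution \<nu> s T (\<lambda>t. fourier_coeff (\<theta> t))"
proof -
  have sob: "in_sobolev s (\<theta> t)" if "t \<in> {0..T}" for t
    using sol that by (auto simp: IPMB_solution_def Linfty_sobolev_def)
  have diff: "\<theta> t differentiable (at x)"
    and eq: "((\<lambda>\<tau>. \<theta> \<tau> x) has_real_derivative - frechet_derivative (\<theta> t) (at x) (brinkman_velocity \<nu> (\<theta> t) x)) (at t within {0..T})"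
    if "t \<in> {0..T}" for t x
    using sol that by (auto simp: IPMB_solution_def)
  obtain C where C: "AE t in lebesgue_on {0..T}. sobolev_norm s (\<theta> t) \<le> C"
    using sol by (auto simp: IPMB_solution_def Linfty_sobolev_def)
  define a where "a t = fourier_coeff (\<theta> t)" for t
  have sm: "sobolev_summable s (a t)" if "t \<in> {0..T}" for t
    unfolding a_def by (rule in_sobolev_imp_summable[OF sob[OF that]])
  have w: "wiener_summable (a t)" if "t \<in> {0..T}" for t
    by (rule sobolev_imp_wiener(1)[OF s sm[OF that]])
  have per: "torus_periodic (\<theta> t)" if "t \<in> {0..T}" for t
    using sob[OF that] by (simp add: in_sobolev_def torus_L2_def)
  have cont: "continuous_on UNIV (\<theta> t)" if "t \<in> {0..T}" for t
    using diff[OF that] differentiable_imp_continuous_within continuous_at_imp_continuous_on by blast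
  have sup: "\<bar>\<theta> t x\<bar> \<le> wiener (a t)" if t: "t \<in> {0..T}" for t x
  proof -
    have w': "(\<lambda>k. bracket k * cmod (a t k)) summable_on UNIV" using w[OF t] by (simp add: wiener_summable_def)
    have "\<bar>\<theta> t x\<bar> = cmod (trig_series (a t) x)"
      unfolding a_def fourier_inversion[OF cont[OF t] per[OF t] w[OF t, unfolded a_def], symmetric] by simp
    also have "\<dots> \<le> (\<Sum>\<^sub>\<infinity>k. cmod (a t k))"
      by (rule norm_trig_series_le[OF summable_of_bracket_summable[OF w']])
    also have "\<dots> \<le> wiener (a t)"
      unfolding wiener_def by (rule infsum_mono[OF summable_of_bracket_summable[OF w'] w' cmod_le_bracket_cmod[of "a t"]])
    finally show ?thesis .
  qed
  define K where "K = (\<Sum>\<^sub>\<infinity>k. (bracket k powr (1 - s))\<^sup>2)"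
  \<comment> \<open>from almost every time to every time\<close>
  have bound: "sobolev_sq s (a t) \<le> C\<^sup>2" if t: "t \<in> {0..T}" for t
  proof -
    have "\<exists>u. u \<in> {0..T} \<and> sobolev_norm s (\<theta> u) \<le> C \<and> \<bar>u - t\<bar> < inverse (real (Suc n))" for n
      using AE_interval_dense[OF C T t, of "inverse (real (Suc n))"] by auto
    then obtain X where X: "\<And>n. X n \<in> {0..T}" "\<And>n. sobolev_norm s (\<theta> (X n)) \<le> C" "\<And>n. \<bar>X n - t\<bar> < inverse (real (Suc n))"
      by metis
    have Xt: "X \<longlonglongrightarrow> t"
    proof (rule LIM_zero_cancel, rule tendsto_rabs_zero_cancel, rule tendsto_sandwich[OF _ _ tendsto_const LIMSEQ_inverse_real_of_nat])
      show "\<forall>\<^sub>F n in sequentially. \<bar>X n - t\<bar> \<le> inverse (real (Suc n))" using X(3) less_imp_le by (intro always_eventually allI) blast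
    qed auto
    have Xs: "sobolev_sq s (a (X n)) \<le> C\<^sup>2" for n
    proof -
      have "sqrt (sobolev_sq s (a (X n))) \<le> C" using X(2)[of n] by (simp add: sobolev_norm_eq a_def)
      then have "(sqrt (sobolev_sq s (a (X n))))\<^sup>2 \<le> C\<^sup>2" by (rule power_mono) simp
      then show ?thesis by simp
    qed
    have coef: "(\<lambda>n. a (X n) k) \<longlonglongrightarrow> a t k" for k
      unfolding a_def
    proof (rule fourier_coeff_tendsto)
      show "continuous_on UNIV (\<theta> (X n))" for n by (rule cont[OF X(1)])
      show "(\<lambda>n. \<theta> (X n) x) \<longlonglongrightarrow> \<theta> t x" for x
      proof -
        have "continuous (at t within {0..T}) (\<lambda>\<tau>. \<theta> \<tau> x)" by (rule DERIV_continuous[OF eq[OF t]])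
        then show ?thesis using X(1) Xt unfolding continuous_within_sequentially o_def by blast
      qed
      show "\<bar>\<theta> (X n) x\<bar> \<le> C\<^sup>2 + K" for n x
        using sup[OF X(1)[of n], of x] sobolev_imp_wiener(2)[OF s sm[OF X(1)[of n]]] Xs[of n] by (simp add: K_def)
    qed
    show ?thesis
      unfolding sobolev_sq_def
    proof (rule infsum_le_finite_sums[OF sm[OF t, unfolded sobolev_summable_def]])
      fix F :: "freq set" assume F: "finite F"
      have "(\<lambda>n. \<Sum>k\<in>F. (bracket k powr s * cmod (a (X n) k))\<^sup>2) \<longlonglongrightarrow> (\<Sum>k\<in>F. (bracket k powr s * cmod (a t k))\<^sup>2)"
        by (intro tendsto_intros coef)
      moreover have "(\<Sum>k\<in>F. (bracket k powr s * cmod (a (X n) k))\<^sup>2) \<le> C\<^sup>2" for n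
        using finite_sum_le_infsum[OF sm[OF X(1)[of n], unfolded sobolev_summable_def] F] Xs[of n] unfolding sobolev_sq_def by fastforce
      ultimately show "(\<Sum>k\<in>F. (bracket k powr s * cmod (a t k))\<^sup>2) \<le> C\<^sup>2"
        by (intro LIMSEQ_le_const2) auto
    qed
  qed
  define A where "A = C\<^sup>2 + K"
  have A: "wiener (a t) \<le> A" if "t \<in> {0..T}" for t
    using sobolev_imp_wiener(2)[OF s sm[OF that]] bound[OF that] by (simp add: A_def K_def)
  define g where "g t x = frechet_derivative (\<theta> t) (at x) (brinkman_velocity \<nu> (\<theta> t) x)" for t x
  have g: "of_real (g t x) = trig_series (transport \<nu> (a t) (a t)) x"
      "(\<lambda>k. cmod (transport \<nu> (a t) (a t) k)) summable_on UNIV" "\<bar>g t x\<bar> \<le> 2 * A\<^sup>2" if t: "t \<in> {0..T}" for t x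
  proof -
    note adv = advection_term[OF \<nu> diff[OF t] per[OF t] w[OF t, unfolded a_def], folded a_def]
    show "of_real (g t x) = trig_series (transport \<nu> (a t) (a t)) x" unfolding g_def by (rule adv(1))
    show "(\<lambda>k. cmod (transport \<nu> (a t) (a t) k)) summable_on UNIV" by (rule adv(2))
    have "(wiener (a t))\<^sup>2 \<le> A\<^sup>2" by (intro power_mono A t wiener_nonneg)
    then show "\<bar>g t x\<bar> \<le> 2 * A\<^sup>2" using adv(3)[of x] unfolding g_def by linarith
  qed
  have deriv: "((\<lambda>\<tau>. a \<tau> k) has_vector_derivative - transport \<nu> (a t) (a t) k) (at t within {0..T})" if t: "t \<in> {0..T}" for t k
  proof (rule has_vector_derivative_sequentially)
    fix X :: "nat \<Rightarrow> real" assume X: "\<And>n. X n \<in> {0..T} - {t}" "X \<longlonglongrightarrow> t"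
    have XT: "X n \<in> {0..T}" "X n \<noteq> t" for n using X(1)[of n] by auto
    \<comment> \<open>the difference quotients, dominated through the mean value theorem\<close>
    define q where "q n x = (\<theta> (X n) x - \<theta> t x) / (X n - t)" for n x
    have ci: "integrable (torus) (\<lambda>x. of_real (\<theta> u x) * cnj (torus_char k x))" if "u \<in> {0..T}" for u
      by (intro integrable_continuous_torus_cell continuous_intros continuous_on_subset[OF cont[OF that] subset_UNIV])
    have q: "fourier_coeff (q n) k = (a (X n) k - a t k) /\<^sub>R (X n - t)" for n
    proof -
      have "(LINT x|torus. of_real (q n x) * cnj (torus_char k x))
        = (LINT x|torus. (of_real (\<theta> (X n) x) * cnj (torus_char k x) - of_real (\<theta> t x) * cnj (torus_char k x)) / of_real (X n - t))"
        by (intro Bochner_Integration.integral_cong refl) (simp add: q_def left_diff_distrib)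
      also have "\<dots> = ((LINT x|torus. of_real (\<theta> (X n) x) * cnj (torus_char k x))
          - (LINT x|torus. of_real (\<theta> t x) * cnj (torus_char k x))) / of_real (X n - t)"
        by (subst integral_divide_zero, subst Bochner_Integration.integral_diff[OF ci[OF XT(1)] ci[OF t]]) simp
      finally have I: "(LINT x|torus. of_real (q n x) * cnj (torus_char k x))
        = ((LINT x|torus. of_real (\<theta> (X n) x) * cnj (torus_char k x))
          - (LINT x|torus. of_real (\<theta> t x) * cnj (torus_char k x))) / of_real (X n - t)" .
      have "(y - z) / of_real d / p = (y / p - z / p) /\<^sub>R d" for y z p :: complex and d :: real
        by (simp add: scaleR_conv_of_real divide_inverse left_diff_distrib right_diff_distrib mult_ac)
      then show ?thesis unfolding fourier_coeff_def a_def I .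
    qed
    have "(\<lambda>n. fourier_coeff (q n) k) \<longlonglongrightarrow> fourier_coeff (\<lambda>x. - g t x) k"
    proof (rule fourier_coeff_tendsto)
      show "continuous_on UNIV (q n)" for n
        unfolding q_def using XT[of n] by (intro continuous_intros cont t) auto
      show "(\<lambda>n. q n x) \<longlonglongrightarrow> - g t x" for x
      proof -
        have "((\<lambda>u. (\<theta> u x - \<theta> t x) / (u - t)) \<longlongrightarrow> - g t x) (at t within {0..T})"
          using eq[OF t, of x] unfolding has_field_derivative_iff g_def .
        then show ?thesis using X unfolding tendsto_at_iff_sequentially o_def q_def by blast
      qed
      show "\<bar>q n x\<bar> \<le> 2 * A\<^sup>2" for n x
      proof -
        have "norm (\<theta> (X n) x - \<theta> t x) \<le> 2 * A\<^sup>2 * norm (X n - t)"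
        proof (rule field_differentiable_bound[of "{0..T}"])
          show "((\<lambda>\<tau>. \<theta> \<tau> x) has_real_derivative - g u x) (at u within {0..T})" if "u \<in> {0..T}" for u
            using eq[OF that, of x] by (simp add: g_def)
          show "norm (- g u x) \<le> 2 * A\<^sup>2" if "u \<in> {0..T}" for u using g(3)[OF that] by simp
        qed (use XT t in auto)
        then show ?thesis using XT(2)[of n] by (simp add: q_def pos_divide_le_eq)
      qed
    qed
    moreover have "fourier_coeff (\<lambda>x. - g t x) k = - transport \<nu> (a t) (a t) k"
      using fourier_coeff_trig_series[of _ "g t" k, OF g(2)[OF t] g(1)[OF t]] unfolding fourier_coeff_def by simp
    ultimately show "(\<lambda>n. (a (X n) k - a t k) /\<^sub>R (X n - t)) \<longlonglongrightarrow> - transport \<nu> (a t) (a t) k"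
      by (simp add: q)
  qed
  show ?thesis
    unfolding coefficient_solution_def a_def[symmetric]
    using sm deriv bound hermitian_fourier_coeff[of "\<theta> _", folded a_def] by blast
qed

section \<open>The limit of vanishing Brinkman parameter\<close>

theorem theorem6p11:
  fixes s T :: real
    and \<theta>0 :: "real^2 \<Rightarrow> real"
    and \<theta> :: "real \<Rightarrow> real \<Rightarrow> real^2 \<Rightarrow> real"
  assumes "s > 2"
    and "in_sobolev s \<theta>0"
    and "zero_mean \<theta>0"
    and "T > 0"
    and "IPMB_solution 0 s T \<theta>0 (\<theta> 0)"
    and "\<And>\<nu>. \<nu> > 0 \<Longrightarrow> IPMB_solution \<nu> s T \<theta>0 (\<theta> \<nu>)"
  shows "\<forall>t\<in>{0..T}.
    ((\<lambda>\<nu>. sobolev_norm (s - 1) (\<lambda>x. \<theta> \<nu> t x - \<theta> 0 t x)) \<longlongrightarrow> 0) (at_right 0)"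
proof
  fix t assume t: "t \<in> {0..T}"
  have sol: "IPMB_solution \<nu> s T \<theta>0 (\<theta> \<nu>)" if "0 \<le> \<nu>" for \<nu>
    using assms(5,6) that by (cases "\<nu> = 0") auto
  have cont: "continuous_on UNIV (\<theta> \<nu> t)" if "0 \<le> \<nu>" "t \<in> {0..T}" for \<nu> t
  proof -
    have "\<theta> \<nu> t differentiable (at x)" for x
      using sol[OF that(1)] that(2) by (auto simp: IPMB_solution_def)
    then show ?thesis using differentiable_imp_continuous_within continuous_at_imp_continuous_on by blast
  qed
  have init: "fourier_coeff (\<theta> \<nu> 0) k = fourier_coeff \<theta>0 k" if "0 \<le> \<nu>" for \<nu> k
  proof -
    have c0: "continuous_on torus_cell (\<theta> \<nu> 0)" using continuous_on_subset[OF cont[OF that] subset_UNIV] \<open>T > 0\<close> by simp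
    have "AE x in torus. \<theta> \<nu> 0 x = \<theta>0 x"
      using sol[OF that] by (subst AE_restrict_space_iff) (auto simp: IPMB_solution_def elim: eventually_mono)
    moreover have "\<theta>0 \<in> borel_measurable (torus)"
      using assms(2) by (simp add: in_sobolev_def torus_L2_def)
    moreover have "\<theta> \<nu> 0 \<in> borel_measurable (torus)"
      by (intro borel_measurable_integrable integrable_continuous_torus_cell c0)
    moreover have "(\<lambda>x. cnj (torus_char k x)) \<in> borel_measurable (torus)"
      by (intro borel_measurable_integrable integrable_continuous_torus_cell continuous_intros)
    ultimately have "(LINT x|torus. of_real (\<theta> \<nu> 0 x) * cnj (torus_char k x))
       = (LINT x|torus. of_real (\<theta>0 x) * cnj (torus_char k x))"
      by (intro integral_cong_AE borel_measurable_times measurable_compose[OF _ borel_measurable_of_real]) (auto elim: eventually_mono)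
    then show ?thesis by (simp add: fourier_coeff_def)
  qed
  have "((\<lambda>\<nu>. sobolev_sq (s - 1) (\<lambda>k. fourier_coeff (\<theta> \<nu> t) k - fourier_coeff (\<theta> 0 t) k)) \<longlongrightarrow> 0) (at_right 0)"
  proof (rule coefficient_convergence[where s = s and T = T and c = "\<lambda>t. fourier_coeff (\<theta> 0 t)" and a = "\<lambda>\<nu> t. fourier_coeff (\<theta> \<nu> t)"])
    show "coefficient_solution 0 s T (\<lambda>t. fourier_coeff (\<theta> 0 t))"
      using solution_coefficients[OF sol] assms by simp
    show "coefficient_solution \<nu> s T (\<lambda>t. fourier_coeff (\<theta> \<nu> t))" if "0 < \<nu>" for \<nu>
      using solution_coefficients[OF sol, of \<nu>] assms that by simp
    show "fourier_coeff (\<theta> \<nu> 0) = fourier_coeff (\<theta> 0 0)" if "0 < \<nu>" for \<nu>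
      using that by (simp add: fun_eq_iff init)
  qed (use assms t in auto)
  then have "((\<lambda>\<nu>. sqrt (sobolev_sq (s - 1) (\<lambda>k. fourier_coeff (\<theta> \<nu> t) k - fourier_coeff (\<theta> 0 t) k))) \<longlongrightarrow> sqrt 0) (at_right 0)"
    by (rule tendsto_real_sqrt)
  then have "((\<lambda>\<nu>. sqrt (sobolev_sq (s - 1) (\<lambda>k. fourier_coeff (\<theta> \<nu> t) k - fourier_coeff (\<theta> 0 t) k))) \<longlongrightarrow> 0) (at_right 0)"
    by simp
  then show "((\<lambda>\<nu>. sobolev_norm (s - 1) (\<lambda>x. \<theta> \<nu> t x - \<theta> 0 t x)) \<longlongrightarrow> 0) (at_right 0)"
  proof (rule Lim_transform_eventually)
    show "\<forall>\<^sub>F \<nu> in at_right 0. sqrt (sobolev_sq (s - 1) (\<lambda>k. fourier_coeff (\<theta> \<nu> t) k - fourier_coeff (\<theta> 0 t) k))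
        = sobolev_norm (s - 1) (\<lambda>x. \<theta> \<nu> t x - \<theta> 0 t x)"
      using eventually_at_right_less[of "0::real"]
    proof eventually_elim
      case (elim \<nu>)
      have "integrable (torus) (\<lambda>x. of_real (\<theta> \<mu> t x) * cnj (torus_char k x))" if "0 \<le> \<mu>" for \<mu> k
        by (intro integrable_continuous_torus_cell continuous_intros continuous_on_subset[OF cont[OF that t] subset_UNIV])
      then have "fourier_coeff (\<lambda>x. \<theta> \<nu> t x - \<theta> 0 t x) = (\<lambda>k. fourier_coeff (\<theta> \<nu> t) k - fourier_coeff (\<theta> 0 t) k)"
        using elim by (simp add: fun_eq_iff fourier_coeff_def left_diff_distrib diff_divide_distrib)
      then show ?case by (simp add: sobolev_norm_eq)
    qed
  qed
qed

end
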